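(* Connected Locally Minimal Defensive Alliance parameterized by the solution size $k$ and maximum degree $\Delta$ admits an FPT algorithm.
   Context: Let $G=(V,E)$ be a finite, simple, undirected graph. For $D\subseteq V$ and $v\in V$, let $d_D(v)$ denote the number of neighbours of $v$ in $D$, and $D^c=V\setminus D$. A non-empty set $D\subseteq V$ is a defensive alliance in $G$ if for each $v\in D$, $d_D(v)+1\geq d_{D^c}(v)$. A defensive alliance is connected if it induces a connected subgraph. A connected defensive alliance $D$ is a connected locally minimal defensive alliance if for every $v\in D$, $D\setminus\{v\}$ is not a connected defensive alliance. The problem Connected Locally Minimal Defensive Alliance is: given a graph $G$ and an integer $k$, does $G$ have a connected locally minimal defensive alliance of size at least $k$? $\Delta$ denotes the maximum degree of $G$. *)

theory Defs
  imports "Graph_Theory.Graph_Theory" "HOL-Library.Discrete_Functions"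
begin

text \<open>
  Random access machines with uniform cost measure (every instruction costs one step), as commonly
  used to define fixed-parameter tractability. Registers hold natural numbers. As addition is the
  only operation that increases values, and so lengthens them by at most one bit per step, running
  times agree with those of Turing machines up to a polynomial. \<open>Sub\<close> is truncated at \<open>0\<close>.
\<close>

datatype instr =
    Const nat nat
  | Add nat nat nat
  | Sub nat nat nat
  | Half nat nat
  | Load nat nat
  | Store nat nat
  | Jump nat
  | JumpZero nat nat

type_synonym config = "nat \<times> (nat \<Rightarrow> nat)"

fun exec :: "instr \<Rightarrow> config \<Rightarrow> config" where
  "exec (Const i c) (pc, R) = (Suc pc, R(i := c))"
| "exec (Add i j l) (pc, R) = (Suc pc, R(i := R j + R l))"
| "exec (Sub i j l) (pc, R) = (Suc pc, R(i := R j - R l))"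
| "exec (Half i j) (pc, R) = (Suc pc, R(i := R j div 2))"
| "exec (Load i j) (pc, R) = (Suc pc, R(i := R (R j)))"
| "exec (Store i j) (pc, R) = (Suc pc, R(R i := R j))"
| "exec (Jump p) (pc, R) = (p, R)"
| "exec (JumpZero i p) (pc, R) = (if R i = 0 then p else Suc pc, R)"

definition halted :: "instr list \<Rightarrow> config \<Rightarrow> bool" where
  "halted P s \<longleftrightarrow> length P \<le> fst s"

definition step :: "instr list \<Rightarrow> config \<Rightarrow> config" where
  "step P s = (if halted P s then s else exec (P ! fst s) s)"

text \<open>Register \<open>0\<close> initially holds the number of input items, which follow from register \<open>1\<close> on.\<close>

definition init_config :: "nat list \<Rightarrow> config" where
  "init_config xs =
     (0, \<lambda>r. if r = 0 then length xs else if r \<le> length xs then xs ! (r - 1) else 0)"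

text \<open>The program halts on the input after at most \<open>t\<close> steps, with output \<open>y\<close> in register \<open>0\<close>.\<close>

definition outputs_within :: "instr list \<Rightarrow> nat list \<Rightarrow> nat \<Rightarrow> nat \<Rightarrow> bool" where
  "outputs_within P xs t y \<longleftrightarrow>
     (let s = (step P ^^ t) (init_config xs) in halted P s \<and> snd s 0 = y)"

definition computable :: "(nat \<Rightarrow> nat) \<Rightarrow> bool" where
  "computable f \<longleftrightarrow> (\<exists>P. \<forall>n. \<exists>t. outputs_within P [n] t (f n))"

text \<open>Total length of the binary representations of the input items.\<close>

definition input_size :: "nat list \<Rightarrow> nat" where
  "input_size xs = (\<Sum>x\<leftarrow>xs. floor_log x + 1)"

text \<open>
  The decision problem \<open>Q\<close> on the instances \<open>I\<close>, presented to the machine via \<open>enc\<close>, is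
  fixed-parameter tractable for the parameter \<open>\<kappa>\<close>: a single program decides it in time
  \<open>f(\<kappa>(x)) * |x|^c\<close>.
\<close>

definition fixed_parameter_tractable ::
    "'i set \<Rightarrow> ('i \<Rightarrow> nat list) \<Rightarrow> ('i \<Rightarrow> bool) \<Rightarrow> ('i \<Rightarrow> nat) \<Rightarrow> bool" where
  "fixed_parameter_tractable I enc Q \<kappa> \<longleftrightarrow>
     (\<exists>P f c. computable f \<and>
        (\<forall>x\<in>I. outputs_within P (enc x) (f (\<kappa> x) * input_size (enc x) ^ c)
                  (if Q x then 1 else 0)))"

text \<open>
  A finite simple undirected graph is a \<^locale>\<open>pair_graph\<close>: its arc relation is finite, symmetric and
  irreflexive.
\<close>

definition nbrs_in :: "'a pair_pre_digraph \<Rightarrow> 'a set \<Rightarrow> 'a \<Rightarrow> nat" where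
  "nbrs_in G D v = card {u \<in> D. (v, u) \<in> parcs G}"

definition max_degree :: "'a pair_pre_digraph \<Rightarrow> nat" where
  "max_degree G = Max (insert 0 (nbrs_in G (pverts G) ` pverts G))"

definition defensive_alliance :: "'a pair_pre_digraph \<Rightarrow> 'a set \<Rightarrow> bool" where
  "defensive_alliance G D \<longleftrightarrow>
     D \<noteq> {} \<and> D \<subseteq> pverts G \<and> (\<forall>v\<in>D. nbrs_in G D v + 1 \<ge> nbrs_in G (pverts G - D) v)"

definition connected_defensive_alliance :: "'a pair_pre_digraph \<Rightarrow> 'a set \<Rightarrow> bool" where
  "connected_defensive_alliance G D \<longleftrightarrow>
     defensive_alliance G D \<and> Digraph_Component.connected (with_proj G \<restriction> D)"

definition connected_locally_minimal_defensive_alliance ::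
    "'a pair_pre_digraph \<Rightarrow> 'a set \<Rightarrow> bool" where
  "connected_locally_minimal_defensive_alliance G D \<longleftrightarrow>
     connected_defensive_alliance G D \<and>
     (\<forall>v\<in>D. \<not> connected_defensive_alliance G (D - {v}))"

text \<open>As usual for algorithmic problems, the vertices of an input graph are \<open>0, \<dots>, n - 1\<close>.\<close>

definition clmda_instances :: "(nat pair_pre_digraph \<times> nat) set" where
  "clmda_instances = {(G, k). pair_graph G \<and> (\<exists>n. pverts G = {..<n})}"

text \<open>The number of vertices, the number \<open>k\<close>, and the adjacency matrix row by row.\<close>

definition encode_instance :: "nat pair_pre_digraph \<times> nat \<Rightarrow> nat list" where
  "encode_instance = (\<lambda>(G, k). let n = card (pverts G) in
     n # k # [if (u, v) \<in> parcs G then 1 else 0. u \<leftarrow> [0..<n], v \<leftarrow> [0..<n]])"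

definition CLMDA :: "nat pair_pre_digraph \<times> nat \<Rightarrow> bool" where
  "CLMDA = (\<lambda>(G, k).
     \<exists>D. connected_locally_minimal_defensive_alliance G D \<and> k \<le> card D)"

end

theory Submission
  imports Defs "HOL-Library.Nat_Bijection"
begin

text \<open>
  Call a vertex of an alliance marginal if it cannot afford to lose a neighbour in the alliance.
  Let \<open>D\<close> be a connected locally minimal alliance. The vertex of \<open>D\<close> farthest from a given \<open>a \<in> D\<close> is
  no cut vertex of \<open>D\<close>, so it has a marginal neighbour \<open>u\<close>. Either \<open>u\<close> has a marginal neighbour
  itself, or \<open>u\<close> is a cut vertex that separates from \<open>a\<close> only neighbours of \<open>u\<close>. In both cases a part
  of \<open>D\<close> next to \<open>u\<close> protects itself: it survives when vertices are deleted one by one from any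
  connected alliance that looks like \<open>D\<close> near \<open>u\<close>. So either \<open>D\<close> has radius at most \<open>k + 3\<close>, or it
  contains two such parts at distance at least \<open>k\<close>, and every connected set that keeps both has at
  least \<open>k\<close> vertices.

  This yields the algorithm. Guess two vertices \<open>a\<close>, \<open>b\<close> and the set \<open>F\<close> of vertices not in \<open>D\<close> at
  distance at most \<open>k + 4\<close> from them; there are at most \<open>n\<^sup>2 * 2 ^ (2 * (\<Delta> + 1) ^ (k + 4))\<close> guesses.
  As alliances are closed under union, the largest alliance that avoids \<open>F\<close> is found by deleting
  undefended vertices, and it contains \<open>D\<close>. Delete vertices from its component of \<open>a\<close> as long as the
  rest is a connected alliance; the result is locally minimal, and it has at least \<open>k\<close> vertices if the
  guess was right.
\<close>

section \<open>Locally minimal alliances\<close>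

text \<open>Alliances are not closed under subsets, so greedy deletion can get stuck anywhere,
  possibly below size k; no statement about one fixed order of deletions would be robust. Hence
  deletion is a relation, \<open>rem\<close>, and every result about it holds for all orders.
  Whether an anchor (a marginal vertex with some of its neighbours) survives depends only on the
  neighbours of the anchor itself. This locality is why it suffices to guess the alliance in a ball
  of bounded radius, although the starting set may differ from it arbitrarily farther out.
  Tractability is stated for a concrete register machine without multiplication. The algorithm is
  therefore written in a language of bounded loops, whose compiler is proved correct with exact step
  counts, and the factor that depends on the parameter needs a program of its own, since it has to
  be computable.\<close>

locale ugraph =
  fixes V :: "'a set" and E :: "'a \<Rightarrow> 'a \<Rightarrow> bool"
  assumes finite_V: "finite V"
    and E_sym: "E u v \<Longrightarrow> E v u"
    and E_V: "E u v \<Longrightarrow> u \<in> V"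
    and E_irrefl: "\<not> E u u"
begin

section \<open>Alliances, connectedness and single deletions\<close>

definition nb :: "'a set \<Rightarrow> 'a \<Rightarrow> nat" where
  "nb X v = card {u \<in> X. E v u}"

text \<open>As \<open>nb V v\<close> counts the neighbours inside and outside \<open>X\<close>
  together, this is the failure of the alliance condition at \<open>v\<close>. With the total degree
  on the right it is visibly antitone in \<open>X\<close>.\<close>

definition undefended :: "'a set \<Rightarrow> 'a \<Rightarrow> bool" where
  "undefended X v \<longleftrightarrow> 2 * nb X v + 1 < nb V v"

definition da :: "'a set \<Rightarrow> bool" where
  "da X \<longleftrightarrow> X \<subseteq> V \<and> (\<forall>v\<in>X. \<not> undefended X v)"

text \<open>A union of connected components of the subgraph induced by \<open>X\<close>.
  Connectedness through such sets avoids walks: a proof exhibits a set and checks single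
  edges.\<close>

definition closed_in :: "'a set \<Rightarrow> 'a set \<Rightarrow> bool" where
  "closed_in X S \<longleftrightarrow> S \<subseteq> X \<and> (\<forall>x\<in>S. \<forall>y\<in>X. E x y \<longrightarrow> y \<in> S)"

definition conn :: "'a set \<Rightarrow> bool" where
  "conn X \<longleftrightarrow> X \<noteq> {} \<and> (\<forall>S. closed_in X S \<and> S \<noteq> {} \<longrightarrow> S = X)"

definition cda :: "'a set \<Rightarrow> bool" where
  "cda X \<longleftrightarrow> da X \<and> conn X"

definition loc_min :: "'a set \<Rightarrow> bool" where
  "loc_min X \<longleftrightarrow> cda X \<and> (\<forall>v\<in>X. \<not> cda (X - {v}))"

definition rem :: "('a \<Rightarrow> 'a set \<Rightarrow> bool) \<Rightarrow> 'a set \<Rightarrow> 'a set \<Rightarrow> bool" where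
  "rem P X Y \<longleftrightarrow> (\<exists>v\<in>X. P v X \<and> Y = X - {v})"

abbreviation shrinks_to :: "'a set \<Rightarrow> 'a set \<Rightarrow> bool" where
  "shrinks_to \<equiv> (rem (\<lambda>v X. cda (X - {v})))\<^sup>*\<^sup>*"

lemma conn_rootI:
  assumes "a \<in> X" "\<And>S. closed_in X S \<Longrightarrow> a \<in> S \<Longrightarrow> S = X"
  shows "conn X"
  unfolding conn_def
proof (intro conjI allI impI)
  fix S assume S: "closed_in X S \<and> S \<noteq> {}"
  show "S = X"
  proof (cases "a \<in> S")
    case False
    have "closed_in X (X - S)"
      using S E_sym unfolding closed_in_def by blast
    then have "X - S = X" using assms False by blast
    then show ?thesis using S unfolding closed_in_def by blast
  qed (use S assms in blast)
qed (use assms in auto)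

lemma conn_closedD: "conn X \<Longrightarrow> closed_in X S \<Longrightarrow> a \<in> S \<Longrightarrow> S = X"
  unfolding conn_def by blast

lemma finite_nbrs: "finite {u \<in> X. E v u}"
  by (rule finite_subset[OF _ finite_V]) (auto dest: E_sym E_V)

lemma nb_mono: "X \<subseteq> Y \<Longrightarrow> nb X v \<le> nb Y v"
  unfolding nb_def by (intro card_mono finite_nbrs) auto

lemma nb_remove: "E v z \<Longrightarrow> z \<in> X \<Longrightarrow> nb X v = Suc (nb (X - {z}) v)"
proof -
  assume "E v z" "z \<in> X"
  then have "{u \<in> X. E v u} = insert z {u \<in> X - {z}. E v u}" by auto
  then have "nb X v = card (insert z {u \<in> X - {z}. E v u})" unfolding nb_def by simp
  also have "\<dots> = Suc (nb (X - {z}) v)"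
    unfolding nb_def by (rule card_insert_disjoint) (rule finite_nbrs, simp)
  finally show ?thesis .
qed

lemma nb_remove_le: "nb X v \<le> Suc (nb (X - {z}) v)"
proof (cases "E v z \<and> z \<in> X")
  case False
  then have "{u \<in> X - {z}. E v u} = {u \<in> X. E v u}" by auto
  then show ?thesis unfolding nb_def by simp
qed (use nb_remove in auto)

lemma nb_remove_non_nbr: "\<not> E v z \<Longrightarrow> nb (X - {z}) v = nb X v"
  unfolding nb_def by (rule arg_cong[where f = card]) auto

lemma undefended_anti: "X \<subseteq> Y \<Longrightarrow> undefended Y v \<Longrightarrow> undefended X v"
  using nb_mono[of X Y v] unfolding undefended_def by linarith

section \<open>Distances in induced subgraphs\<close>

text \<open>Breadth-first distance from \<open>a\<close> within \<open>X\<close>, pinned down by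
  edgewise conditions instead of shortest walks. Nothing is said about values outside
  \<open>X\<close>.\<close>

definition is_dist :: "'a set \<Rightarrow> 'a \<Rightarrow> ('a \<Rightarrow> nat) \<Rightarrow> bool" where
  "is_dist X a d \<longleftrightarrow> d a = 0 \<and> (\<forall>x\<in>X. \<forall>y\<in>X. E x y \<longrightarrow> d y \<le> Suc (d x)) \<and>
     (\<forall>y\<in>X - {a}. \<exists>x\<in>X. E x y \<and> d y = Suc (d x))"

fun lev :: "'a set \<Rightarrow> nat \<Rightarrow> 'a set \<Rightarrow> 'a set" where
  "lev X 0 S = S"
| "lev X (Suc j) S = lev X j S \<union> {y \<in> X. \<exists>x\<in>lev X j S. E x y}"

lemma lev_mono: "i \<le> j \<Longrightarrow> lev X i S \<subseteq> lev X j S"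
  by (induction j) (auto simp: le_Suc_eq)

text \<open>The union of the breadth-first levels is closed, so the levels exhaust \<open>X\<close>;
  the distance is the index of the first level that contains the vertex.\<close>

lemma dist_exists:
  assumes "conn X" "a \<in> X"
  obtains d where "is_dist X a d"
proof -
  let ?L = "\<lambda>j. lev X j {a}"
  have sub: "?L j \<subseteq> X" for j by (induction j) (use assms in auto)
  have "closed_in X (\<Union>j. ?L j)"
    unfolding closed_in_def
  proof (intro conjI ballI impI)
    fix x y assume "x \<in> (\<Union>j. ?L j)" "y \<in> X" "E x y"
    then obtain j where "x \<in> ?L j" by blast
    then have "y \<in> ?L (Suc j)" using \<open>y \<in> X\<close> \<open>E x y\<close> by auto
    then show "y \<in> (\<Union>j. ?L j)" by blast
  qed (use sub in blast)
  moreover have "a \<in> (\<Union>j. ?L j)"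
    by (rule UN_I[of 0]) auto
  ultimately have all: "(\<Union>j. ?L j) = X" using conn_closedD[OF assms(1)] by blast
  define d where "d y = (LEAST j. y \<in> ?L j)" for y
  have dL: "y \<in> ?L (d y)" if "y \<in> X" for y
    unfolding d_def using that all by (metis (no_types, lifting) LeastI UN_E)
  have d_le: "y \<in> ?L j \<Longrightarrow> d y \<le> j" for y j
    unfolding d_def by (rule Least_le)
  have "d a = 0" using d_le[of a 0] by simp
  moreover have "d y \<le> Suc (d x)" if "x \<in> X" "y \<in> X" "E x y" for x y
    by (rule d_le) (use dL that in auto)
  moreover have "\<exists>x\<in>X. E x y \<and> d y = Suc (d x)" if y: "y \<in> X - {a}" for y
  proof -
    have "d y \<noteq> 0" using dL[of y] y by (auto intro!: gr0I)
    then obtain j where j: "d y = Suc j" using not0_implies_Suc by blast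
    have "y \<notin> ?L j" using d_le[of y j] j by auto
    then obtain x where x: "x \<in> ?L j" "E x y" using dL[of y] y unfolding j by auto
    then have "d x \<le> j" "x \<in> X" using d_le sub by blast+
    moreover have "d y \<le> Suc (d x)"
      by (rule d_le) (use dL[of x] y x calculation in auto)
    ultimately show ?thesis using x j by (intro bexI[of _ x]) auto
  qed
  ultimately have "is_dist X a d" unfolding is_dist_def by blast
  then show ?thesis by (rule that)
qed

section \<open>Marginal vertices and anchors\<close>

text \<open>Equivalent to \<open>2 * nb X u \<le> nb V u\<close>: with one neighbour fewer in
  \<open>X\<close>, the vertex is undefended.\<close>

definition marginal :: "'a set \<Rightarrow> 'a \<Rightarrow> bool" where
  "marginal X u \<longleftrightarrow> 2 * nb X u < nb V u + 1"

text \<open>The self-protecting part of an alliance. The two alternatives at the end correspond to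
  the two cases in the proof of \<open>farthest_anchor\<close>.\<close>

definition anchor :: "'a set \<Rightarrow> 'a \<Rightarrow> 'a set \<Rightarrow> bool" where
  "anchor D u K \<longleftrightarrow> u \<in> D \<and> marginal D u \<and> K \<noteq> {} \<and> K \<subseteq> D \<and> (\<forall>w\<in>K. E u w) \<and>
     ((\<exists>w\<in>K. marginal D w) \<or> (\<forall>w\<in>K. \<forall>x\<in>D. E w x \<longrightarrow> x \<in> insert u K))"

lemma not_undefended_remove:
  assumes "\<not> undefended X v" "\<not> (marginal X v \<and> E v z)"
  shows "\<not> undefended (X - {z}) v"
  using assms nb_remove_le[of X v z] nb_remove_non_nbr[of v z X]
  unfolding undefended_def marginal_def by (cases "E v z") auto

text \<open>Distances decrease strictly along a chain of predecessors down to \<open>a\<close>, so a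
  chain that starts elsewhere never meets a vertex of maximal distance.\<close>

lemma farthest_remove_conn:
  assumes "is_dist D a d" "a \<in> D" "v \<noteq> a" "\<And>x. x \<in> D \<Longrightarrow> d x \<le> d v"
  shows "conn (D - {v})"
proof (rule conn_rootI)
  fix S assume S: "closed_in (D - {v}) S" "a \<in> S"
  have "y \<in> D - {v} \<Longrightarrow> d y = m \<Longrightarrow> y \<in> S" for y m
  proof (induction m arbitrary: y)
    case 0
    then show ?case using assms(1) S(2) unfolding is_dist_def
      by (metis DiffE DiffI insertE nat.distinct(1) singletonI empty_iff)
  next
    case (Suc m)
    show ?case
    proof (cases "y = a")
      case False
      then obtain x where x: "x \<in> D" "E x y" "d y = Suc (d x)"
        using assms(1) Suc.prems unfolding is_dist_def by blast
      have "d y \<le> d v" using assms(4) Suc.prems by blast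
      then have "x \<noteq> v" using x by auto
      then have "x \<in> S" using Suc x by simp
      then show ?thesis using S(1) x Suc.prems unfolding closed_in_def by blast
    qed (use S in simp)
  qed
  then show "S = D - {v}" using S unfolding closed_in_def by blast
qed (use assms in auto)

text \<open>
  The vertex \<open>v\<close> farthest from \<open>a\<close> is no cut vertex of \<open>D\<close>, so it has a marginal neighbour \<open>u\<close>.
  If no neighbour of \<open>u\<close> is marginal, then \<open>u\<close> is a cut vertex, and since \<open>v\<close> is farthest, all
  vertices that \<open>u\<close> separates from \<open>a\<close> are adjacent to \<open>u\<close>.
\<close>

lemma farthest_anchor:
  assumes D: "loc_min D" and d: "is_dist D a d" and a: "a \<in> D" and v: "v \<in> D" "3 \<le> d v"
    and far: "\<And>x. x \<in> D \<Longrightarrow> d x \<le> d v"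
  obtains u K where "anchor D u K" "a \<notin> insert u K" "d v \<le> Suc (d u)"
proof -
  have D': "D \<subseteq> V" "conn D" "\<And>x. x \<in> D \<Longrightarrow> \<not> undefended D x"
    using D unfolding loc_min_def cda_def da_def by auto
  have da0: "d a = 0" and dstep: "\<And>x y. x \<in> D \<Longrightarrow> y \<in> D \<Longrightarrow> E x y \<Longrightarrow> d y \<le> Suc (d x)"
    and dpred: "\<And>y. y \<in> D \<Longrightarrow> y \<noteq> a \<Longrightarrow> \<exists>x\<in>D. E x y \<and> d y = Suc (d x)"
    using d unfolding is_dist_def by auto
  have "v \<noteq> a" using da0 v by auto
  then have "conn (D - {v})" using farthest_remove_conn[OF d a _ far] by blast
  then have "\<not> da (D - {v})" using D v unfolding loc_min_def cda_def by blast
  then obtain u where u: "u \<in> D" "u \<noteq> v" "undefended (D - {v}) u"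
    using D' unfolding da_def by blast
  then have mu: "marginal D u" "E u v" using not_undefended_remove D'(3) by blast+
  have du: "d v \<le> Suc (d u)" using dstep u mu v by blast
  show ?thesis
  proof (cases "\<exists>w\<in>D. E u w \<and> marginal D w")
    case True
    then obtain w where w: "w \<in> D" "E u w" "marginal D w" by blast
    \<comment> \<open>As \<open>d v\<close> is at least 3, \<open>u\<close> has distance at least 2
      and \<open>w\<close> at least 1, so neither is \<open>a\<close>.\<close>
    have "d u \<le> Suc (d w)" using dstep E_sym w u by blast
    then have "a \<notin> insert u {w}" using du v da0 by auto
    moreover have "anchor D u {w}" unfolding anchor_def using u w mu by auto
    ultimately show ?thesis using that du by blast
  next
    case False
    then have "\<not> undefended (D - {u}) x" if "x \<in> D" for x
      using not_undefended_remove D'(3) E_sym that by blast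
    then have "da (D - {u})" using D'(1) unfolding da_def by blast
    then have nc: "\<not> conn (D - {u})" using D u unfolding loc_min_def cda_def by blast
    have "a \<noteq> u" using du da0 v by auto
    then obtain S where S: "closed_in (D - {u}) S" "a \<in> S" "S \<noteq> D - {u}"
      using nc conn_rootI[of a "D - {u}"] a by blast
    define K where "K = D - {u} - S"
    have K: "K \<noteq> {}" "K \<subseteq> D" "a \<notin> insert u K"
      using S \<open>a \<noteq> u\<close> unfolding K_def closed_in_def by auto
    have Kcl: "x \<in> insert u K" if "w \<in> K" "x \<in> D" "E w x" for w x
      using S that E_sym unfolding K_def closed_in_def by blast
    \<comment> \<open>A chain of predecessors from \<open>K\<close> to \<open>a\<close> can leave
      \<open>K\<close> only through \<open>u\<close>, so all of \<open>K\<close> lies beyond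
      \<open>u\<close>.\<close>
    have Kd: "w \<in> K \<Longrightarrow> d w = m \<Longrightarrow> Suc (d u) \<le> m" for w m
    proof (induction m arbitrary: w rule: less_induct)
      case (less m)
      have "w \<in> D" "w \<noteq> a" using less K by auto
      then obtain x where x: "x \<in> D" "E x w" "d w = Suc (d x)" using dpred by blast
      then have "x \<in> insert u K" using Kcl less.prems E_sym by blast
      then show ?case using less x by fastforce
    qed
    have "E u w" if w: "w \<in> K" for w
    proof -
      have "w \<in> D" "w \<noteq> a" using w K by auto
      then obtain x where x: "x \<in> D" "E x w" "d w = Suc (d x)" using dpred by blast
      \<comment> \<open>Since \<open>v\<close> is farthest, \<open>K\<close> occupies just the level
        after \<open>u\<close>. The predecessor of \<open>w\<close> is one level lower, so it is
        outside \<open>K\<close>, and only \<open>u\<close> remains.\<close>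
      have "d w \<le> Suc (d u)" using far[OF \<open>w \<in> D\<close>] du by simp
      then have "x \<notin> K" using Kd[of x] x by auto
      then show ?thesis using Kcl[OF w x(1) E_sym[OF x(2)]] x(2) by blast
    qed
    then have "anchor D u K" unfolding anchor_def using u mu K Kcl by blast
    then show ?thesis using that K du by blast
  qed
qed

text \<open>
  While the vertices are deleted one by one, the vertices of \<open>K\<close> stay because \<open>u\<close> needs them, and
  \<open>u\<close> stays because it is needed by a marginal vertex of \<open>K\<close> or connects \<open>K\<close> to \<open>t\<close>.
\<close>

lemma anchor_step:
  assumes an: "anchor D u K"
    and loc: "\<And>w x. w \<in> insert u K \<Longrightarrow> x \<in> X \<Longrightarrow> E w x \<Longrightarrow> x \<in> D"
    and Y: "Y \<subseteq> X" "insert u K \<subseteq> Y" "t \<in> Y" "t \<notin> insert u K"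
    and z: "z \<in> Y" "cda (Y - {z})"
  shows "z \<notin> insert u K"
proof
  assume zK: "z \<in> insert u K"
  \<comment> \<open>All neighbours of \<open>m\<close> in \<open>Y\<close> belong to
    \<open>D\<close>, so \<open>m\<close> has no more defenders in \<open>Y\<close> than in
    \<open>D\<close> and cannot spare \<open>z\<close>.\<close>
  have marg: "\<not> E m z" if m: "m \<in> insert u K" "marginal D m" "m \<noteq> z" for m
  proof
    assume "E m z"
    have "{x \<in> Y. E m x} \<subseteq> {x \<in> D. E m x}" using loc m Y by blast
    then have "nb Y m \<le> nb D m" unfolding nb_def by (intro card_mono finite_nbrs)
    then have "nb Y m \<le> nb D m" "nb Y m = Suc (nb (Y - {z}) m)"
      using nb_remove[OF \<open>E m z\<close> z(1)] by auto
    then have "undefended (Y - {z}) m"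
      using m(2) unfolding undefended_def marginal_def by linarith
    then show False using z(2) m Y unfolding cda_def da_def by blast
  qed
  have u: "marginal D u" "\<And>w. w \<in> K \<Longrightarrow> E u w" "K \<noteq> {}"
    using an unfolding anchor_def by auto
  have "z = u" using zK u marg E_irrefl by blast
  moreover have "\<not> (\<exists>w\<in>K. marginal D w)"
    using marg u \<open>z = u\<close> E_sym E_irrefl by blast
  then have Kcl: "\<And>w x. w \<in> K \<Longrightarrow> x \<in> D \<Longrightarrow> E w x \<Longrightarrow> x \<in> insert u K"
    using an unfolding anchor_def by blast
  \<comment> \<open>Without \<open>u\<close>, the set \<open>K\<close> would be cut off from
    \<open>t\<close>.\<close>
  have "closed_in (Y - {u}) K"
    unfolding closed_in_def
  proof (intro conjI ballI impI)
    show "K \<subseteq> Y - {u}" using Y u E_irrefl by blast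
  next
    fix x y assume "x \<in> K" "y \<in> Y - {u}" "E x y"
    then show "y \<in> K" using Kcl loc Y(1) by blast
  qed
  ultimately have "K = Y - {u}" using z(2) u(3) unfolding cda_def conn_def by blast
  then show False using Y by blast
qed

text \<open>Distances within \<open>D\<close> are at least those in the whole graph, so balls of
  \<open>D\<close> lie in the guessed ball.\<close>

lemma dist_in_lev:
  assumes "is_dist D a d" "a \<in> S" "w \<in> D" "d w \<le> j"
  shows "w \<in> lev V j S"
  using assms(3,4)
proof (induction j arbitrary: w)
  case 0
  then show ?case using assms(1,2) unfolding is_dist_def by fastforce
next
  case (Suc j)
  show ?case
  proof (cases "w = a")
    case True
    then show ?thesis using assms(2) lev_mono[of 0 "Suc j" V S] by auto
  next
    case False
    then obtain x where "x \<in> D" "E x w" "d w = Suc (d x)"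
      using assms(1) Suc.prems unfolding is_dist_def by blast
    then show ?thesis using Suc E_sym E_V by auto blast
  qed
qed

lemma lev_nbr: "x \<in> lev V j S \<Longrightarrow> E x y \<Longrightarrow> y \<in> lev V (Suc j) S"
  using E_sym E_V by auto

text \<open>\<open>Y\<close> may leave \<open>D\<close>, where \<open>d\<close> means nothing, but
  by \<open>loc\<close> not directly from a level up to \<open>k\<close>. If \<open>Y\<close> missed
  a level \<open>j < k\<close>, its vertices of \<open>D\<close> below that level would be closed in
  \<open>Y\<close>, and \<open>b\<close> would not be reached.\<close>

lemma dist_many_vertices:
  assumes d: "is_dist D a d" and Y: "conn Y" "Y \<subseteq> X" "a \<in> Y" "b \<in> Y" "a \<in> D"
    and b: "k \<le> d b" "b \<in> D"
    and loc: "\<And>w x. w \<in> D \<Longrightarrow> d w \<le> k \<Longrightarrow> x \<in> X \<Longrightarrow> E w x \<Longrightarrow> x \<in> D"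
    and fin: "finite Y"
  shows "k \<le> card Y"
proof -
  have "\<exists>y\<in>Y. y \<in> D \<and> d y = j" if j: "j < k" for j
  proof (rule ccontr)
    assume none: "\<not> (\<exists>y\<in>Y. y \<in> D \<and> d y = j)"
    let ?S = "{y \<in> Y. y \<in> D \<and> d y < j}"
    have "d a = 0" using d unfolding is_dist_def by blast
    then have "a \<in> ?S" using none Y by (auto intro!: gr0I)
    moreover have "closed_in Y ?S"
      unfolding closed_in_def
    proof (intro conjI ballI impI)
      fix x y assume x: "x \<in> ?S" and y: "y \<in> Y" "E x y"
      then have "y \<in> D" using loc[of x y] Y(2) j by auto
      moreover have "d y \<le> Suc (d x)" using d x y calculation unfolding is_dist_def by blast
      moreover have "d y \<noteq> j" using none y calculation by blast
      ultimately show "y \<in> ?S" using x y by auto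
    qed auto
    ultimately have "?S = Y" using conn_closedD[OF Y(1)] by blast
    then have "d b < j" using Y(4) by blast
    then show False using b j by simp
  qed
  then obtain g where g: "\<And>j. j < k \<Longrightarrow> g j \<in> Y \<and> d (g j) = j" by metis
  have "inj_on g {..<k}" by (rule inj_onI) (metis g lessThan_iff)
  then have "card (g ` {..<k}) = k" by (simp add: card_image)
  moreover have "g ` {..<k} \<subseteq> Y" using g by blast
  ultimately show ?thesis using fin card_mono by metis
qed

lemma shrinks_to_props:
  assumes "shrinks_to X Y" "cda X"
  shows "Y \<subseteq> X \<and> cda Y"
  using assms by (induction rule: rtranclp_induct) (auto simp: rem_def)

text \<open>The neighbours of \<open>D\<close> in \<open>X\<close> are within the ball of radius
  \<open>k + 1\<close> and hence in \<open>D\<close>. So \<open>D\<close> is a component of the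
  connected set \<open>X\<close>, and local minimality forbids any deletion.\<close>

lemma small_witness:
  assumes D: "loc_min D" and a: "a \<in> D" and d: "is_dist D a d" and small: "\<And>x. x \<in> D \<Longrightarrow> d x \<le> k"
    and S: "a \<in> S" and X: "cda X" "D \<subseteq> X" "X \<inter> lev V (Suc k) S \<subseteq> D"
    and Y: "shrinks_to X Y"
  shows "Y = D"
proof -
  have "closed_in X D"
    unfolding closed_in_def
    using X dist_in_lev[OF d S] small lev_nbr[of _ k S] by blast
  then have "D = X" using X(1) a unfolding cda_def conn_def by blast
  have "\<not> rem (\<lambda>v X. cda (X - {v})) D Y" for Y
    using D unfolding rem_def loc_min_def by blast
  then show ?thesis using Y \<open>D = X\<close> by (metis converse_rtranclpE)
qed

text \<open>A double sweep: the search from an arbitrary \<open>c\<close> finds the first anchor,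
  the search from its vertex \<open>a\<close> finds a second one far away. The vertex of each anchor
  serves as the outside vertex \<open>t\<close> in \<open>anchor_step\<close> for the other.\<close>

theorem large_witness:
  assumes D: "loc_min D" and k: "k \<le> card D"
  shows "\<exists>a\<in>D. \<exists>b\<in>D. \<forall>X Y. cda X \<and> D \<subseteq> X \<and> X \<inter> lev V (k + 4) {a, b} \<subseteq> D \<and> shrinks_to X Y
           \<longrightarrow> k \<le> card Y"
proof -
  have D': "conn D" "D \<subseteq> V" "D \<noteq> {}"
    using D unfolding loc_min_def cda_def da_def conn_def by auto
  then have finD: "finite D" using finite_V finite_subset by blast
  \<comment> \<open>Radius \<open>k + 3\<close> is what \<open>small_witness\<close> handles with a
    ball of radius \<open>k + 4\<close>. The second guessed vertex is \<open>a\<close>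
    again.\<close>
  have small: ?thesis if "a \<in> D" "is_dist D a d" "\<And>x. x \<in> D \<Longrightarrow> d x \<le> k + 3" for a d
    using that k small_witness[OF D that, of "{a, a}"]
    by (intro bexI[of _ a]) (auto simp: numeral_eq_Suc)
  have sweep: ?thesis if "a \<in> D"
    and H: "\<And>d v. is_dist D a d \<Longrightarrow> v \<in> D \<Longrightarrow> k + 4 \<le> d v \<Longrightarrow> (\<And>x. x \<in> D \<Longrightarrow> d x \<le> d v) \<Longrightarrow> ?thesis" for a
  proof -
    obtain d where d: "is_dist D a d" using dist_exists D' \<open>a \<in> D\<close> by blast
    obtain v where v: "v \<in> D" "\<And>x. x \<in> D \<Longrightarrow> d x \<le> d v"
    proof -
      have "Max (d ` D) \<in> d ` D" using finD D'(3) by (intro Max_in) auto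
      then obtain v where v: "v \<in> D" "Max (d ` D) = d v" by blast
      have "d x \<le> d v" if "x \<in> D" for x
        unfolding v(2)[symmetric] using finD that by (intro Max_ge) auto
      then show ?thesis using that v by blast
    qed
    show ?thesis
    proof (cases "d v \<le> k + 3")
      case True
      then show ?thesis using small[OF \<open>a \<in> D\<close> d] v order_trans by blast
    next
      case False
      then show ?thesis using H[OF d v(1) _ v(2)] by simp
    qed
  qed
  obtain c where c: "c \<in> D" using D' by blast
  show ?thesis
  proof (rule sweep[OF c])
    fix d0 v0 assume d0: "is_dist D c d0" "v0 \<in> D" "k + 4 \<le> d0 v0" "\<And>x. x \<in> D \<Longrightarrow> d0 x \<le> d0 v0"
    have "3 \<le> d0 v0" using d0(3) by simp
    then obtain a K where aK: "anchor D a K"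
      using farthest_anchor[OF D d0(1) c d0(2) _ d0(4)] by blast
    then have a: "a \<in> D" unfolding anchor_def by blast
    show ?thesis
    proof (rule sweep[OF a])
      fix d v assume d: "is_dist D a d" "v \<in> D" "k + 4 \<le> d v" "\<And>x. x \<in> D \<Longrightarrow> d x \<le> d v"
      have "3 \<le> d v" using d(3) by simp
      then obtain b K' where bK: "anchor D b K'" "a \<notin> insert b K'" "d v \<le> Suc (d b)"
        using farthest_anchor[OF D d(1) a d(2) _ d(4)] by blast
      have b: "b \<in> D" using bK unfolding anchor_def by blast
      have da0: "d a = 0" and dstep: "\<And>x y. x \<in> D \<Longrightarrow> y \<in> D \<Longrightarrow> E x y \<Longrightarrow> d y \<le> Suc (d x)"
        using d unfolding is_dist_def by auto
      \<comment> \<open>The search gives \<open>d v\<close> at least \<open>k + 4\<close>, and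
        \<open>b\<close> is at most one level lower. That is enough for \<open>k\<close> levels and
        for placing \<open>b\<close> outside the anchor at \<open>a\<close>.\<close>
      have "2 \<le> d b" using bK(3) d(3) by simp
      then have "b \<noteq> a" "\<not> E a b" using dstep[OF a b] da0 by auto
      then have "b \<notin> insert a K" using aK unfolding anchor_def by blast
      have "k \<le> card Y" if X: "cda X" "D \<subseteq> X" "X \<inter> lev V (k + 4) {a, b} \<subseteq> D" and Y: "shrinks_to X Y" for X Y
      proof -
        have far: "x \<in> D" if "w \<in> lev V (k + 3) {a, b}" "x \<in> X" "E w x" for w x
        proof -
          have "k + 4 = Suc (k + 3)" by simp
          then show ?thesis using lev_nbr[OF that(1,3)] that(2) X(3) by (metis IntI subsetD)
        qed
        \<comment> \<open>Both anchors lie in the ball of radius 1, so whatever touches them in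
          \<open>X\<close> is within radius 2 and belongs to \<open>D\<close>.\<close>
        have near: "x \<in> D" if "w \<in> lev V 1 {a, b}" "x \<in> X" "E w x" for w x
          using far lev_mono[of 1 "k + 3" V "{a, b}"] that by auto
        have locK: "x \<in> D" if "w \<in> insert a K" "x \<in> X" "E w x" for w x
          using near[of w x] that aK D' unfolding anchor_def by auto
        have locK': "x \<in> D" if "w \<in> insert b K'" "x \<in> X" "E w x" for w x
          using near[of w x] that bK D' unfolding anchor_def by auto
        have "Y \<subseteq> X \<and> insert a K \<subseteq> Y \<and> insert b K' \<subseteq> Y"
          using Y
        proof (induction rule: rtranclp_induct)
          case base
          then show ?case using aK bK X(2) unfolding anchor_def by auto
        next
          case (step Y Z)
          then obtain z where z: "z \<in> Y" "cda (Y - {z})" "Z = Y - {z}" unfolding rem_def by blast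
          have "z \<notin> insert a K"
            by (rule anchor_step[OF aK locK _ _ _ \<open>b \<notin> insert a K\<close> z(1,2)]) (use step in auto)
          moreover have "z \<notin> insert b K'"
            by (rule anchor_step[OF bK(1) locK' _ _ _ bK(2) z(1,2)]) (use step in auto)
          ultimately show ?case using z step by blast
        qed
        moreover have "cda Y" using shrinks_to_props Y X by blast
        ultimately show ?thesis
        proof (intro dist_many_vertices[OF d(1), where b = b])
          show "finite Y" using \<open>cda Y\<close> finite_V finite_subset unfolding cda_def da_def by blast
          fix w x assume "w \<in> D" "d w \<le> k" "x \<in> X" "E w x"
          then show "x \<in> D" using far dist_in_lev[OF d(1), of "{a, b}" w "k + 3"] by auto
        qed (use a b bK d(3) in \<open>auto simp: cda_def\<close>)
      qed
      then show ?thesis using a b by blast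
    qed
  qed
qed

section \<open>Peeling, components and the correctness of a guess\<close>

lemma rem_iter_subset: "(rem P)\<^sup>*\<^sup>* X Y \<Longrightarrow> Y \<subseteq> X"
  by (induction rule: rtranclp_induct) (auto simp: rem_def)

lemma peel_da:
  assumes "(rem (\<lambda>v X. undefended X v))\<^sup>*\<^sup>* X Z" "\<forall>v\<in>Z. \<not> undefended Z v" "X \<subseteq> V"
  shows "da Z"
  using assms rem_iter_subset unfolding da_def by blast

text \<open>A vertex undefended in the current set is undefended in each subset that contains it, so
  an alliance inside the set never loses a vertex.\<close>

lemma peel_greatest:
  assumes "(rem (\<lambda>v X. undefended X v))\<^sup>*\<^sup>* X Z" "da D" "D \<subseteq> X"
  shows "D \<subseteq> Z"
  using assms
proof (induction rule: rtranclp_induct)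
  case (step Y Z)
  then show ?case using undefended_anti unfolding rem_def da_def by blast
qed

text \<open>Graph search phrased as deletion: \<open>U\<close> holds what is not reached yet and
  loses a vertex once it has a neighbour that is reached. Peeling, searching and shrinking thus are
  instances of \<open>rem\<close> and share one loop scheme, \<open>sweep\<close>.\<close>

definition unreached :: "'a set \<Rightarrow> 'a \<Rightarrow> 'a set \<Rightarrow> bool" where
  "unreached X s U \<longleftrightarrow>
     (rem (\<lambda>u U. \<exists>w\<in>X - U. E u w))\<^sup>*\<^sup>* (X - {s}) U \<and> (\<forall>u\<in>U. \<not> (\<exists>w\<in>X - U. E u w))"

lemma unreached_component:
  assumes "unreached X s U" "s \<in> X"
  shows "conn (X - U)" "closed_in X (X - U)" "s \<in> X - U"
proof -
  have U: "U \<subseteq> X - {s}" using assms rem_iter_subset unfolding unreached_def by blast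
  show s: "s \<in> X - U" using U assms by blast
  show cl: "closed_in X (X - U)"
    using assms E_sym unfolding unreached_def closed_in_def by blast
  show "conn (X - U)"
  proof (rule conn_rootI[OF s])
    fix S assume S: "closed_in (X - U) S" "s \<in> S"
    then have S': "closed_in X S" using cl unfolding closed_in_def by blast
    have "(rem (\<lambda>u U. \<exists>w\<in>X - U. E u w))\<^sup>*\<^sup>* (X - {s}) U" using assms unfolding unreached_def by blast
    then have "X - S \<subseteq> U"
    proof (induction rule: rtranclp_induct)
      case base
      then show ?case using S by blast
    next
      case (step Y Z)
      then show ?case using S' E_sym unfolding rem_def closed_in_def by blast
    qed
    then show "S = X - U" using S unfolding closed_in_def by blast
  qed
qed

lemma unreached_conn_iff:
  assumes "unreached X s U" "s \<in> X"
  shows "conn X \<longleftrightarrow> U = {}"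
proof
  assume "conn X"
  then have "X - U = X" using unreached_component[OF assms] conn_closedD by blast
  moreover have "U \<subseteq> X" using assms rem_iter_subset unfolding unreached_def by blast
  ultimately show "U = {}" by blast
qed (use unreached_component[OF assms] in auto)

text \<open>The neighbours in \<open>Z\<close> of a vertex of the component are in the component as
  well, so no defender is lost.\<close>

lemma component_cda:
  assumes "da Z" "unreached Z a U" "a \<in> Z"
  shows "cda (Z - U)"
proof -
  note c = unreached_component[OF assms(2,3)]
  have "nb (Z - U) v = nb Z v" if "v \<in> Z - U" for v
    unfolding nb_def by (rule arg_cong[where f = card]) (use c(2) that in \<open>auto simp: closed_in_def\<close>)
  then show ?thesis using assms(1) c(1) unfolding cda_def da_def undefended_def by auto
qed

definition peeled :: "'a set \<Rightarrow> 'a set \<Rightarrow> bool" where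
  "peeled F Z \<longleftrightarrow> (rem (\<lambda>v X. undefended X v))\<^sup>*\<^sup>* (V - F) Z \<and> (\<forall>v\<in>Z. \<not> undefended Z v)"

definition shrunk_component :: "'a \<Rightarrow> 'a set \<Rightarrow> 'a set \<Rightarrow> bool" where
  "shrunk_component a Z Y \<longleftrightarrow>
     (\<exists>U. unreached Z a U \<and> shrinks_to (Z - U) Y \<and> (\<forall>v\<in>Y. \<not> cda (Y - {v})))"

text \<open>Soundness of every guess: a wrong one may yield a small alliance, but never one that is
  not locally minimal.\<close>

lemma shrunk_component_loc_min:
  assumes "peeled F Z" "a \<in> Z" "shrunk_component a Z Y"
  shows "loc_min Y"
proof -
  have "da Z" using assms peel_da[of "V - F" Z] unfolding peeled_def by blast
  then show ?thesis
    using assms component_cda shrinks_to_props unfolding shrunk_component_def loc_min_def by blast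
qed

theorem guess_complete:
  assumes "loc_min D" "k \<le> card D"
  shows "\<exists>a\<in>V. \<exists>b\<in>V. \<exists>F\<subseteq>lev V (k + 4) {a, b}. \<forall>Z. peeled F Z \<longrightarrow>
           a \<in> Z \<and> (\<forall>Y. shrunk_component a Z Y \<longrightarrow> k \<le> card Y)"
proof -
  obtain a b where ab: "a \<in> D" "b \<in> D" and
    H: "\<And>X Y. cda X \<Longrightarrow> D \<subseteq> X \<Longrightarrow> X \<inter> lev V (k + 4) {a, b} \<subseteq> D \<Longrightarrow> shrinks_to X Y \<Longrightarrow> k \<le> card Y"
    using large_witness[OF assms] by blast
  have D: "da D" "conn D" "D \<subseteq> V" using assms unfolding loc_min_def cda_def da_def by auto
  \<comment> \<open>Forbidding exactly the part of the ball outside \<open>D\<close> keeps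
    \<open>D\<close> intact during peeling and makes the result agree with \<open>D\<close> on the
    ball.\<close>
  let ?F = "lev V (k + 4) {a, b} - D"
  have "a \<in> Z \<and> (\<forall>Y. shrunk_component a Z Y \<longrightarrow> k \<le> card Y)" if p: "peeled ?F Z" for Z
  proof -
    have DZ: "D \<subseteq> Z" using p peel_greatest D unfolding peeled_def by blast
    then have aZ: "a \<in> Z" using ab by blast
    have Z: "da Z" "Z \<subseteq> V - ?F"
      using p peel_da[of "V - ?F" Z] rem_iter_subset unfolding peeled_def by blast+
    have "k \<le> card Y" if sc: "shrunk_component a Z Y" for Y
    proof -
      obtain U where un: "unreached Z a U" and Y: "shrinks_to (Z - U) Y"
        using sc unfolding shrunk_component_def by blast
      note c = unreached_component[OF un aZ]
      have "closed_in D (D \<inter> (Z - U))"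
        using c(2) DZ unfolding closed_in_def by blast
      then have "D \<inter> (Z - U) = D" using conn_closedD[OF D(2)] c(3) ab by blast
      moreover have "cda (Z - U)" using component_cda[OF Z(1) un aZ] .
      moreover have "(Z - U) \<inter> lev V (k + 4) {a, b} \<subseteq> D" using Z(2) by blast
      ultimately show ?thesis using H[of "Z - U" Y] Y by blast
    qed
    then show ?thesis using aZ by blast
  qed
  then show ?thesis using ab D(3) by (intro bexI[of _ a] bexI[of _ b] exI[of _ ?F]) auto
qed

end

section \<open>A loop language for the machine\<close>

datatype exp = Cst nat | Var nat | Arr nat exp | Plus exp exp | Minus exp exp | Hlf exp

text \<open>All loops are bounded, with the limit evaluated on entry. So every program terminates,
  and its meaning and its exact step count are functions defined by recursion on the
  program.\<close>

datatype com = Skip | Asg nat exp | Put nat exp exp | Seq com com | If exp com com | For nat exp com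

record st =
  vr :: "nat \<Rightarrow> nat"
  ar :: "nat \<Rightarrow> nat \<Rightarrow> nat"

definition set_var :: "nat \<Rightarrow> nat \<Rightarrow> st \<Rightarrow> st" where
  "set_var x a s = s\<lparr>vr := (vr s)(x := a)\<rparr>"

definition set_arr :: "nat \<Rightarrow> nat \<Rightarrow> nat \<Rightarrow> st \<Rightarrow> st" where
  "set_arr t i a s = s\<lparr>ar := (ar s)(t := (ar s t)(i := a))\<rparr>"

lemma set_var_simps [simp]:
  "vr (set_var x a s) y = (if y = x then a else vr s y)" "ar (set_var x a s) = ar s"
  by (simp_all add: set_var_def)

lemma set_arr_simps [simp]:
  "vr (set_arr t i a s) = vr s" "ar (set_arr t i a s) t' = (if t' = t then (ar s t)(i := a) else ar s t')"
  by (simp_all add: set_arr_def)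

primrec iter :: "(nat \<Rightarrow> 'a \<Rightarrow> 'a) \<Rightarrow> 'a \<Rightarrow> nat \<Rightarrow> 'a" where
  "iter f a 0 = a"
| "iter f a (Suc j) = f j (iter f a j)"

primrec eval :: "exp \<Rightarrow> st \<Rightarrow> nat" where
  "eval (Cst c) s = c"
| "eval (Var x) s = vr s x"
| "eval (Arr t e) s = ar s t (eval e s)"
| "eval (Plus a b) s = eval a s + eval b s"
| "eval (Minus a b) s = eval a s - eval b s"
| "eval (Hlf a) s = eval a s div 2"

primrec sem :: "com \<Rightarrow> st \<Rightarrow> st" where
  "sem Skip s = s"
| "sem (Asg x e) s = set_var x (eval e s) s"
| "sem (Put t i e) s = set_arr t (eval i s) (eval e s) s"
| "sem (Seq c1 c2) s = sem c2 (sem c1 s)"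
| "sem (If e c1 c2) s = (if eval e s \<noteq> 0 then sem c1 s else sem c2 s)"
| "sem (For x e c) s = iter (\<lambda>j s'. sem c (set_var x j s')) s (eval e s)"

primrec ecost :: "exp \<Rightarrow> nat" where
  "ecost (Cst c) = 1"
| "ecost (Var x) = 2"
| "ecost (Arr t e) = ecost e + 7"
| "ecost (Plus a b) = ecost a + ecost b + 1"
| "ecost (Minus a b) = ecost a + ecost b + 1"
| "ecost (Hlf a) = ecost a + 1"

text \<open>The constants count the instructions emitted by \<open>ccom\<close>: a loop takes three
  to set up and two for its last, failing test, and each round takes seven around the body.\<close>

primrec tm :: "com \<Rightarrow> st \<Rightarrow> nat" where
  "tm Skip s = 0"
| "tm (Asg x e) s = ecost e + 2"
| "tm (Put t i e) s = ecost i + ecost e + 7"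
| "tm (Seq c1 c2) s = tm c1 s + tm c2 (sem c1 s)"
| "tm (If e c1 c2) s = ecost e + 1 + (if eval e s \<noteq> 0 then tm c1 s + 1 else tm c2 s)"
| "tm (For x e c) s = ecost e + 5 +
     (\<Sum>j<eval e s. 7 + tm c (set_var x j (iter (\<lambda>j s'. sem c (set_var x j s')) s j)))"

text \<open>
  Memory layout: variables in registers below 40, the base address \<open>B\<close> of the arrays in register 40,
  loop counters and limits in registers 41 to 99, temporaries in registers 100 to 199. The eight
  arrays are interleaved, entry \<open>i\<close> of array \<open>t\<close> being at address \<open>B + 8 * i + t\<close>.
\<close>

definition rel :: "nat \<Rightarrow> (nat \<Rightarrow> nat) \<Rightarrow> st \<Rightarrow> bool" where
  "rel B R s \<longleftrightarrow> 200 \<le> B \<and> R 40 = B \<and> (\<forall>x<40. R x = vr s x) \<and>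
     (\<forall>t<8. \<forall>i. R (B + 8 * i + t) = ar s t i)"

definition addr_code :: "nat \<Rightarrow> nat \<Rightarrow> instr list" where
  "addr_code d t = [Add d d d, Add d d d, Add d d d, Add d d 40, Const (Suc d) t, Add d d (Suc d)]"

text \<open>A register is copied by doubling and halving.\<close>

primrec cexp :: "nat \<Rightarrow> exp \<Rightarrow> instr list" where
  "cexp d (Cst c) = [Const d c]"
| "cexp d (Var x) = [Add d x x, Half d d]"
| "cexp d (Arr t e) = cexp d e @ addr_code d t @ [Load d d]"
| "cexp d (Plus a b) = cexp d a @ cexp (Suc d) b @ [Add d d (Suc d)]"
| "cexp d (Minus a b) = cexp d a @ cexp (Suc d) b @ [Sub d d (Suc d)]"
| "cexp d (Hlf a) = cexp d a @ [Half d d]"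

primrec wfe :: "nat \<Rightarrow> exp \<Rightarrow> bool" where
  "wfe d (Cst c) \<longleftrightarrow> d < 200"
| "wfe d (Var x) \<longleftrightarrow> d < 200 \<and> x < 40"
| "wfe d (Arr t e) \<longleftrightarrow> wfe d e \<and> t < 8 \<and> Suc d < 200"
| "wfe d (Plus a b) \<longleftrightarrow> wfe d a \<and> wfe (Suc d) b"
| "wfe d (Minus a b) \<longleftrightarrow> wfe d a \<and> wfe (Suc d) b"
| "wfe d (Hlf a) \<longleftrightarrow> wfe d a"

text \<open>Jumps have absolute targets, so the length of a piece of code must be known before the
  code is generated.\<close>

primrec csize :: "com \<Rightarrow> nat" where
  "csize Skip = 0"
| "csize (Asg x e) = ecost e + 2"
| "csize (Put t i e) = ecost i + ecost e + 7"
| "csize (Seq c1 c2) = csize c1 + csize c2"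
| "csize (If e c1 c2) = ecost e + csize c1 + csize c2 + 2"
| "csize (For x e c) = ecost e + csize c + 10"

text \<open>\<open>p\<close> is the address of the first instruction and \<open>d\<close> the loop
  nesting depth, which selects the registers for counter and limit. The bound \<open>d < 29\<close>
  in \<open>wfc\<close> keeps these below the temporaries.\<close>

primrec ccom :: "nat \<Rightarrow> nat \<Rightarrow> com \<Rightarrow> instr list" where
  "ccom d p Skip = []"
| "ccom d p (Asg x e) = cexp 100 e @ [Add x 100 100, Half x x]"
| "ccom d p (Put t i e) = cexp 100 i @ addr_code 100 t @ cexp 101 e @ [Store 100 101]"
| "ccom d p (Seq c1 c2) = ccom d p c1 @ ccom d (p + csize c1) c2"
| "ccom d p (If e c1 c2) = cexp 100 e @ [JumpZero 100 (p + ecost e + csize c1 + 2)] @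
     ccom d (p + ecost e + 1) c1 @ [Jump (p + ecost e + csize c1 + csize c2 + 2)] @
     ccom d (p + ecost e + csize c1 + 2) c2"
| "ccom d p (For x e c) = cexp 100 e @
     [Add (42 + 2 * d) 100 100, Half (42 + 2 * d) (42 + 2 * d), Const (41 + 2 * d) 0,
      Sub 100 (42 + 2 * d) (41 + 2 * d), JumpZero 100 (p + ecost e + csize c + 10),
      Add x (41 + 2 * d) (41 + 2 * d), Half x x] @
     ccom (Suc d) (p + ecost e + 7) c @
     [Const 100 1, Add (41 + 2 * d) (41 + 2 * d) 100, Jump (p + ecost e + 3)]"

primrec wfc :: "nat \<Rightarrow> com \<Rightarrow> bool" where
  "wfc d Skip \<longleftrightarrow> True"
| "wfc d (Asg x e) \<longleftrightarrow> x < 40 \<and> wfe 100 e"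
| "wfc d (Put t i e) \<longleftrightarrow> t < 8 \<and> wfe 100 i \<and> wfe 101 e"
| "wfc d (Seq c1 c2) \<longleftrightarrow> wfc d c1 \<and> wfc d c2"
| "wfc d (If e c1 c2) \<longleftrightarrow> wfe 100 e \<and> wfc d c1 \<and> wfc d c2"
| "wfc d (For x e c) \<longleftrightarrow> x < 40 \<and> d < 29 \<and> wfe 100 e \<and> wfc (Suc d) c"

lemma length_cexp [simp]: "length (cexp d e) = ecost e"
  by (induction e arbitrary: d) (auto simp: addr_code_def)

lemma length_ccom [simp]: "length (ccom d p c) = csize c"
  by (induction c arbitrary: d p) (auto simp: addr_code_def)

section \<open>Execution and correctness of compiled code\<close>

primrec code_at :: "instr list \<Rightarrow> nat \<Rightarrow> instr list \<Rightarrow> bool" where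
  "code_at P p [] \<longleftrightarrow> True"
| "code_at P p (i # is) \<longleftrightarrow> p < length P \<and> P ! p = i \<and> code_at P (Suc p) is"

lemma code_at_append [simp]:
  "code_at P p (is @ js) \<longleftrightarrow> code_at P p is \<and> code_at P (p + length is) js"
  by (induction "is" arbitrary: p) auto

lemma code_at_infix: "code_at (xs @ is @ ys) (length xs) is"
proof (induction "is" arbitrary: xs)
  case (Cons i "is")
  have "code_at ((xs @ [i]) @ is @ ys) (length (xs @ [i])) is" by (rule Cons)
  then show ?case by (simp add: nth_append)
qed simp

definition steps :: "instr list \<Rightarrow> nat \<Rightarrow> config \<Rightarrow> config \<Rightarrow> bool" where
  "steps P t s s' \<longleftrightarrow> (step P ^^ t) s = s'"

lemma steps_0 [simp]: "steps P 0 s s' \<longleftrightarrow> s = s'"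
  by (simp add: steps_def)

lemma steps_trans: "steps P t s s' \<Longrightarrow> steps P t' s' s'' \<Longrightarrow> steps P (t + t') s s''"
  by (simp add: steps_def add.commute[of t] funpow_add)

lemma steps_eq: "steps P t s s' \<Longrightarrow> t = t' \<Longrightarrow> s' = s'' \<Longrightarrow> steps P t' s s''"
  by simp

lemma step_code: "p < length P \<Longrightarrow> P ! p = i \<Longrightarrow> step P (p, R) = exec i (p, R)"
  by (simp add: step_def halted_def)

lemma steps_one: "code_at P p (i # is) \<Longrightarrow> exec i (p, R) = s \<Longrightarrow> steps P 1 (p, R) s"
  by (simp add: steps_def step_code)

fun straight :: "instr \<Rightarrow> bool" where
  "straight (Jump _) \<longleftrightarrow> False"
| "straight (JumpZero _ _) \<longleftrightarrow> False"
| "straight _ \<longleftrightarrow> True"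

primrec lin :: "instr list \<Rightarrow> (nat \<Rightarrow> nat) \<Rightarrow> (nat \<Rightarrow> nat)" where
  "lin [] R = R"
| "lin (i # is) R = lin is (snd (exec i (0, R)))"

lemma lin_append [simp]: "lin (is @ js) R = lin js (lin is R)"
  by (induction "is" arbitrary: R) auto

lemma exec_straight: "straight i \<Longrightarrow> exec i (p, R) = (Suc p, snd (exec i (0, R)))"
  by (cases i) auto

lemma steps_lin:
  assumes "list_all straight is" "code_at P p is" "length is = t" "p + t = p'" "lin is R = R'"
  shows "steps P t (p, R) (p', R')"
  using assms
proof (induction "is" arbitrary: p R t)
  case (Cons i "is")
  have 1: "steps P 1 (p, R) (Suc p, snd (exec i (0, R)))"
    using Cons.prems exec_straight[of i p R] by (intro steps_one) auto
  have "steps P (length is) (Suc p, snd (exec i (0, R))) (p', R')"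
    using Cons by auto
  from steps_trans[OF 1 this] show ?case using Cons.prems by simp
qed simp

lemma straight_cexp [simp]: "list_all straight (cexp d e)"
  by (induction e arbitrary: d) (auto simp: addr_code_def)

lemma rel_cong:
  assumes "rel B R s" "\<And>r. r \<le> 40 \<or> 200 \<le> r \<Longrightarrow> R' r = R r"
  shows "rel B R' s"
  using assms unfolding rel_def by auto

lemma lin_addr_code:
  assumes "rel B R s" "100 \<le> d"
  shows "lin (addr_code d t) R d = B + 8 * R d + t"
    "\<And>r. r \<noteq> d \<Longrightarrow> r \<noteq> Suc d \<Longrightarrow> lin (addr_code d t) R r = R r"
  using assms by (auto simp: addr_code_def rel_def)

lemma lin_cexp:
  assumes "rel B R s" "wfe d e" "100 \<le> d"
  shows "lin (cexp d e) R d = eval e s \<and> (\<forall>r. r < d \<or> 200 \<le> r \<longrightarrow> lin (cexp d e) R r = R r)"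
  using assms
proof (induction e arbitrary: d R)
  case (Arr t e)
  let ?R = "lin (cexp d e) R"
  have e: "?R d = eval e s" "\<And>r. r < d \<or> 200 \<le> r \<Longrightarrow> ?R r = R r" using Arr by auto
  have rel: "rel B ?R s" by (rule rel_cong[OF Arr.prems(1)]) (use e Arr.prems in auto)
  have "lin (addr_code d t) ?R (B + 8 * eval e s + t) = ar s t (eval e s)"
    using lin_addr_code(2)[OF rel Arr.prems(3), of "B + 8 * eval e s + t" t] rel Arr.prems
    by (auto simp: rel_def)
  then show ?case using lin_addr_code[OF rel Arr.prems(3), where t = t] e Arr.prems by auto
next
  case (Plus a b)
  let ?R = "lin (cexp d a) R"
  have a: "?R d = eval a s" "\<And>r. r < d \<or> 200 \<le> r \<Longrightarrow> ?R r = R r" using Plus by auto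
  have rel: "rel B ?R s" by (rule rel_cong[OF Plus.prems(1)]) (use a Plus.prems in auto)
  \<comment> \<open>Well-formedness bounds the target register of every expression, but only the
    leaves say so.\<close>
  have "Suc d < 200" using Plus.prems(2) by (simp, induction b) auto
  then show ?case using a Plus.IH(2)[OF rel, of "Suc d"] Plus.prems by auto
next
  case (Minus a b)
  let ?R = "lin (cexp d a) R"
  have a: "?R d = eval a s" "\<And>r. r < d \<or> 200 \<le> r \<Longrightarrow> ?R r = R r" using Minus by auto
  have rel: "rel B ?R s" by (rule rel_cong[OF Minus.prems(1)]) (use a Minus.prems in auto)
  have "Suc d < 200" using Minus.prems(2) by (simp, induction b) auto
  then show ?case using a Minus.IH(2)[OF rel, of "Suc d"] Minus.prems by auto
next
  case (Hlf a)
  have "d < 200" using Hlf.prems(2) by (simp, induction a) auto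
  then show ?case using Hlf by auto
qed (auto simp: rel_def)

lemma rel_set_var: "rel B R s \<Longrightarrow> x < 40 \<Longrightarrow> rel B (R(x := a)) (set_var x a s)"
  unfolding rel_def by auto

text \<open>Relative to \<open>B\<close>, the array number is the remainder of the address modulo 8,
  so different entries never share a register.\<close>

lemma rel_set_arr:
  assumes "rel B R s" "t < 8"
  shows "rel B (R(B + 8 * i + t := a)) (set_arr t i a s)"
proof -
  have "B + 8 * j + t' = B + 8 * i + t \<longleftrightarrow> t' = t \<and> j = i" if "t' < 8" for t' j
    using that assms(2) by (cases j i rule: linorder_cases) auto
  then show ?thesis using assms unfolding rel_def by auto
qed

text \<open>The last conjunct protects the counters and limits of the enclosing loops, which
  \<open>rel\<close> does not mention; the induction for loops depends on it.\<close>

theorem ccom_correct: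
  assumes "rel B R s" "wfc d c" "d \<le> 29" "code_at P p (ccom d p c)"
  shows "\<exists>R'. steps P (tm c s) (p, R) (p + csize c, R') \<and> rel B R' (sem c s) \<and>
           (\<forall>r. 41 \<le> r \<and> r < 41 + 2 * d \<longrightarrow> R' r = R r)"
  using assms
proof (induction c arbitrary: d p R s)
  case Skip
  then show ?case by auto
next
  case (Asg x e)
  let ?R = "lin (cexp 100 e) R"
  have e: "?R 100 = eval e s" "\<And>r. r < 100 \<or> 200 \<le> r \<Longrightarrow> ?R r = R r"
    using lin_cexp[of B R s 100 e] Asg by auto
  have rel: "rel B ?R s" by (rule rel_cong[OF Asg.prems(1)]) (use e in auto)
  have "steps P (tm (Asg x e) s) (p, R) (p + csize (Asg x e), lin (ccom d p (Asg x e)) R)"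
    by (rule steps_lin[OF _ Asg.prems(4)]) simp_all
  moreover have "lin (ccom d p (Asg x e)) R = ?R(x := eval e s)"
    using e Asg.prems by (simp add: fun_eq_iff)
  moreover have "rel B (?R(x := eval e s)) (sem (Asg x e) s)"
    using rel_set_var[OF rel, of x "eval e s"] Asg.prems by simp
  moreover have "(?R(x := eval e s)) r = R r" if "41 \<le> r \<and> r < 41 + 2 * d" for r
    using e Asg.prems that by simp
  ultimately show ?case by metis
next
  case (Put t i e)
  let ?R1 = "lin (cexp 100 i) R"
  have i: "?R1 100 = eval i s" "\<And>r. r < 100 \<or> 200 \<le> r \<Longrightarrow> ?R1 r = R r"
    using lin_cexp[of B R s 100 i] Put by auto
  have rel1: "rel B ?R1 s" by (rule rel_cong[OF Put.prems(1)]) (use i in auto)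
  let ?R2 = "lin (addr_code 100 t) ?R1"
  have R2: "?R2 100 = B + 8 * eval i s + t" "\<And>r. r < 100 \<or> 200 \<le> r \<Longrightarrow> ?R2 r = R r"
    using lin_addr_code[OF rel1, where d = 100 and t = t] i by auto
  have rel2: "rel B ?R2 s" by (rule rel_cong[OF Put.prems(1)]) (use R2 in auto)
  let ?R3 = "lin (cexp 101 e) ?R2"
  have R3: "?R3 101 = eval e s" "?R3 100 = B + 8 * eval i s + t"
    "\<And>r. r < 100 \<or> 200 \<le> r \<Longrightarrow> ?R3 r = R r"
    using lin_cexp[OF rel2, of 101 e] R2 Put.prems by auto
  have rel3: "rel B ?R3 s" by (rule rel_cong[OF Put.prems(1)]) (use R3 in auto)
  have "tm (Put t i e) s = length (ccom d p (Put t i e))"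
    "csize (Put t i e) = length (ccom d p (Put t i e))"
    "list_all straight (ccom d p (Put t i e))"
    by (simp_all add: addr_code_def)
  then have "steps P (tm (Put t i e) s) (p, R) (p + csize (Put t i e), lin (ccom d p (Put t i e)) R)"
    by (intro steps_lin[OF _ Put.prems(4)]) (simp_all only:)
  moreover have "lin (ccom d p (Put t i e)) R = ?R3(B + 8 * eval i s + t := eval e s)"
    using R3 by simp
  moreover have "rel B (?R3(B + 8 * eval i s + t := eval e s)) (sem (Put t i e) s)"
    using rel_set_arr[OF rel3, of t "eval i s" "eval e s"] Put.prems by simp
  moreover have "(?R3(B + 8 * eval i s + t := eval e s)) r = R r" if "41 \<le> r \<and> r < 41 + 2 * d" for r
    using R3 Put.prems that rel3 unfolding rel_def by simp
  ultimately show ?case by metis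
next
  case (Seq c1 c2)
  obtain R1 where R1: "steps P (tm c1 s) (p, R) (p + csize c1, R1)" "rel B R1 (sem c1 s)"
    "\<And>r. 41 \<le> r \<Longrightarrow> r < 41 + 2 * d \<Longrightarrow> R1 r = R r"
    using Seq.IH(1)[of R s d p] Seq.prems by auto
  obtain R2 where R2: "steps P (tm c2 (sem c1 s)) (p + csize c1, R1) (p + csize c1 + csize c2, R2)"
    "rel B R2 (sem c2 (sem c1 s))" "\<And>r. 41 \<le> r \<Longrightarrow> r < 41 + 2 * d \<Longrightarrow> R2 r = R1 r"
    using Seq.IH(2)[OF R1(2), of d "p + csize c1"] Seq.prems by auto
  show ?case using steps_trans[OF R1(1) R2(1)] R1 R2 by (auto simp: add.assoc)
next
  case (If e c1 c2)
  let ?R = "lin (cexp 100 e) R"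
  have e: "?R 100 = eval e s" "\<And>r. r < 100 \<or> 200 \<le> r \<Longrightarrow> ?R r = R r"
    using lin_cexp[of B R s 100 e] If by auto
  have rel: "rel B ?R s" by (rule rel_cong[OF If.prems(1)]) (use e in auto)
  have code: "code_at P p (cexp 100 e)"
    "code_at P (p + ecost e) [JumpZero 100 (p + ecost e + csize c1 + 2)]"
    "code_at P (p + ecost e + 1) (ccom d (p + ecost e + 1) c1)"
    "code_at P (p + ecost e + 1 + csize c1) [Jump (p + ecost e + csize c1 + csize c2 + 2)]"
    "code_at P (p + ecost e + csize c1 + 2) (ccom d (p + ecost e + csize c1 + 2) c2)"
    using If.prems(4) by auto
  have s1: "steps P (ecost e) (p, R) (p + ecost e, ?R)"
    by (rule steps_lin[OF _ code(1)]) simp_all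
  show ?case
  proof (cases "eval e s = 0")
    case True
    have "steps P 1 (p + ecost e, ?R) (p + ecost e + csize c1 + 2, ?R)"
      by (rule steps_one[OF code(2)]) (use True e in simp)
    note s2 = steps_trans[OF s1 this]
    obtain R' where R': "steps P (tm c2 s) (p + ecost e + csize c1 + 2, ?R) (p + ecost e + csize c1 + 2 + csize c2, R')"
      "rel B R' (sem c2 s)" "\<And>r. 41 \<le> r \<Longrightarrow> r < 41 + 2 * d \<Longrightarrow> R' r = ?R r"
      using If.IH(2)[OF rel _ _ code(5)] If.prems by auto
    show ?thesis using steps_trans[OF s2 R'(1)] R' e True If.prems(3) by (auto simp: ac_simps)
  next
    case False
    have "steps P 1 (p + ecost e, ?R) (p + ecost e + 1, ?R)"
      by (rule steps_one[OF code(2)]) (use False e in simp)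
    note s2 = steps_trans[OF s1 this]
    obtain R' where R': "steps P (tm c1 s) (p + ecost e + 1, ?R) (p + ecost e + 1 + csize c1, R')"
      "rel B R' (sem c1 s)" "\<And>r. 41 \<le> r \<Longrightarrow> r < 41 + 2 * d \<Longrightarrow> R' r = ?R r"
      using If.IH(1)[OF rel _ _ code(3)] If.prems by auto
    have "steps P 1 (p + ecost e + 1 + csize c1, R') (p + ecost e + csize c1 + csize c2 + 2, R')"
      by (rule steps_one[OF code(4)]) simp
    note s3 = steps_trans[OF steps_trans[OF s2 R'(1)] this]
    show ?thesis using s3 R' e False If.prems(3) by (auto simp: ac_simps)
  qed
next
  case (For x e c)
  let ?h = "41 + 2 * d" and ?l = "42 + 2 * d" and ?n = "eval e s" and ?q = "p + ecost e + 3"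
  let ?S = "iter (\<lambda>j s'. sem c (set_var x j s')) s"
  have wf: "x < 40" "d < 29" "wfe 100 e" "wfc (Suc d) c" using For.prems by auto
  let ?A = "cexp 100 e @ [Add ?l 100 100, Half ?l ?l, Const ?h 0]"
    and ?B = "[Sub 100 ?l ?h, JumpZero 100 (?q + csize c + 7), Add x ?h ?h, Half x x] @
       ccom (Suc d) (?q + 4) c @ [Const 100 1, Add ?h ?h 100, Jump ?q]"
  have "ccom d p (For x e c) = ?A @ ?B" by (simp add: ac_simps)
  with For.prems(4) have "code_at P p (?A @ ?B)" by (simp only:)
  note split = iffD1[OF code_at_append this]
  note code0 = conjunct1[OF split] conjunct2[OF split]
  have "p + length ?A = ?q" by simp
  with code0(2) have code1: "code_at P ?q ?B" by (simp only:)
  have code: "code_at P ?q [Sub 100 ?l ?h]"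
    "code_at P (?q + 1) [JumpZero 100 (?q + csize c + 7)]"
    "code_at P (?q + 2) [Add x ?h ?h, Half x x]"
    "code_at P (?q + 4) (ccom (Suc d) (?q + 4) c)"
    "code_at P (?q + 4 + csize c) [Const 100 1, Add ?h ?h 100]"
    "code_at P (?q + 6 + csize c) [Jump ?q]"
  proof -
    have q: "?q + 1 = Suc ?q" "?q + 2 = Suc (Suc ?q)" "?q + 4 = Suc (Suc (Suc (Suc ?q)))"
      "?q + 6 + csize c = Suc (Suc (Suc (Suc (Suc (Suc ?q)))) + csize c)"
      by simp_all
    show "code_at P ?q [Sub 100 ?l ?h]"
      "code_at P (?q + 1) [JumpZero 100 (?q + csize c + 7)]"
      "code_at P (?q + 2) [Add x ?h ?h, Half x x]"
      "code_at P (?q + 4) (ccom (Suc d) (?q + 4) c)"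
      "code_at P (?q + 4 + csize c) [Const 100 1, Add ?h ?h 100]"
      "code_at P (?q + 6 + csize c) [Jump ?q]"
      using code1 unfolding q
      by (simp_all only: code_at.simps code_at_append append.simps length_ccom list.size simp_thms add_Suc_right add_Suc add_0_right)
  qed
  define R0 where "R0 = lin (cexp 100 e @ [Add ?l 100 100, Half ?l ?l, Const ?h 0]) R"
  have e: "lin (cexp 100 e) R 100 = ?n" "\<And>r. r < 100 \<or> 200 \<le> r \<Longrightarrow> lin (cexp 100 e) R r = R r"
    using lin_cexp[OF For.prems(1) wf(3)] by auto
  have R0: "R0 ?l = ?n" "R0 ?h = 0" "\<And>r. r < ?h \<or> 200 \<le> r \<Longrightarrow> R0 r = R r"
    using e wf(2) unfolding R0_def by auto
  have s0: "steps P (ecost e + 3) (p, R) (?q, R0)"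
    unfolding R0_def by (rule steps_lin[OF _ code0(1)]) (simp_all del: lin_append)
  have rel0: "rel B R0 s" by (rule rel_cong[OF For.prems(1)]) (use R0 in auto)
  \<comment> \<open>The hidden counter drives the loop, not the variable \<open>x\<close>, which is
    merely reloaded in each round; so the body may overwrite \<open>x\<close>.\<close>
  have loop: "\<exists>R'. steps P (\<Sum>i<j. 7 + tm c (set_var x i (?S i))) (?q, R0) (?q, R') \<and> rel B R' (?S j) \<and>
     R' ?h = j \<and> R' ?l = ?n \<and> (\<forall>r. 41 \<le> r \<and> r < ?h \<longrightarrow> R' r = R r)" if "j \<le> ?n" for j
    using that
  proof (induction j)
    case 0
    then show ?case using R0 rel0 by (intro exI[of _ R0]) auto
  next
    case (Suc j)
    then have "j \<le> ?n" by simp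
    from Suc.IH[OF this] obtain R1 where R1: "steps P (\<Sum>i<j. 7 + tm c (set_var x i (?S i))) (?q, R0) (?q, R1)"
      "rel B R1 (?S j)" "R1 ?h = j" "R1 ?l = ?n" "\<And>r. 41 \<le> r \<Longrightarrow> r < ?h \<Longrightarrow> R1 r = R r"
      by blast
    define R2 where "R2 = (R1(100 := ?n - j))(x := j)"
    have "steps P 1 (?q, R1) (?q + 1, R1(100 := ?n - j))"
      by (rule steps_one[OF code(1)]) (use R1 in simp)
    moreover have "steps P 1 (?q + 1, R1(100 := ?n - j)) (?q + 2, R1(100 := ?n - j))"
      by (rule steps_one[OF code(2)]) (use Suc.prems in simp)
    moreover have "steps P 2 (?q + 2, R1(100 := ?n - j)) (?q + 4, R2)"
    proof -
      have "lin [Add x ?h ?h, Half x x] (R1(100 := ?n - j)) = R2"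
        unfolding R2_def using R1 wf by (auto simp: fun_eq_iff)
      then show ?thesis by (intro steps_lin[OF _ code(3)]) simp_all
    qed
    ultimately have a: "steps P (1 + 1 + 2) (?q, R1) (?q + 4, R2)"
      using steps_trans by blast
    have "rel B (R1(100 := ?n - j)) (?S j)" by (rule rel_cong[OF R1(2)]) auto
    then have rel2: "rel B R2 (set_var x j (?S j))"
      unfolding R2_def using rel_set_var wf(1) by blast
    obtain R3 where R3: "steps P (tm c (set_var x j (?S j))) (?q + 4, R2) (?q + 4 + csize c, R3)"
      "rel B R3 (?S (Suc j))" "\<And>r. 41 \<le> r \<Longrightarrow> r < 41 + 2 * Suc d \<Longrightarrow> R3 r = R2 r"
      using For.IH[OF rel2 wf(4) _ code(4)] wf(2) by auto
    define R4 where "R4 = (R3(100 := 1))(?h := Suc j)"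
    have h: "R3 ?h = j" "R3 ?l = ?n" "\<And>r. 41 \<le> r \<Longrightarrow> r < ?h \<Longrightarrow> R3 r = R r"
      using R3(3) R1 wf unfolding R2_def by auto
    have b: "steps P 2 (?q + 4 + csize c, R3) (?q + 6 + csize c, R4)"
    proof -
      have "lin [Const 100 1, Add ?h ?h 100] R3 = R4"
        unfolding R4_def using h wf by (auto simp: fun_eq_iff)
      then show ?thesis by (intro steps_lin[OF _ code(5)]) simp_all
    qed
    have c: "steps P 1 (?q + 6 + csize c, R4) (?q, R4)"
      by (rule steps_one[OF code(6)]) simp
    have "steps P (1 + 1 + 2 + tm c (set_var x j (?S j)) + (2 + 1)) (?q, R1) (?q, R4)"
      using steps_trans[OF steps_trans[OF a R3(1)] steps_trans[OF b c]] .
    from steps_trans[OF R1(1) this]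
    have "steps P (\<Sum>i<Suc j. 7 + tm c (set_var x i (?S i))) (?q, R0) (?q, R4)"
      by (rule steps_eq) simp_all
    moreover have "rel B R4 (?S (Suc j))"
      by (rule rel_cong[OF R3(2)]) (use wf in \<open>auto simp: R4_def\<close>)
    moreover have "R4 ?h = Suc j" "R4 ?l = ?n" "\<And>r. 41 \<le> r \<Longrightarrow> r < ?h \<Longrightarrow> R4 r = R r"
      using h wf unfolding R4_def by simp_all
    ultimately show ?case by blast
  qed
  obtain R1 where R1: "steps P (\<Sum>i<?n. 7 + tm c (set_var x i (?S i))) (?q, R0) (?q, R1)"
    "rel B R1 (?S ?n)" "R1 ?h = ?n" "R1 ?l = ?n" "\<And>r. 41 \<le> r \<Longrightarrow> r < ?h \<Longrightarrow> R1 r = R r"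
    using loop[of ?n] by auto
  have "steps P 1 (?q, R1) (?q + 1, R1(100 := 0))"
    by (rule steps_one[OF code(1)]) (use R1 in simp)
  moreover have "steps P 1 (?q + 1, R1(100 := 0)) (?q + csize c + 7, R1(100 := 0))"
    by (rule steps_one[OF code(2)]) simp
  ultimately have "steps P (1 + 1) (?q, R1) (?q + csize c + 7, R1(100 := 0))"
    by (rule steps_trans)
  from steps_trans[OF steps_trans[OF s0 R1(1)] this]
  have "steps P (tm (For x e c) s) (p, R) (p + csize (For x e c), R1(100 := 0))"
    by (rule steps_eq) simp_all
  moreover have "rel B (R1(100 := 0)) (?S ?n)" by (rule rel_cong[OF R1(2)]) auto
  moreover from this have "rel B (R1(100 := 0)) (sem (For x e c) s)" by simp
  moreover have "(R1(100 := 0)) r = R r" if "41 \<le> r \<and> r < 41 + 2 * d" for r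
    using R1(5)[of r] wf that by simp
  ultimately show ?case by blast
qed


section \<open>Moving the input to its place\<close>

text \<open>
  The input occupies all low registers except register 0, which holds its length \<open>l\<close>. The first input
  item is parked at address \<open>4 * l\<close>, outside the input, which frees register 1; then all registers
  below 200 are moved to their places in array 0, where \<open>B = 4 * l + 200\<close>.
\<close>

definition save_code :: "instr list" where
  "save_code =
     [Add 0 0 0, Add 0 0 0, Store 0 1, Const 1 216, Add 0 0 1, Store 0 2,
      Const 2 216, Sub 2 0 2, Load 2 2, Const 1 8, Sub 0 0 1, Store 0 2,
      Const 1 16, Add 0 0 1, Const 1 8]"

text \<open>Unrolled with fixed source registers, so that it uses only the pointer in register 0 and
  the stride 8 in register 1.\<close>

definition save_regs :: "nat \<Rightarrow> instr list" where
  "save_regs m = concat (map (\<lambda>j. [Store 0 j, Add 0 0 1]) [3..<m])"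

text \<open>Register 0 now points behind entry 199 of array 0, at \<open>B + 8 * 200\<close>. From
  it \<open>B\<close> is recovered by subtraction, and \<open>l\<close> from
  \<open>B = 4 * l + 200\<close> by halving twice.\<close>

definition setup_code :: "instr list" where
  "setup_code =
     [Const 4 1600, Sub 40 0 4, Const 4 200, Sub 3 40 4, Half 3 3, Half 3 3,
      Const 5 1, Add 3 3 5, Const 2 200]"

definition move_code :: "nat \<Rightarrow> instr list" where
  "move_code q =
     [Sub 4 3 2, JumpZero 4 (q + 7), Load 4 2, Store 0 4, Add 0 0 1, Add 2 2 5, Jump q]"

lemma lin_save_code:
  assumes "0 < l" "R 0 = l" and B: "B = 4 * l + 200"
  shows "lin save_code R 0 = B + 24" "lin save_code R 1 = 8" "lin save_code R (B + 8) = R 1"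
    "2 \<le> l \<Longrightarrow> lin save_code R (B + 16) = R 2"
    "\<And>r. 3 \<le> r \<Longrightarrow> r \<le> l \<Longrightarrow> lin save_code R r = R r"
proof -
  obtain k where "l = Suc k" using assms by (cases l) auto
  then show "lin save_code R 0 = B + 24" "lin save_code R 1 = 8" "lin save_code R (B + 8) = R 1"
    "2 \<le> l \<Longrightarrow> lin save_code R (B + 16) = R 2"
    "\<And>r. 3 \<le> r \<Longrightarrow> r \<le> l \<Longrightarrow> lin save_code R r = R r"
    using assms unfolding save_code_def by auto
qed

lemma straight_save_regs: "list_all straight (save_regs m)"
  unfolding save_regs_def by (auto simp: list_all_iff)

lemma length_save_regs: "length (save_regs m) = 2 * (m - 3)"
  unfolding save_regs_def by (induction m) (auto simp: length_concat comp_def)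

lemma lin_save_regs:
  assumes "R 0 = B + 24" "R 1 = 8" "200 \<le> B" "3 \<le> m" "m \<le> 200"
  shows "lin (save_regs m) R 0 = B + 8 * m \<and> (\<forall>j. 3 \<le> j \<and> j < m \<longrightarrow> lin (save_regs m) R (B + 8 * j) = R j) \<and>
     (\<forall>r. r \<noteq> 0 \<and> (\<forall>j. 3 \<le> j \<and> j < m \<longrightarrow> r \<noteq> B + 8 * j) \<longrightarrow> lin (save_regs m) R r = R r)"
  using assms(4,5)
proof (induction m rule: dec_induct)
  case base
  then show ?case using assms by (simp add: save_regs_def)
next
  case (step m)
  let ?R = "lin (save_regs m) R"
  have IH: "?R 0 = B + 8 * m" "\<And>j. 3 \<le> j \<Longrightarrow> j < m \<Longrightarrow> ?R (B + 8 * j) = R j"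
    "\<And>r. r \<noteq> 0 \<Longrightarrow> (\<forall>j. 3 \<le> j \<and> j < m \<longrightarrow> r \<noteq> B + 8 * j) \<Longrightarrow> ?R r = R r"
    using step by auto
  have "lin (save_regs (Suc m)) R = (?R(B + 8 * m := R m))(0 := B + 8 * Suc m)"
  proof -
    have "lin (save_regs (Suc m)) R = lin [Store 0 m, Add 0 0 1] ?R"
      using step.hyps unfolding save_regs_def by simp
    moreover have "?R m = R m" "?R 1 = 8" using IH(3)[of m] IH(3)[of 1] step assms by auto
    ultimately show ?thesis using IH(1) assms by (simp add: fun_eq_iff)
  qed
  then show ?case using IH assms(3) step.hyps by (auto simp: less_Suc_eq)
qed

text \<open>The targets lie above \<open>B\<close>, beyond the last input register \<open>l\<close>,
  so no entry is overwritten before it is read.\<close>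

lemma move_code_correct:
  assumes "code_at P q (move_code q)" "R 0 = B + 8 * j" "R 1 = 8" "R 2 = j" "R 3 = Suc l" "R 5 = 1"
    "200 \<le> j" "l < B" "200 \<le> B"
  shows "\<exists>R'. steps P (7 * (Suc l - j) + 2) (q, R) (q + 7, R') \<and> R' 40 = R 40 \<and>
     (\<forall>i. j \<le> i \<and> i \<le> l \<longrightarrow> R' (B + 8 * i) = R i) \<and>
     (\<forall>r. 200 \<le> r \<and> (\<forall>i. j \<le> i \<and> i \<le> l \<longrightarrow> r \<noteq> B + 8 * i) \<longrightarrow> R' r = R r)"
  using assms
proof (induction "Suc l - j" arbitrary: j R)
  case 0
  have c: "code_at P q [Sub 4 3 2]" "code_at P (q + 1) [JumpZero 4 (q + 7)]"
    using 0(2) by (auto simp: move_code_def)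
  have "steps P 1 (q, R) (q + 1, R(4 := 0))" by (rule steps_one[OF c(1)]) (use 0 in simp)
  moreover have "steps P 1 (q + 1, R(4 := 0)) (q + 7, R(4 := 0))" by (rule steps_one[OF c(2)]) simp
  ultimately have "steps P (1 + 1) (q, R) (q + 7, R(4 := 0))" by (rule steps_trans)
  then have "steps P (7 * (Suc l - j) + 2) (q, R) (q + 7, R(4 := 0))"
    by (rule steps_eq) (use 0 in simp_all)
  moreover have "\<not> j \<le> l" using 0 by simp
  ultimately show ?case by (intro exI[of _ "R(4 := 0)"]) (auto simp del: fun_upd_apply, auto)
next
  case (Suc n)
  have jl: "j \<le> l" using Suc.hyps by simp
  have c: "code_at P q [Sub 4 3 2]" "code_at P (q + 1) [JumpZero 4 (q + 7)]"
    "code_at P (q + 2) [Load 4 2, Store 0 4, Add 0 0 1, Add 2 2 5]" "code_at P (q + 6) [Jump q]"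
    using Suc.prems(1) by (auto simp: move_code_def eval_nat_numeral)
  define R1 where "R1 = R(4 := R j, B + 8 * j := R j, 0 := B + 8 * Suc j, 2 := Suc j)"
  have s1: "steps P 1 (q, R) (q + 1, R(4 := Suc l - j))"
    by (rule steps_one[OF c(1)]) (use Suc.prems in simp)
  have s2: "steps P 1 (q + 1, R(4 := Suc l - j)) (q + 2, R(4 := Suc l - j))"
    by (rule steps_one[OF c(2)]) (use jl in simp)
  have s3: "steps P 4 (q + 2, R(4 := Suc l - j)) (q + 6, R1)"
    by (rule steps_lin[OF _ c(3)]) (use Suc.prems in \<open>auto simp: R1_def fun_eq_iff\<close>)
  have s4: "steps P 1 (q + 6, R1) (q, R1)" by (rule steps_one[OF c(4)]) simp
  note s = steps_trans[OF steps_trans[OF s1 s2] steps_trans[OF s3 s4]]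
  obtain R' where R': "steps P (7 * (Suc l - Suc j) + 2) (q, R1) (q + 7, R')" "R' 40 = R1 40"
    "\<And>i. Suc j \<le> i \<Longrightarrow> i \<le> l \<Longrightarrow> R' (B + 8 * i) = R1 i"
    "\<And>r. 200 \<le> r \<Longrightarrow> (\<forall>i. Suc j \<le> i \<and> i \<le> l \<longrightarrow> r \<noteq> B + 8 * i) \<Longrightarrow> R' r = R1 r"
  proof -
    have "\<exists>R'. steps P (7 * (Suc l - Suc j) + 2) (q, R1) (q + 7, R') \<and> R' 40 = R1 40 \<and>
      (\<forall>i. Suc j \<le> i \<and> i \<le> l \<longrightarrow> R' (B + 8 * i) = R1 i) \<and>
      (\<forall>r. 200 \<le> r \<and> (\<forall>i. Suc j \<le> i \<and> i \<le> l \<longrightarrow> r \<noteq> B + 8 * i) \<longrightarrow> R' r = R1 r)"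
      by (rule Suc.hyps(1)) (use Suc.prems Suc.hyps(2) in \<open>auto simp: R1_def\<close>)
    then show ?thesis using that by blast
  qed
  have "steps P (7 * (Suc l - j) + 2) (q, R) (q + 7, R')"
    by (rule steps_eq[OF steps_trans[OF s R'(1)]]) (use jl in auto)
  moreover have "R' 40 = R 40" using R'(2) Suc.prems by (simp add: R1_def)
  moreover have "R' (B + 8 * i) = R i" if "j \<le> i" "i \<le> l" for i
  proof (cases "i = j")
    case True
    then show ?thesis using R'(4)[of "B + 8 * j"] Suc.prems by (auto simp: R1_def)
  next
    case False
    then show ?thesis using R'(3)[of i] that Suc.prems by (auto simp: R1_def)
  qed
  moreover have "R' r = R r" if "200 \<le> r" "\<forall>i. j \<le> i \<and> i \<le> l \<longrightarrow> r \<noteq> B + 8 * i" for r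
    using R'(4)[of r] that jl by (auto simp: R1_def)
  ultimately show ?case by blast
qed

definition prelude :: "instr list" where
  "prelude = (save_code @ save_regs 200 @ setup_code) @ move_code 418"

definition compile :: "com \<Rightarrow> instr list" where
  "compile c = prelude @ ccom 0 425 c"

lemma prelude_correct:
  assumes "xs \<noteq> []" "code_at P 0 prelude"
  shows "\<exists>t R s B. t \<le> 7 * length xs + 420 \<and> steps P t (init_config xs) (425, R) \<and> rel B R s \<and>
     (\<forall>i<length xs. ar s 0 (Suc i) = xs ! i)"
proof -
  define l where "l = length xs"
  define B where "B = 4 * l + 200"
  define R0 where "R0 = snd (init_config xs)"
  have l: "0 < l" using assms unfolding l_def by simp
  have init: "init_config xs = (0, R0)" by (simp add: R0_def init_config_def)
  have R0: "R0 0 = l" "\<And>i. i < l \<Longrightarrow> R0 (Suc i) = xs ! i"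
    by (simp_all add: R0_def init_config_def l_def)
  define R1 where "R1 = lin save_code R0"
  note R1 = lin_save_code[of l R0 B, OF l R0(1) B_def, folded R1_def]
  define R2 where "R2 = lin (save_regs 200) R1"
  have R2: "R2 0 = B + 1600" "\<And>j. 3 \<le> j \<Longrightarrow> j < 200 \<Longrightarrow> R2 (B + 8 * j) = R1 j"
    "\<And>r. r \<noteq> 0 \<Longrightarrow> (\<forall>j. 3 \<le> j \<and> j < 200 \<longrightarrow> r \<noteq> B + 8 * j) \<Longrightarrow> R2 r = R1 r"
    using lin_save_regs[OF R1(1,2), of 200] unfolding R2_def by (auto simp: B_def)
  define R3 where "R3 = lin setup_code R2"
  have "R2 1 = 8" using R2(3)[of 1] R1(2) by (simp add: B_def)
  then have R3: "R3 0 = B + 1600" "R3 1 = 8" "R3 2 = 200" "R3 3 = Suc l" "R3 5 = 1" "R3 40 = B"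
    "\<And>r. 200 \<le> r \<Longrightarrow> R3 r = R2 r"
    using R2(1) unfolding R3_def setup_code_def by (auto simp: B_def)
  have len: "length (save_code @ save_regs 200 @ setup_code) = 418"
    by (simp add: save_code_def setup_code_def length_save_regs)
  have "code_at P 0 ((save_code @ save_regs 200 @ setup_code) @ move_code 418)"
    using assms(2) unfolding prelude_def .
  then have "code_at P 0 (save_code @ save_regs 200 @ setup_code) \<and> code_at P 418 (move_code 418)"
    unfolding code_at_append[of P 0 "save_code @ save_regs 200 @ setup_code"] len by simp
  then have code: "code_at P 0 (save_code @ save_regs 200 @ setup_code)" "code_at P 418 (move_code 418)"
    by blast+
  have s1: "steps P 418 (0, R0) (418, R3)"
    by (rule steps_lin[OF _ code(1) len])
      (simp_all add: straight_save_regs R3_def R2_def R1_def, simp_all add: save_code_def setup_code_def)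
  obtain R4 where R4: "steps P (7 * (Suc l - 200) + 2) (418, R3) (418 + 7, R4)" "R4 40 = R3 40"
    "\<And>i. 200 \<le> i \<Longrightarrow> i \<le> l \<Longrightarrow> R4 (B + 8 * i) = R3 i"
    "\<And>r. 200 \<le> r \<Longrightarrow> (\<forall>i. 200 \<le> i \<and> i \<le> l \<longrightarrow> r \<noteq> B + 8 * i) \<Longrightarrow> R4 r = R3 r"
    using move_code_correct[OF code(2), of R3 B 200 l] R3 by (auto simp: B_def)
  \<comment> \<open>The state is read off the memory. Only the input is known about it, so programs
    have to initialise what they use.\<close>
  define s where "s = \<lparr>vr = R4, ar = \<lambda>t i. R4 (B + 8 * i + t)\<rparr>"
  have "rel B R4 s" using R4(2) R3(6) by (simp add: rel_def s_def B_def)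
  moreover have "ar s 0 (Suc i) = xs ! i" if i: "i < length xs" for i
  proof -
    have "R4 (B + 8 * Suc i) = R0 (Suc i)"
    proof (cases "200 \<le> Suc i")
      case True
      then have "R4 (B + 8 * Suc i) = R3 (Suc i)" using R4(3)[of "Suc i"] i l_def by simp
      also have "\<dots> = R2 (Suc i)" using R3(7) True by simp
      also have "\<dots> = R1 (Suc i)" using R2(3)[of "Suc i"] i l_def by (simp add: B_def)
      also have "\<dots> = R0 (Suc i)" using R1(5)[of "Suc i"] True i l_def by simp
      finally show ?thesis .
    next
      case False
      then have "R4 (B + 8 * Suc i) = R2 (B + 8 * Suc i)"
        using R4(4)[of "B + 8 * Suc i"] R3(7)[of "B + 8 * Suc i"] by (simp add: B_def)
      also have "\<dots> = R0 (Suc i)"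
      proof (cases "3 \<le> Suc i")
        case True
        then show ?thesis using False R2(2)[of "Suc i"] R1(5)[of "Suc i"] i l_def by simp
      next
        case small: False
        then consider "i = 0" | "i = 1" by linarith
        then show ?thesis
        proof cases
          case 1
          then show ?thesis using R2(3)[of "B + 8"] R1(3) by (simp add: B_def)
        next
          case 2
          then show ?thesis using R2(3)[of "B + 16"] R1(4) i l_def by (simp add: B_def numeral_2_eq_2)
        qed
      qed
      finally show ?thesis .
    qed
    then show ?thesis using R0(2) i l_def by (simp add: s_def)
  qed
  moreover have "steps P (418 + (7 * (Suc l - 200) + 2)) (init_config xs) (425, R4)"
    unfolding init using steps_trans[OF s1 R4(1)] by simp
  moreover have "418 + (7 * (Suc l - 200) + 2) \<le> 7 * length xs + 420" by (simp add: l_def)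
  ultimately show ?thesis by blast
qed

lemma length_prelude: "length prelude = 425"
  by (simp add: prelude_def save_code_def setup_code_def move_code_def length_save_regs)

text \<open>A halted machine stays where it is, so the output persists. This allows a time bound far
  above the actual running time.\<close>

theorem compile_run:
  assumes "xs \<noteq> []" "wfc 0 c"
  shows "\<exists>s. (\<forall>i<length xs. ar s 0 (Suc i) = xs ! i) \<and>
     (\<forall>t\<ge>7 * length xs + 420 + tm c s. outputs_within (compile c) xs t (vr (sem c s) 0))"
proof -
  let ?P = "compile c"
  have code: "code_at ?P 0 prelude" "code_at ?P 425 (ccom 0 425 c)"
    using code_at_infix[of "[]" prelude "ccom 0 425 c"] code_at_infix[of prelude "ccom 0 425 c" "[]"]
    unfolding compile_def length_prelude by simp_all
  obtain t0 R s B where t0: "t0 \<le> 7 * length xs + 420" "steps ?P t0 (init_config xs) (425, R)"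
    "rel B R s" "\<forall>i<length xs. ar s 0 (Suc i) = xs ! i"
    using prelude_correct[OF assms(1) code(1)] by blast
  obtain R' where R': "steps ?P (tm c s) (425, R) (425 + csize c, R')" "rel B R' (sem c s)"
    using ccom_correct[OF t0(3) assms(2) _ code(2)] by auto
  note st = steps_trans[OF t0(2) R'(1)]
  have h: "halted ?P (425 + csize c, R')" unfolding halted_def compile_def by (simp add: length_prelude)
  have "outputs_within ?P xs t (vr (sem c s) 0)" if t: "7 * length xs + 420 + tm c s \<le> t" for t
  proof -
    have "t0 + tm c s \<le> t" using t0(1) t by linarith
    then obtain e where e: "t = (t0 + tm c s) + e" using le_Suc_ex by blast
    have stay: "steps ?P e (425 + csize c, R') (425 + csize c, R')"
      unfolding steps_def by (induction e) (use h in \<open>auto simp: step_def\<close>)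
    have "steps ?P t (init_config xs) (425 + csize c, R')"
      unfolding e by (rule steps_trans[OF st stay])
    then have "(step ?P ^^ t) (init_config xs) = (425 + csize c, R')" unfolding steps_def .
    moreover have "R' 0 = vr (sem c s) 0" using R'(2) unfolding rel_def by simp
    ultimately show ?thesis using h unfolding outputs_within_def by (simp add: Let_def)
  qed
  then show ?thesis using t0(4) by blast
qed

section \<open>Frames, loop invariants and time bounds\<close>

primrec wrv :: "com \<Rightarrow> nat set" where
  "wrv Skip = {}"
| "wrv (Asg x e) = {x}"
| "wrv (Put t i e) = {}"
| "wrv (Seq c1 c2) = wrv c1 \<union> wrv c2"
| "wrv (If e c1 c2) = wrv c1 \<union> wrv c2"
| "wrv (For x e c) = insert x (wrv c)"

primrec wra :: "com \<Rightarrow> nat set" where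
  "wra Skip = {}"
| "wra (Asg x e) = {}"
| "wra (Put t i e) = {t}"
| "wra (Seq c1 c2) = wra c1 \<union> wra c2"
| "wra (If e c1 c2) = wra c1 \<union> wra c2"
| "wra (For x e c) = wra c"

lemma vr_sem: "x \<notin> wrv c \<Longrightarrow> vr (sem c s) x = vr s x"
proof (induction c arbitrary: s)
  case (For y e c)
  have "vr (iter (\<lambda>j s'. sem c (set_var y j s')) s m) x = vr s x" for m
    by (induction m) (use For in auto)
  then show ?case by simp
qed auto

lemma ar_sem: "t \<notin> wra c \<Longrightarrow> ar (sem c s) t = ar s t"
proof (induction c arbitrary: s)
  case (For y e c)
  have "ar (iter (\<lambda>j s'. sem c (set_var y j s')) s m) t = ar s t" for m
    by (induction m) (use For in auto)
  then show ?case by simp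
qed auto

definition agree :: "nat set \<Rightarrow> nat set \<Rightarrow> st \<Rightarrow> st \<Rightarrow> bool" where
  "agree W A s s' \<longleftrightarrow> (\<forall>y. y \<notin> W \<longrightarrow> vr s' y = vr s y) \<and> (\<forall>t. t \<notin> A \<longrightarrow> ar s' t = ar s t)"

lemma agreeD: "agree W A s s' \<Longrightarrow> y \<notin> W \<Longrightarrow> vr s' y = vr s y"
  "agree W A s s' \<Longrightarrow> t \<notin> A \<Longrightarrow> ar s' t = ar s t"
  by (auto simp: agree_def)

lemma agree_refl: "agree W A s s"
  by (simp add: agree_def)

lemma agree_trans: "agree W A s s' \<Longrightarrow> agree W A s' s'' \<Longrightarrow> agree W A s s''"
  by (simp add: agree_def)

lemma agree_sem: "wrv c \<subseteq> W \<Longrightarrow> wra c \<subseteq> A \<Longrightarrow> agree W A s (sem c s)"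
  unfolding agree_def using vr_sem ar_sem by blast

lemma agree_set_var: "x \<in> W \<Longrightarrow> agree W A s (set_var x a s)"
  by (auto simp: agree_def)

text \<open>The frame of the body is supplied to the invariance proof, so that invariants need to
  mention only what the loop changes.\<close>

lemma iter_invariant:
  assumes "I 0 s"
    and "\<And>j s'. j < m \<Longrightarrow> I j s' \<Longrightarrow> agree (insert x (wrv c)) (wra c) s s' \<Longrightarrow>
           I (Suc j) (sem c (set_var x j s'))"
  defines "S \<equiv> iter (\<lambda>j s'. sem c (set_var x j s')) s"
  shows "i \<le> m \<Longrightarrow> I i (S i) \<and> agree (insert x (wrv c)) (wra c) s (S i)"
proof (induction i)
  case 0
  then show ?case using assms(1) by (simp add: S_def agree_refl)
next
  case (Suc i)
  then have "I i (S i)" "agree (insert x (wrv c)) (wra c) s (S i)" by auto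
  moreover have "agree (insert x (wrv c)) (wra c) (S i) (S (Suc i))"
    by (auto simp: S_def intro!: agree_trans[OF agree_set_var agree_sem])
  moreover have "S (Suc i) = sem c (set_var x i (S i))" by (simp add: S_def)
  ultimately show ?case using assms(2)[of i "S i"] Suc.prems agree_trans by auto
qed

lemma For_rule:
  assumes "I 0 s"
    and "\<And>j s'. j < eval e s \<Longrightarrow> I j s' \<Longrightarrow> agree (insert x (wrv c)) (wra c) s s' \<Longrightarrow>
           I (Suc j) (sem c (set_var x j s'))"
  shows "I (eval e s) (sem (For x e c) s)"
  using iter_invariant[of I s "eval e s" x c "eval e s"] assms by simp

lemma For_time:
  assumes "I 0 s"
    and "\<And>j s'. j < eval e s \<Longrightarrow> I j s' \<Longrightarrow> agree (insert x (wrv c)) (wra c) s s' \<Longrightarrow>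
           I (Suc j) (sem c (set_var x j s')) \<and> tm c (set_var x j s') \<le> b"
  shows "tm (For x e c) s \<le> ecost e + 5 + eval e s * (7 + b)"
proof -
  let ?S = "iter (\<lambda>j s'. sem c (set_var x j s')) s"
  have "I j (?S j) \<and> agree (insert x (wrv c)) (wra c) s (?S j)" if "j < eval e s" for j
    using iter_invariant[of I s "eval e s" x c j] assms that by auto
  then have "(\<Sum>j<eval e s. 7 + tm c (set_var x j (?S j))) \<le> (\<Sum>j<eval e s. 7 + b)"
    by (intro sum_mono) (use assms(2) in auto)
  then show ?thesis by simp
qed

primrec limits_in :: "nat set \<Rightarrow> com \<Rightarrow> bool" where
  "limits_in Z Skip \<longleftrightarrow> True"
| "limits_in Z (Asg x e) \<longleftrightarrow> True"
| "limits_in Z (Put t i e) \<longleftrightarrow> True"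
| "limits_in Z (Seq c1 c2) \<longleftrightarrow> limits_in Z c1 \<and> limits_in Z c2"
| "limits_in Z (If e c1 c2) \<longleftrightarrow> limits_in Z c1 \<and> limits_in Z c2"
| "limits_in Z (For x e c) \<longleftrightarrow> (\<exists>y\<in>Z. e = Var y) \<and> limits_in Z c"

primrec dep :: "com \<Rightarrow> nat" where
  "dep Skip = 0"
| "dep (Asg x e) = 0"
| "dep (Put t i e) = 0"
| "dep (Seq c1 c2) = max (dep c1) (dep c2)"
| "dep (If e c1 c2) = max (dep c1) (dep c2)"
| "dep (For x e c) = Suc (dep c)"

primrec kc :: "com \<Rightarrow> nat" where
  "kc Skip = 0"
| "kc (Asg x e) = ecost e + 2"
| "kc (Put t i e) = ecost i + ecost e + 7"
| "kc (Seq c1 c2) = kc c1 + kc c2"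
| "kc (If e c1 c2) = ecost e + 2 + kc c1 + kc c2"
| "kc (For x e c) = ecost e + 12 + kc c"

text \<open>Limits in \<open>Z\<close> are never assigned, so each of at most \<open>dep c\<close>
  nested loops makes at most \<open>M\<close> rounds. The base \<open>M + 1\<close> is positive,
  which lets shallower parts be padded to the full depth. Polynomial factors are read off the syntax
  this way; the remaining loops are counted with \<open>For_time\<close>.\<close>

lemma tm_le:
  assumes "limits_in Z c" "wrv c \<inter> Z = {}" "\<And>y. y \<in> Z \<Longrightarrow> vr s y \<le> M"
  shows "tm c s \<le> kc c * (M + 1) ^ dep c"
  using assms
proof (induction c arbitrary: s)
  case (Seq c1 c2)
  have 1: "tm c1 s \<le> kc c1 * (M + 1) ^ dep c1" using Seq by auto
  have "tm c2 (sem c1 s) \<le> kc c2 * (M + 1) ^ dep c2"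
  proof (rule Seq.IH(2))
    fix y assume "y \<in> Z"
    moreover from this have "vr (sem c1 s) y = vr s y" using Seq.prems(2) by (intro vr_sem) auto
    ultimately show "vr (sem c1 s) y \<le> M" using Seq.prems(3) by simp
  qed (use Seq.prems in auto)
  with 1 have "tm (Seq c1 c2) s \<le> kc c1 * (M + 1) ^ dep c1 + kc c2 * (M + 1) ^ dep c2" by simp
  also have "\<dots> \<le> kc c1 * (M + 1) ^ dep (Seq c1 c2) + kc c2 * (M + 1) ^ dep (Seq c1 c2)"
    by (intro add_mono mult_left_mono power_increasing) auto
  finally show ?case by (simp add: algebra_simps)
next
  case (If e c1 c2)
  have "tm c1 s \<le> kc c1 * (M + 1) ^ dep c1" "tm c2 s \<le> kc c2 * (M + 1) ^ dep c2"
    using If by auto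
  then have "tm (If e c1 c2) s \<le> (ecost e + 2) * 1 + kc c1 * (M + 1) ^ dep c1 + kc c2 * (M + 1) ^ dep c2"
    by auto
  also have "\<dots> \<le> (ecost e + 2) * (M + 1) ^ dep (If e c1 c2) + kc c1 * (M + 1) ^ dep (If e c1 c2)
      + kc c2 * (M + 1) ^ dep (If e c1 c2)"
    by (intro add_mono mult_left_mono power_increasing) auto
  finally show ?case by (simp add: algebra_simps)
next
  case (For x e c)
  then obtain y where y: "y \<in> Z" "e = Var y" by auto
  have "tm (For x e c) s \<le> ecost e + 5 + eval e s * (7 + kc c * (M + 1) ^ dep c)"
  proof (rule For_time[where I = "\<lambda>_ _. True"])
    fix j s' assume a: "agree (insert x (wrv c)) (wra c) s s'"
    have "vr (set_var x j s') y \<le> M" if "y \<in> Z" for y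
    proof -
      have "y \<notin> insert x (wrv c)" using For.prems(2) that by auto
      then show ?thesis using agreeD(1)[OF a, of y] For.prems(3)[OF that] by simp
    qed
    then show "True \<and> tm c (set_var x j s') \<le> kc c * (M + 1) ^ dep c"
      using For by auto
  qed simp
  also have "\<dots> \<le> ecost e + 5 + M * (7 + kc c * (M + 1) ^ dep c)"
    using For.prems(3) y by (intro add_mono mult_right_mono) auto
  also have "\<dots> \<le> (ecost e + 5) * (M + 1) ^ Suc (dep c) + (M + 1) * (7 * (M + 1) ^ dep c + kc c * (M + 1) ^ dep c)"
  proof -
    have "(ecost e + 5) * 1 \<le> (ecost e + 5) * (M + 1) ^ Suc (dep c)"
      by (intro mult_le_mono2 one_le_power) simp
    moreover have "M * (7 * 1 + kc c * (M + 1) ^ dep c) \<le>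
        (M + 1) * (7 * (M + 1) ^ dep c + kc c * (M + 1) ^ dep c)"
      by (intro mult_le_mono add_le_mono le_refl one_le_power) simp_all
    ultimately show ?thesis by (simp only: mult_1_right)
  qed
  also have "\<dots> = kc (For x e c) * (M + 1) ^ dep (For x e c)" by (simp add: algebra_simps)
  finally show ?case .
qed auto

section \<open>The algorithm\<close>

text \<open>
  Variables: 0 the answer, 1 the number \<open>n\<close> of vertices, 2 the number \<open>k\<close>, 3 and 4 the guessed vertices,
  6 the code of the guessed set \<open>F\<close> and 5 the number of codes, 7 the length of the list in array 1.
  Arrays: 0 the input, 1 the list of the vertices near the guessed ones (with repetitions), 2 the current
  alliance, 3 the set whose connectedness is tested, 4 its vertices not yet reached, and 5 the indices in
  the input where the rows of the adjacency matrix start.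
\<close>

definition adj :: "exp \<Rightarrow> exp \<Rightarrow> exp" where
  "adj a b = Arr 0 (Plus (Arr 5 a) b)"

text \<open>Truncated subtraction acts as a comparison: variable 14 stays positive exactly if the
  degree exceeds \<open>2 * nb X v + 1\<close>.\<close>

definition undef_com :: "nat \<Rightarrow> nat \<Rightarrow> com" where
  "undef_com t v =
     Seq (Asg 15 (Cst 0)) (Seq (Asg 16 (Cst 0)) (Seq
       (For 17 (Var 1) (If (adj (Var v) (Var 17))
          (Seq (Asg 16 (Plus (Var 16) (Cst 1)))
               (If (Arr t (Var 17)) (Asg 15 (Plus (Var 15) (Cst 1))) Skip)) Skip))
       (Asg 14 (Minus (Var 16) (Plus (Plus (Var 15) (Var 15)) (Cst 1))))))"

definition sweep :: "nat \<Rightarrow> nat \<Rightarrow> nat \<Rightarrow> com \<Rightarrow> nat \<Rightarrow> com" where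
  "sweep t r v c f = For r (Var 1) (For v (Var 1)
     (Seq c (If (Var f) (If (Arr t (Var v)) (Put t (Var v) (Cst 0)) Skip) Skip)))"

definition copy_com :: "nat \<Rightarrow> nat \<Rightarrow> com" where
  "copy_com t t' = For 21 (Var 1) (Put t (Var 21) (Arr t' (Var 21)))"

definition reach_com :: com where
  "reach_com = Seq (copy_com 4 3) (Seq (Put 4 (Var 20) (Cst 0))
     (sweep 4 22 21
       (Seq (Asg 23 (Cst 0))
         (For 24 (Var 1) (If (adj (Var 21) (Var 24))
            (If (Arr 3 (Var 24)) (If (Arr 4 (Var 24)) Skip (Asg 23 (Cst 1))) Skip) Skip)))
       23))"

definition check_com :: com where
  "check_com = Seq (Asg 26 (Cst 0))
     (Seq (For 21 (Var 1) (If (Arr 3 (Var 21)) (Seq (Asg 20 (Var 21)) (Asg 26 (Cst 1))) Skip))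
     (If (Var 26)
       (Seq reach_com
       (Seq (For 21 (Var 1) (If (Arr 4 (Var 21)) (Asg 26 (Cst 0)) Skip))
            (For 21 (Var 1) (If (Arr 3 (Var 21))
               (Seq (undef_com 3 21) (If (Var 14) (Asg 26 (Cst 0)) Skip)) Skip))))
       Skip))"

definition shrink_com :: com where
  "shrink_com = sweep 2 13 12 (Seq (copy_com 3 2) (Seq (Put 3 (Var 12) (Cst 0)) check_com)) 26"

text \<open>Bit \<open>i\<close> of variable 6 decides whether list entry \<open>i\<close> belongs
  to the guessed set. The lowest bit is what remains after twice the half is subtracted.\<close>

definition decode_com :: com where
  "decode_com = Seq (For 21 (Var 1) (Put 2 (Var 21) (Cst 1))) (Seq (Asg 18 (Var 6))
     (For 9 (Var 7) (Seq (Asg 19 (Hlf (Var 18)))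
       (Seq (If (Minus (Var 18) (Plus (Var 19) (Var 19))) (Put 2 (Arr 1 (Var 9)) (Cst 0)) Skip)
            (Asg 18 (Var 19))))))"

definition run_com :: com where
  "run_com = Seq decode_com (Seq (sweep 2 13 12 (undef_com 2 12) 14)
     (If (Arr 2 (Var 3))
       (Seq (copy_com 3 2) (Seq (Asg 20 (Var 3)) (Seq reach_com
       (Seq (For 21 (Var 1) (If (Arr 4 (Var 21)) (Put 2 (Var 21) (Cst 0)) Skip))
       (Seq shrink_com
       (Seq (Asg 25 (Cst 0))
       (Seq (For 21 (Var 1) (If (Arr 2 (Var 21)) (Asg 25 (Plus (Var 25) (Cst 1))) Skip))
            (If (Minus (Var 2) (Var 25)) Skip (Asg 0 (Cst 1))))))))))
       Skip))"

section \<open>Correctness of the subroutines for one guess\<close>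

locale graph_run = ugraph "{..<n}" E for n :: nat and E :: "nat \<Rightarrow> nat \<Rightarrow> bool"
begin

text \<open>The start of each matrix row is tabulated in array 5 because the machine cannot multiply
  by \<open>n\<close>.\<close>

definition ctx :: "st \<Rightarrow> bool" where
  "ctx s \<longleftrightarrow> vr s 1 = n \<and> (\<forall>u<n. \<forall>v<n. ar s 0 (ar s 5 u + v) = of_bool (E u v))"

definition mem :: "nat \<Rightarrow> st \<Rightarrow> nat set" where
  "mem t s = {v. v < n \<and> ar s t v \<noteq> 0}"

lemma ctx_cong: "ctx s \<Longrightarrow> vr s' 1 = vr s 1 \<Longrightarrow> ar s' 0 = ar s 0 \<Longrightarrow> ar s' 5 = ar s 5 \<Longrightarrow> ctx s'"
  by (simp add: ctx_def)

lemma ctx_agree: "ctx s \<Longrightarrow> agree W A s s' \<Longrightarrow> 1 \<notin> W \<Longrightarrow> 0 \<notin> A \<Longrightarrow> 5 \<notin> A \<Longrightarrow> ctx s'"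
  by (auto simp: agree_def elim!: ctx_cong)

lemma ctx_sem: "ctx s \<Longrightarrow> 1 \<notin> wrv c \<Longrightarrow> 0 \<notin> wra c \<Longrightarrow> 5 \<notin> wra c \<Longrightarrow> ctx (sem c s)"
  by (auto intro: ctx_cong simp: vr_sem ar_sem)

lemma ctx_set_var [simp]: "x \<noteq> 1 \<Longrightarrow> ctx (set_var x a s) \<longleftrightarrow> ctx s"
  by (auto simp: ctx_def)

lemma mem_cong: "ar s' t = ar s t \<Longrightarrow> mem t s' = mem t s"
  by (simp add: mem_def)

lemma mem_sem: "t \<notin> wra c \<Longrightarrow> mem t (sem c s) = mem t s"
  by (simp add: mem_def ar_sem)

lemma mem_set_var [simp]: "mem t (set_var x a s) = mem t s"
  by (simp add: mem_def)

lemma mem_sub: "mem t s \<subseteq> {..<n}"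
  by (auto simp: mem_def)

lemma finite_mem: "finite (mem t s)"
  using mem_sub finite_subset by blast

lemma eval_adj: "ctx s \<Longrightarrow> eval a s < n \<Longrightarrow> eval b s < n \<Longrightarrow> eval (adj a b) s = of_bool (E (eval a s) (eval b s))"
  by (simp add: adj_def ctx_def)

lemma undef_com_frame: "wrv (undef_com t v) = {14, 15, 16, 17}" "wra (undef_com t v) = {}"
  by (auto simp: undef_com_def)

lemma card_less_Suc: "card {u. u < Suc j \<and> P u} = card {u. u < j \<and> P u} + of_bool (P j)"
proof (cases "P j")
  case True
  then have "{u. u < Suc j \<and> P u} = insert j {u. u < j \<and> P u}" by auto
  then show ?thesis using True by simp
next
  case False
  then have "{u. u < Suc j \<and> P u} = {u. u < j \<and> P u}" by (auto simp: less_Suc_eq)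
  then show ?thesis using False by simp
qed

lemma undef_com_correct:
  assumes "ctx s" "vr s v < n" "v \<notin> {15, 16, 17}"
  shows "vr (sem (undef_com t v) s) 14 \<noteq> 0 \<longleftrightarrow> undefended (mem t s) (vr s v)"
proof -
  define x where "x = vr s v"
  define s0 where "s0 = set_var 16 0 (set_var 15 0 s)"
  define c where "c = If (adj (Var v) (Var 17)) (Seq (Asg 16 (Plus (Var 16) (Cst 1)))
               (If (Arr t (Var 17)) (Asg 15 (Plus (Var 15) (Cst 1))) Skip)) Skip"
  define I where "I j s' \<longleftrightarrow> vr s' 16 = card {u. u < j \<and> E x u} \<and>
     vr s' 15 = card {u. u < j \<and> E x u \<and> ar s t u \<noteq> 0}" for j and s' :: st
  have c0: "ctx s0" using assms by (simp add: s0_def)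
  have n: "eval (Var 1) s0 = n" using c0 by (simp add: ctx_def)
  have "I (eval (Var 1) s0) (sem (For 17 (Var 1) c) s0)"
  proof (rule For_rule)
    show "I 0 s0" by (simp add: I_def s0_def)
    fix j s' assume j: "j < eval (Var 1) s0" and I: "I j s'" and a: "agree (insert 17 (wrv c)) (wra c) s0 s'"
    have "ctx s'" using ctx_agree[OF c0 a] by (simp add: c_def)
    then have cx: "ctx (set_var 17 j s')" by simp
    have v: "vr s' v = x" "ar s' = ar s"
      using agreeD(1)[OF a, of v] agreeD(2)[OF a] assms by (auto simp: c_def s0_def x_def)
    then have e: "eval (adj (Var v) (Var 17)) (set_var 17 j s') = of_bool (E x j)"
      using eval_adj[OF cx, of "Var v" "Var 17"] assms j n by (auto simp: x_def)
    show "I (Suc j) (sem c (set_var 17 j s'))"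
      using I v unfolding I_def c_def by (simp add: e card_less_Suc)
  qed
  then have "I n (sem (For 17 (Var 1) c) s0)" using n by simp
  moreover have "card {u. u < n \<and> E x u} = nb {..<n} x" "card {u. u < n \<and> E x u \<and> ar s t u \<noteq> 0} = nb (mem t s) x"
    unfolding nb_def mem_def by (rule arg_cong[where f = card], auto)+
  moreover have "vr (sem (undef_com t v) s) 14 =
     vr (sem (For 17 (Var 1) c) s0) 16 - (vr (sem (For 17 (Var 1) c) s0) 15 + vr (sem (For 17 (Var 1) c) s0) 15 + 1)"
    by (simp add: undef_com_def c_def s0_def del: sem.simps(6))
  ultimately show ?thesis unfolding I_def undefended_def x_def by auto
qed

lemma sweep_frame: "wrv (sweep t r v c f) = insert r (insert v (wrv c))" "wra (sweep t r v c f) = insert t (wra c)"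
  by (auto simp: sweep_def)

lemma mem_clear: "mem t (set_arr t i 0 s) = mem t s - {i}"
  by (auto simp: mem_def)

lemma rem_fixpoint:
  assumes "(rem P)\<^sup>*\<^sup>* X Y" "\<forall>v\<in>X. \<not> P v X"
  shows "Y = X"
  using assms(1)
proof (cases rule: converse_rtranclpE)
  case (step Z)
  then show ?thesis using assms(2) by (auto simp: rem_def)
qed simp

text \<open>
  Each of the \<open>n\<close> rounds of a sweep deletes a vertex unless a fixed point has been reached.
\<close>

lemma sweep_correct:
  assumes n: "vr s 1 = n" and fresh: "1 \<notin> insert r (insert v (wrv c))" "v \<notin> wrv c" "t \<notin> wra c"
    and c: "\<And>s'. agree (insert r (insert v (wrv c))) (insert t (wra c)) s s' \<Longrightarrow> vr s' v < n \<Longrightarrow>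
       vr (sem c s') f \<noteq> 0 \<longleftrightarrow> P (vr s' v) (mem t s')"
  defines "X \<equiv> mem t s" and "Y \<equiv> mem t (sem (sweep t r v c f) s)"
  shows "(rem P)\<^sup>*\<^sup>* X Y" "\<forall>v\<in>Y. \<not> P v Y"
proof -
  let ?W = "insert r (insert v (wrv c))" and ?A = "insert t (wra c)"
  define b where "b = Seq c (If (Var f) (If (Arr t (Var v)) (Put t (Var v) (Cst 0)) Skip) Skip)"
  have frame_b: "wrv b = wrv c" "wra b = ?A" by (auto simp: b_def)
  have body: "mem t (sem b (set_var v j s')) =
      (if j \<in> mem t s' \<and> P j (mem t s') then mem t s' - {j} else mem t s')"
    if a: "agree ?W ?A s s'" and j: "j < n" for s' j
  proof -
    let ?s = "set_var v j s'"
    have "agree ?W ?A s ?s" by (rule agree_trans[OF a agree_set_var]) simp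
    then have P: "vr (sem c ?s) f \<noteq> 0 \<longleftrightarrow> P j (mem t s')" using c[of ?s] j by simp
    have "ar (sem c ?s) t = ar s' t" "vr (sem c ?s) v = j" using fresh by (simp_all add: ar_sem vr_sem)
    then show ?thesis using P j mem_cong[of "sem c ?s" t s']
      by (auto simp: b_def mem_clear) (auto simp: mem_def)
  qed
  have inner: "(rem P)\<^sup>*\<^sup>* (mem t s1) (mem t (sem (For v (Var 1) b) s1)) \<and>
     ((\<forall>v\<in>mem t s1. \<not> P v (mem t s1)) \<or> card (mem t (sem (For v (Var 1) b) s1)) < card (mem t s1))"
    if a1: "agree ?W ?A s s1" for s1
  proof -
    have n1: "eval (Var 1) s1 = n" using agreeD(1)[OF a1, of 1] fresh n by simp
    let ?X = "mem t s1"
    \<comment> \<open>The test refers to the current set, so a deletion voids all earlier tests of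
      the round. Hence the alternative: nothing has changed and all tests failed, or the set has
      become smaller.\<close>
    define I where "I j s' \<longleftrightarrow> (rem P)\<^sup>*\<^sup>* ?X (mem t s') \<and>
      ((mem t s' = ?X \<and> (\<forall>v\<in>?X. v < j \<longrightarrow> \<not> P v ?X)) \<or> card (mem t s') < card ?X)" for j s'
    have "I (eval (Var 1) s1) (sem (For v (Var 1) b) s1)"
    proof (rule For_rule)
      show "I 0 s1" by (simp add: I_def)
      fix j s' assume j: "j < eval (Var 1) s1" and I: "I j s'" and "agree (insert v (wrv b)) (wra b) s1 s'"
      then have "agree ?W ?A s1 s'" unfolding frame_b agree_def by auto
      then have a': "agree ?W ?A s s'" using a1 agree_trans by blast
      note bd = body[OF a' j[unfolded n1]]
      show "I (Suc j) (sem b (set_var v j s'))"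
      proof (cases "j \<in> mem t s' \<and> P j (mem t s')")
        case True
        then have "rem P (mem t s') (mem t (sem b (set_var v j s')))" using bd by (auto simp: rem_def)
        moreover have "card (mem t (sem b (set_var v j s'))) < card (mem t s')"
        proof -
          have "mem t (sem b (set_var v j s')) = mem t s' - {j}" using True bd by simp
          then show ?thesis using card_Diff1_less[OF finite_mem] True by (simp only:)
        qed
        ultimately show ?thesis using I unfolding I_def by auto
      next
        case False
        have "mem t (sem b (set_var v j s')) = mem t s'" by (rule trans[OF bd if_not_P[OF False]])
        then show ?thesis using I False unfolding I_def by (auto simp: less_Suc_eq)
      qed
    qed
    then show ?thesis using mem_sub[of t s1] unfolding I_def n1 by auto
  qed
  define J where "J i s' \<longleftrightarrow> (rem P)\<^sup>*\<^sup>* X (mem t s') \<and>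
    ((\<forall>v\<in>mem t s'. \<not> P v (mem t s')) \<or> card (mem t s') + i \<le> card X)" for i s'
  have "J (eval (Var 1) s) (sem (For r (Var 1) (For v (Var 1) b)) s)"
  proof (rule For_rule)
    show "J 0 s" by (simp add: J_def X_def)
    fix i s' assume J: "J i s'" and "agree (insert r (wrv (For v (Var 1) b))) (wra (For v (Var 1) b)) s s'"
    then have "agree ?W ?A s s'" by (simp add: frame_b)
    then have "agree ?W ?A s (set_var r i s')" by (rule agree_trans[OF _ agree_set_var]) simp
    note inn = inner[OF this]
    show "J (Suc i) (sem (For v (Var 1) b) (set_var r i s'))"
    proof (cases "\<forall>v\<in>mem t s'. \<not> P v (mem t s')")
      case True
      then have "mem t (sem (For v (Var 1) b) (set_var r i s')) = mem t s'"
        using rem_fixpoint[of P] inn by (simp del: sem.simps)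
      then show ?thesis using J True unfolding J_def by simp
    next
      case False
      then show ?thesis using J inn unfolding J_def by (auto simp del: sem.simps)
    qed
  qed
  then have J: "J n (sem (sweep t r v c f) s)" using n by (simp add: sweep_def b_def)
  then show "(rem P)\<^sup>*\<^sup>* X Y" by (simp add: J_def Y_def)
  \<comment> \<open>After \<open>n\<close> rounds without a fixed point the set is empty, and the
    empty set is a fixed point.\<close>
  have "card X \<le> n" using card_mono[OF _ mem_sub[of t s]] by (simp add: X_def)
  then have "card Y = 0 \<or> (\<forall>v\<in>Y. \<not> P v Y)" using J unfolding J_def Y_def by linarith
  then show "\<forall>v\<in>Y. \<not> P v Y" using finite_mem[of t] by (auto simp: Y_def)
qed


lemma copy_com_frame: "wrv (copy_com t t') = {21}" "wra (copy_com t t') = {t}"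
  by (auto simp: copy_com_def)

lemma copy_com_correct:
  assumes "vr s 1 = n" "t \<noteq> t'"
  shows "mem t (sem (copy_com t t') s) = mem t' s"
proof -
  define I where "I j s' \<longleftrightarrow> (\<forall>v<j. ar s' t v = ar s t' v)" for j and s' :: st
  have "I (eval (Var 1) s) (sem (copy_com t t') s)"
    unfolding copy_com_def
  proof (rule For_rule)
    fix j s' assume I: "I j s'"
      and a: "agree (insert 21 (wrv (Put t (Var 21) (Arr t' (Var 21))))) (wra (Put t (Var 21) (Arr t' (Var 21)))) s s'"
    have "ar s' t' = ar s t'" using agreeD(2)[OF a, of t'] assms by simp
    then show "I (Suc j) (sem (Put t (Var 21) (Arr t' (Var 21))) (set_var 21 j s'))"
      using I assms by (auto simp: I_def less_Suc_eq)
  qed (simp add: I_def)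
  then show ?thesis using assms by (auto simp: I_def mem_def)
qed

lemma reach_com_frame: "wrv reach_com = {21, 22, 23, 24}" "wra reach_com = {4}"
  by (auto simp: reach_com_def copy_com_frame sweep_frame)

text \<open>The search sweeps over array 4, while its predicate refers to array 3, which it leaves
  alone.\<close>

lemma reach_com_correct:
  assumes "ctx s" "vr s 20 < n"
  shows "unreached (mem 3 s) (vr s 20) (mem 4 (sem reach_com s))"
proof -
  define b where "b = If (adj (Var 21) (Var 24))
            (If (Arr 3 (Var 24)) (If (Arr 4 (Var 24)) Skip (Asg 23 (Cst 1))) Skip) Skip"
  define c where "c = Seq (Asg 23 (Cst 0)) (For 24 (Var 1) b)"
  have fr: "wrv c = {23, 24}" "wra c = {}" by (auto simp: c_def b_def)
  have cond: "vr (sem c s1) 23 \<noteq> 0 \<longleftrightarrow> (\<exists>w\<in>mem 3 s1 - mem 4 s1. E (vr s1 21) w)"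
    if s1: "ctx s1" "vr s1 21 < n" for s1
  proof -
    define s0 where "s0 = set_var 23 0 s1"
    have c0: "ctx s0" using s1 by (simp add: s0_def)
    then have n: "eval (Var 1) s0 = n" by (simp add: ctx_def)
    define I where "I j s' \<longleftrightarrow> (vr s' 23 \<noteq> 0 \<longleftrightarrow> (\<exists>w<j. E (vr s1 21) w \<and> ar s1 3 w \<noteq> 0 \<and> ar s1 4 w = 0))"
      for j and s' :: st
    have "I (eval (Var 1) s0) (sem (For 24 (Var 1) b) s0)"
    proof (rule For_rule)
      show "I 0 s0" by (simp add: I_def s0_def)
      fix j s' assume j: "j < eval (Var 1) s0" and I: "I j s'" and a: "agree (insert 24 (wrv b)) (wra b) s0 s'"
      have "ctx s'" using ctx_agree[OF c0 a] by (simp add: b_def)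
      then have cx: "ctx (set_var 24 j s')" by simp
      have v: "vr s' 21 = vr s1 21" "ar s' = ar s1"
        using agreeD(1)[OF a, of 21] agreeD(2)[OF a] by (auto simp: b_def s0_def)
      then have e: "eval (adj (Var 21) (Var 24)) (set_var 24 j s') = of_bool (E (vr s1 21) j)"
        using eval_adj[OF cx, of "Var 21" "Var 24"] s1 j n by auto
      show "I (Suc j) (sem b (set_var 24 j s'))"
        using I v unfolding I_def b_def by (auto simp: e less_Suc_eq)
    qed
    then have "I n (sem c s1)" using n by (simp add: c_def s0_def)
    then show ?thesis unfolding I_def mem_def by auto
  qed
  define s2 where "s2 = sem (Put 4 (Var 20) (Cst 0)) (sem (copy_com 4 3) s)"
  have "vr (sem (copy_com 4 3) s) 20 = vr s 20" by (simp add: vr_sem copy_com_frame)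
  then have m4: "mem 4 s2 = mem 3 s - {vr s 20}"
    using copy_com_correct[of s 4 3] assms(1) by (simp add: s2_def mem_clear ctx_def)
  have m3: "mem 3 s2 = mem 3 s" unfolding s2_def by (subst mem_sem, simp)+ (simp add: mem_sem copy_com_frame)
  have cx2: "ctx s2" unfolding s2_def using assms(1) by (intro ctx_sem) (simp_all add: copy_com_frame)
  have eq: "sem reach_com s = sem (sweep 4 22 21 c 23) s2"
    by (simp add: reach_com_def s2_def c_def b_def)
  have cnd: "vr (sem c s') 23 \<noteq> 0 \<longleftrightarrow> (\<exists>w\<in>mem 3 s - mem 4 s'. E (vr s' 21) w)"
    if a: "agree (insert 22 (insert 21 (wrv c))) (insert 4 (wra c)) s2 s'" "vr s' 21 < n" for s'
  proof -
    have "ctx s'" using ctx_agree[OF cx2 a(1)] by (simp add: fr)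
    moreover have "mem 3 s' = mem 3 s"
      unfolding m3[symmetric] by (rule mem_cong) (use agreeD(2)[OF a(1), of 3] in \<open>simp add: fr\<close>)
    ultimately show ?thesis using cond[of s'] a(2) by simp
  qed
  have "vr s2 1 = n" using cx2 by (simp add: ctx_def)
  note sw = sweep_correct[where P = "\<lambda>u U. \<exists>w\<in>mem 3 s - U. E u w" and f = 23 and r = 22, OF this _ _ _ cnd]
  show ?thesis unfolding unreached_def eq using sw[folded m4] by (simp add: fr m4)
qed

lemma check_com_frame:
  "wrv check_com = {14, 15, 16, 17, 20, 21, 22, 23, 24, 26}" "wra check_com = {4}"
  by (auto simp: check_com_def reach_com_frame undef_com_frame)

lemma check_com_correct:
  assumes cx: "ctx s"
  shows "vr (sem check_com s) 26 \<noteq> 0 \<longleftrightarrow> cda (mem 3 s)"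
proof -
  define b1 where "b1 = If (Arr 3 (Var 21)) (Seq (Asg 20 (Var 21)) (Asg 26 (Cst 1))) Skip"
  define b2 where "b2 = If (Arr 4 (Var 21)) (Asg 26 (Cst 0)) Skip"
  define b3 where "b3 = If (Arr 3 (Var 21)) (Seq (undef_com 3 21) (If (Var 14) (Asg 26 (Cst 0)) Skip)) Skip"
  define s0 where "s0 = sem (Asg 26 (Cst 0)) s"
  define s1 where "s1 = sem (For 21 (Var 1) b1) s0"
  define s2 where "s2 = sem reach_com s1"
  define s3 where "s3 = sem (For 21 (Var 1) b2) s2"
  define s4 where "s4 = sem (For 21 (Var 1) b3) s3"
  have cx0: "ctx s0" using cx by (simp add: s0_def)
  have cx1: "ctx s1" unfolding s1_def by (rule ctx_sem[OF cx0]) (simp_all add: b1_def)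
  have cx2: "ctx s2" unfolding s2_def by (rule ctx_sem[OF cx1]) (simp_all add: reach_com_frame)
  have cx3: "ctx s3" unfolding s3_def by (rule ctx_sem[OF cx2]) (simp_all add: b2_def)
  have n: "eval (Var 1) s0 = n" "eval (Var 1) s2 = n" "eval (Var 1) s3 = n"
    using cx0 cx2 cx3 by (simp_all add: ctx_def)
  have m1: "mem 3 s1 = mem 3 s" unfolding s1_def by (subst mem_sem) (simp_all add: b1_def s0_def)
  have m2: "mem 3 s2 = mem 3 s" unfolding s2_def by (subst mem_sem) (simp_all add: reach_com_frame m1)
  have m3: "mem 3 s3 = mem 3 s" unfolding s3_def by (subst mem_sem) (simp_all add: b2_def m2)
  have eq: "sem check_com s = (if vr s1 26 \<noteq> 0 then s4 else s1)"
    by (simp add: check_com_def s0_def s1_def s2_def s3_def s4_def b1_def b2_def b3_def del: sem.simps(6))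
  define I1 where "I1 j s' \<longleftrightarrow> (vr s' 26 \<noteq> 0 \<longleftrightarrow> (\<exists>w<j. ar s 3 w \<noteq> 0)) \<and>
      (vr s' 26 \<noteq> 0 \<longrightarrow> vr s' 20 < j \<and> ar s 3 (vr s' 20) \<noteq> 0)" for j and s' :: st
  have "I1 (eval (Var 1) s0) s1"
    unfolding s1_def
  proof (rule For_rule)
    show "I1 0 s0" by (simp add: I1_def s0_def)
    fix j s' assume I: "I1 j s'" and a: "agree (insert 21 (wrv b1)) (wra b1) s0 s'"
    have "ar s' = ar s" using agreeD(2)[OF a] by (auto simp: b1_def s0_def)
    then show "I1 (Suc j) (sem b1 (set_var 21 j s'))"
      using I unfolding I1_def b1_def by (auto simp: less_Suc_eq)
  qed
  then have s1: "vr s1 26 \<noteq> 0 \<longleftrightarrow> mem 3 s \<noteq> {}" "vr s1 26 \<noteq> 0 \<Longrightarrow> vr s1 20 \<in> mem 3 s"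
    unfolding n I1_def mem_def by auto
  show ?thesis
  proof (cases "vr s1 26 = 0")
    \<comment> \<open>No start vertex was found, so the set is empty, and the empty set does not
      count as connected.\<close>
    case True
    then show ?thesis using s1 eq by (simp add: cda_def conn_def)
  next
    case False
    then have v20: "vr s1 20 \<in> mem 3 s" using s1 by simp
    then have "vr s1 20 < n" by (simp add: mem_def)
    from reach_com_correct[OF cx1 this] have "unreached (mem 3 s) (vr s1 20) (mem 4 s2)"
      unfolding m1 s2_def .
    then have conn: "conn (mem 3 s) \<longleftrightarrow> mem 4 s2 = {}" using unreached_conn_iff v20 by blast
    have f2: "vr s2 26 \<noteq> 0" using False by (simp add: s2_def vr_sem reach_com_frame)
    define I2 where "I2 j s' \<longleftrightarrow> (vr s' 26 \<noteq> 0 \<longleftrightarrow> \<not> (\<exists>w<j. ar s2 4 w \<noteq> 0))" for j and s' :: st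
    have "I2 (eval (Var 1) s2) s3"
      unfolding s3_def
    proof (rule For_rule)
      show "I2 0 s2" using f2 by (simp add: I2_def)
      fix j s' assume I: "I2 j s'" and a: "agree (insert 21 (wrv b2)) (wra b2) s2 s'"
      have "ar s' = ar s2" using agreeD(2)[OF a] by (auto simp: b2_def)
      then show "I2 (Suc j) (sem b2 (set_var 21 j s'))"
        using I unfolding I2_def b2_def by (auto simp: less_Suc_eq)
    qed
    moreover have "mem 4 s2 = {} \<longleftrightarrow> \<not> (\<exists>w<n. ar s2 4 w \<noteq> 0)" by (auto simp: mem_def)
    ultimately have s3: "vr s3 26 \<noteq> 0 \<longleftrightarrow> conn (mem 3 s)"
      unfolding n I2_def conn by simp
    define I3 where "I3 j s' \<longleftrightarrow> (vr s' 26 \<noteq> 0 \<longleftrightarrow> vr s3 26 \<noteq> 0 \<and>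
        \<not> (\<exists>w\<in>mem 3 s. w < j \<and> undefended (mem 3 s) w))" for j and s' :: st
    have "I3 (eval (Var 1) s3) s4"
      unfolding s4_def
    proof (rule For_rule)
      show "I3 0 s3" by (simp add: I3_def)
      fix j s' assume j: "j < eval (Var 1) s3" and I: "I3 j s'" and a: "agree (insert 21 (wrv b3)) (wra b3) s3 s'"
      have ar: "ar s' = ar s3" using agreeD(2)[OF a] by (auto simp: b3_def undef_com_frame)
      let ?s = "set_var 21 j s'"
      have m: "mem 3 s' = mem 3 s" unfolding m3[symmetric] by (rule mem_cong) (simp add: ar)
      have "ctx s'" using ctx_agree[OF cx3 a] by (simp add: b3_def undef_com_frame)
      then have u: "vr (sem (undef_com 3 21) ?s) 14 \<noteq> 0 \<longleftrightarrow> undefended (mem 3 s) j"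
        using undef_com_correct[of ?s 21 3] j n by (simp add: m)
      have v: "vr (sem (undef_com 3 21) ?s) 26 = vr s' 26" by (simp add: vr_sem undef_com_frame)
      have "ar s' 3 j \<noteq> 0 \<longleftrightarrow> j \<in> mem 3 s" using m j n by (auto simp: mem_def)
      then show "I3 (Suc j) (sem b3 ?s)"
        using I u v unfolding I3_def b3_def by (auto simp: less_Suc_eq)
    qed
    then have "vr s4 26 \<noteq> 0 \<longleftrightarrow> cda (mem 3 s)"
      using s3 mem_sub[of 3 s] unfolding n I3_def cda_def da_def by auto
    then show ?thesis using eq False by simp
  qed
qed

lemma shrink_com_frame:
  "wrv shrink_com = {12, 13, 14, 15, 16, 17, 20, 21, 22, 23, 24, 26}" "wra shrink_com = {2, 3, 4}"
  by (auto simp: shrink_com_def sweep_frame copy_com_frame check_com_frame)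

lemma shrink_com_correct:
  assumes cx: "ctx s"
  defines "Y \<equiv> mem 2 (sem shrink_com s)"
  shows "shrinks_to (mem 2 s) Y" "\<forall>v\<in>Y. \<not> cda (Y - {v})"
proof -
  define c where "c = Seq (copy_com 3 2) (Seq (Put 3 (Var 12) (Cst 0)) check_com)"
  have fr: "wrv c = {14, 15, 16, 17, 20, 21, 22, 23, 24, 26}" "wra c = {3, 4}"
    by (auto simp: c_def copy_com_frame check_com_frame)
  have cnd: "vr (sem c s') 26 \<noteq> 0 \<longleftrightarrow> cda (mem 2 s' - {vr s' 12})"
    if a: "agree (insert 13 (insert 12 (wrv c))) (insert 2 (wra c)) s s'" for s'
  proof -
    have cx': "ctx s'" using ctx_agree[OF cx a] by (simp add: fr)
    define s2 where "s2 = sem (Put 3 (Var 12) (Cst 0)) (sem (copy_com 3 2) s')"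
    have cx2: "ctx s2" unfolding s2_def using cx' by (intro ctx_sem) (simp_all add: copy_com_frame)
    have "vr (sem (copy_com 3 2) s') 12 = vr s' 12" by (simp add: vr_sem copy_com_frame)
    then have "mem 3 s2 = mem 2 s' - {vr s' 12}"
      using copy_com_correct[of s' 3 2] cx' by (simp add: s2_def mem_clear ctx_def)
    then show ?thesis using check_com_correct[OF cx2] by (simp add: c_def s2_def)
  qed
  have "vr s 1 = n" using cx by (simp add: ctx_def)
  note sw = sweep_correct[where P = "\<lambda>v X. cda (X - {v})" and f = 26, OF this _ _ _ cnd]
  show "shrinks_to (mem 2 s) Y" "\<forall>v\<in>Y. \<not> cda (Y - {v})"
    unfolding Y_def shrink_com_def c_def[symmetric] using sw by (simp_all add: fr)
qed

lemma decode_com_frame: "wrv decode_com = {9, 18, 19, 21}" "wra decode_com = {2}"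
  by (auto simp: decode_com_def)

lemma decode_com_correct:
  assumes "vr s 1 = n"
  shows "mem 2 (sem decode_com s) = {..<n} - {ar s 1 i | i. i < vr s 7 \<and> odd (vr s 6 div 2 ^ i)}"
proof -
  define b1 where "b1 = Put 2 (Var 21) (Cst 1)"
  define b2 where "b2 = Seq (Asg 19 (Hlf (Var 18)))
       (Seq (If (Minus (Var 18) (Plus (Var 19) (Var 19))) (Put 2 (Arr 1 (Var 9)) (Cst 0)) Skip)
            (Asg 18 (Var 19)))"
  define s1 where "s1 = sem (For 21 (Var 1) b1) s"
  define s2 where "s2 = sem (Asg 18 (Var 6)) s1"
  have eq: "sem decode_com s = sem (For 9 (Var 7) b2) s2"
    by (simp add: decode_com_def s1_def s2_def b1_def b2_def del: sem.simps(6))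
  define I1 where "I1 j s' \<longleftrightarrow> (\<forall>v<j. ar s' 2 v \<noteq> 0)" for j and s' :: st
  have "I1 (eval (Var 1) s) s1"
    unfolding s1_def by (rule For_rule) (auto simp: I1_def b1_def less_Suc_eq)
  then have m1: "mem 2 s1 = {..<n}" using assms by (auto simp: I1_def mem_def)
  have s2: "vr s2 18 = vr s 6" "vr s2 7 = vr s 7" "ar s2 1 = ar s 1"
    unfolding s2_def s1_def by (simp_all add: vr_sem ar_sem b1_def del: sem.simps(6))
  define I2 where "I2 j s' \<longleftrightarrow> vr s' 18 = vr s 6 div 2 ^ j \<and>
     mem 2 s' = {..<n} - {ar s 1 i | i. i < j \<and> odd (vr s 6 div 2 ^ i)}" for j and s' :: st
  have "I2 (eval (Var 7) s2) (sem (For 9 (Var 7) b2) s2)"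
  proof (rule For_rule)
    show "I2 0 s2" using m1 s2 by (simp add: I2_def s2_def)
    fix j s' assume I: "I2 j s'" and a: "agree (insert 9 (wrv b2)) (wra b2) s2 s'"
    have ar1: "ar s' 1 = ar s 1" using agreeD(2)[OF a, of 1] s2 by (simp add: b2_def)
    let ?m = "vr s 6 div 2 ^ j"
    have hm: "m - (m div 2 + m div 2) \<noteq> 0 \<longleftrightarrow> odd m" for m :: nat by presburger
    have set: "{ar s 1 i | i. i < Suc j \<and> odd (vr s 6 div 2 ^ i)} =
        {ar s 1 i | i. i < j \<and> odd (vr s 6 div 2 ^ i)} \<union> (if odd ?m then {ar s 1 j} else {})"
      by (auto simp: less_Suc_eq)
    have div: "vr s 6 div 2 ^ Suc j = ?m div 2" by (simp only: power_Suc2 div_mult2_eq)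
    have "mem 2 (sem b2 (set_var 9 j s')) = (if odd ?m then mem 2 s' - {ar s 1 j} else mem 2 s')"
      using I ar1 hm unfolding I2_def b2_def by (auto simp: mem_clear)
    moreover have "vr (sem b2 (set_var 9 j s')) 18 = ?m div 2"
      using I unfolding I2_def b2_def by simp
    ultimately show "I2 (Suc j) (sem b2 (set_var 9 j s'))"
      using I unfolding I2_def set div by auto
  qed
  then show ?thesis using s2 unfolding eq I2_def by simp
qed

lemma run_com_frame:
  "wrv run_com = {0, 9, 12, 13, 14, 15, 16, 17, 18, 19, 20, 21, 22, 23, 24, 25, 26}"
  "wra run_com = {2, 3, 4}"
  by (auto simp: run_com_def decode_com_frame sweep_frame undef_com_frame copy_com_frame
      reach_com_frame shrink_com_frame)

text \<open>The loops fix some order of deletions and so some \<open>Z\<close> and \<open>Y\<close>.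
  Which ones is left open, as \<open>guess_complete\<close> covers all of them.\<close>

lemma run_com_correct:
  assumes cx: "ctx s" and a: "vr s 3 < n"
  defines "F \<equiv> {ar s 1 i | i. i < vr s 7 \<and> odd (vr s 6 div 2 ^ i)}"
  shows "\<exists>Z. peeled F Z \<and>
     (if vr s 3 \<in> Z
      then \<exists>Y. shrunk_component (vr s 3) Z Y \<and>
             vr (sem run_com s) 0 = (if vr s 2 \<le> card Y then 1 else vr s 0)
      else vr (sem run_com s) 0 = vr s 0)"
proof -
  define b1 where "b1 = If (Arr 4 (Var 21)) (Put 2 (Var 21) (Cst 0)) Skip"
  define b2 where "b2 = If (Arr 2 (Var 21)) (Asg 25 (Plus (Var 25) (Cst 1))) Skip"
  define s1 where "s1 = sem decode_com s"
  define s2 where "s2 = sem (sweep 2 13 12 (undef_com 2 12) 14) s1"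
  define s3 where "s3 = sem (Asg 20 (Var 3)) (sem (copy_com 3 2) s2)"
  define s4 where "s4 = sem reach_com s3"
  define s5 where "s5 = sem (For 21 (Var 1) b1) s4"
  define s6 where "s6 = sem (Asg 25 (Cst 0)) (sem shrink_com s5)"
  define s7 where "s7 = sem (For 21 (Var 1) b2) s6"
  have eq: "sem run_com s = (if ar s2 2 (vr s2 3) \<noteq> 0
      then if vr s7 2 - vr s7 25 \<noteq> 0 then s7 else set_var 0 1 s7 else s2)"
    unfolding run_com_def s1_def s2_def s3_def s4_def s5_def s6_def s7_def b1_def b2_def
    by (simp del: sem.simps(6))
  note frames = decode_com_frame sweep_frame undef_com_frame copy_com_frame reach_com_frame shrink_com_frame
  have cx1: "ctx s1" unfolding s1_def by (rule ctx_sem[OF cx]) (simp_all add: frames)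
  have cx2: "ctx s2" unfolding s2_def by (rule ctx_sem[OF cx1]) (simp_all add: frames)
  have cx3: "ctx s3" unfolding s3_def using ctx_sem[OF cx2, of "copy_com 3 2"] by (simp add: frames)
  have cx4: "ctx s4" unfolding s4_def by (rule ctx_sem[OF cx3]) (simp_all add: frames)
  have cx5: "ctx s5" unfolding s5_def by (rule ctx_sem[OF cx4]) (simp_all add: b1_def)
  have cx6: "ctx s6" unfolding s6_def using ctx_sem[OF cx5, of shrink_com] by (simp add: frames)
  have n1: "vr s1 1 = n" and n4: "eval (Var 1) s4 = n" and n6: "eval (Var 1) s6 = n"
    using cx1 cx4 cx6 by (simp_all add: ctx_def)
  have m1: "mem 2 s1 = {..<n} - F"
    unfolding s1_def F_def using decode_com_correct cx by (simp add: ctx_def)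
  have cnd: "vr (sem (undef_com 2 12) s') 14 \<noteq> 0 \<longleftrightarrow> undefended (mem 2 s') (vr s' 12)"
    if a: "agree (insert 13 (insert 12 (wrv (undef_com 2 12)))) (insert 2 (wra (undef_com 2 12))) s1 s'"
      "vr s' 12 < n" for s'
  proof -
    have "ctx s'" using ctx_agree[OF cx1 a(1)] by (simp add: frames)
    then show ?thesis using undef_com_correct[of s' 12 2] a(2) by simp
  qed
  note sw = sweep_correct[where P = "\<lambda>v X. undefended X v" and f = 14 and r = 13 and v = 12 and t = 2, OF n1 _ _ _ cnd]
  have peeled: "peeled F (mem 2 s2)"
    unfolding peeled_def s2_def using sw[unfolded m1] by (simp add: frames)
  have v3: "vr s2 3 = vr s 3" and v0: "vr s2 0 = vr s 0" and v2: "vr s2 2 = vr s 2"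
    unfolding s2_def s1_def by (simp_all add: vr_sem frames)
  have cond: "ar s2 2 (vr s2 3) \<noteq> 0 \<longleftrightarrow> vr s 3 \<in> mem 2 s2" using a v3 by (simp add: mem_def)
  show ?thesis
  proof (cases "vr s 3 \<in> mem 2 s2")
    case False
    then show ?thesis using peeled eq cond v0 by (intro exI[of _ "mem 2 s2"]) simp
  next
    case True
    have s3: "mem 3 s3 = mem 2 s2" "mem 2 s3 = mem 2 s2" "vr s3 20 = vr s 3"
      unfolding s3_def using copy_com_correct[of s2 3 2] cx2 v3
      by (simp_all add: ctx_def mem_sem vr_sem frames)
    then have un: "unreached (mem 2 s2) (vr s 3) (mem 4 s4)"
      using reach_com_correct[OF cx3] a by (simp add: s4_def)
    have m24: "mem 2 s4 = mem 2 s2" unfolding s4_def using s3 by (simp add: mem_sem frames)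
    define I where "I j s' \<longleftrightarrow> mem 2 s' = mem 2 s4 - {v \<in> mem 4 s4. v < j}" for j and s' :: st
    have "I (eval (Var 1) s4) s5"
      unfolding s5_def
    proof (rule For_rule)
      show "I 0 s4" by (simp add: I_def)
      fix j s' assume j: "j < eval (Var 1) s4" and I: "I j s'" and ag: "agree (insert 21 (wrv b1)) (wra b1) s4 s'"
      have "ar s' 4 = ar s4 4" using agreeD(2)[OF ag, of 4] by (simp add: b1_def)
      then have "ar s' 4 j \<noteq> 0 \<longleftrightarrow> j \<in> mem 4 s4" using j n4 by (simp add: mem_def)
      then have "mem 2 (sem b1 (set_var 21 j s')) = (if j \<in> mem 4 s4 then mem 2 s' - {j} else mem 2 s')"
        by (simp add: b1_def mem_clear)
      then show "I (Suc j) (sem b1 (set_var 21 j s'))"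
        using I unfolding I_def by (auto simp: less_Suc_eq)
    qed
    then have m5: "mem 2 s5 = mem 2 s2 - mem 4 s4"
      unfolding I_def n4 m24 using mem_sub[of 4 s4] by auto
    let ?Y = "mem 2 (sem shrink_com s5)"
    have Y: "shrunk_component (vr s 3) (mem 2 s2) ?Y"
      unfolding shrunk_component_def using un shrink_com_correct[OF cx5] by (auto simp: m5)
    have m6: "mem 2 s6 = ?Y" by (simp add: s6_def)
    define J where "J j s' \<longleftrightarrow> vr s' 25 = card {v. v < j \<and> v \<in> ?Y}" for j and s' :: st
    have "J (eval (Var 1) s6) s7"
      unfolding s7_def
    proof (rule For_rule)
      show "J 0 s6" by (simp add: J_def s6_def)
      fix j s' assume j: "j < eval (Var 1) s6" and J: "J j s'" and ag: "agree (insert 21 (wrv b2)) (wra b2) s6 s'"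
      have "ar s' 2 = ar s6 2" using agreeD(2)[OF ag, of 2] by (simp add: b2_def)
      then have "ar s' 2 j \<noteq> 0 \<longleftrightarrow> j \<in> ?Y" using j n6 m6 by (auto simp: mem_def)
      then show "J (Suc j) (sem b2 (set_var 21 j s'))"
        using J unfolding J_def b2_def by (simp add: card_less_Suc)
    qed
    moreover have "{v. v < n \<and> v \<in> ?Y} = ?Y" using mem_sub[of 2] by auto
    ultimately have v25: "vr s7 25 = card ?Y" unfolding J_def n6 by simp
    have "vr s7 2 = vr s2 2" "vr s7 0 = vr s2 0"
      unfolding s7_def s6_def s5_def s4_def s3_def b1_def b2_def
      by (simp_all add: vr_sem frames del: sem.simps(6))
    then have "vr (sem run_com s) 0 = (if vr s 2 \<le> card ?Y then 1 else vr s 0)"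
      using eq cond True v25 v0 v2 by simp
    then show ?thesis using peeled True Y by (intro exI[of _ "mem 2 s2"]) auto
  qed
qed

end

section \<open>Enumeration of the guesses\<close>

text \<open>Neighbours are appended without a test for repetition. A round then multiplies the
  length of the list by at most \<open>\<Delta> + 1\<close>, which is where
  \<open>2 * (\<Delta> + 1) ^ (k + 4)\<close> comes from.\<close>

definition nbrs_com :: com where
  "nbrs_com = For 10 (Var 1) (If (adj (Arr 1 (Var 9)) (Var 10))
     (Seq (Put 1 (Var 7) (Var 10)) (Asg 7 (Plus (Var 7) (Cst 1)))) Skip)"

text \<open>The length is copied to variable 8, which the loop body does not assign, so that
  \<open>tm_le\<close> applies to the loop.\<close>

definition round_com :: com where
  "round_com = Seq (Asg 8 (Var 7)) (For 9 (Var 8) nbrs_com)"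

definition ball_com :: com where
  "ball_com = Seq (Put 1 (Cst 0) (Var 3)) (Seq (Put 1 (Cst 1) (Var 4)) (Seq (Asg 7 (Cst 2))
     (For 11 (Plus (Var 2) (Cst 4)) round_com)))"

definition pow_com :: com where
  "pow_com = Seq (Asg 5 (Cst 1)) (For 9 (Var 7) (Asg 5 (Plus (Var 5) (Var 5))))"

definition pair_com :: com where
  "pair_com = Seq ball_com (Seq pow_com (For 6 (Var 5) run_com))"

definition init_com :: com where
  "init_com = Seq (Asg 1 (Arr 0 (Cst 1))) (Seq (Asg 2 (Arr 0 (Cst 2))) (Seq (Asg 0 (Cst 0))
     (Seq (Asg 18 (Cst 3)) (For 17 (Var 1) (Seq (Put 5 (Var 17) (Var 18)) (Asg 18 (Plus (Var 18) (Var 1))))))))"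

definition main_com :: com where
  "main_com = Seq init_com (For 3 (Var 1) (For 4 (Var 1) pair_com))"

lemma bits_exist:
  assumes "S \<subseteq> {..<l}"
  shows "\<exists>m::nat. m < 2 ^ l \<and> (\<forall>i. odd (m div 2 ^ i) \<longleftrightarrow> i \<in> S)"
proof -
  have fin: "finite S" using assms finite_subset by blast
  have "odd (set_encode S div 2 ^ i) \<longleftrightarrow> i \<in> S" for i
    using set_encode_inverse[OF fin] unfolding set_decode_def by blast
  moreover have "set_encode S \<le> (\<Sum>i<l. 2 ^ i)"
    unfolding set_encode_def using assms by (intro sum_mono2) auto
  moreover have "(\<Sum>i<l. 2 ^ i) < (2::nat) ^ l" by (induction l) auto
  ultimately show ?thesis by (meson le_less_trans)
qed

lemma ball_frames:
  "wrv nbrs_com = {7, 10}" "wra nbrs_com = {1}"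
  "wrv round_com = {7, 8, 9, 10}" "wra round_com = {1}"
  "wrv ball_com = {7, 8, 9, 10, 11}" "wra ball_com = {1}"
  "wrv pow_com = {5, 9}" "wra pow_com = {}"
  by (auto simp: nbrs_com_def round_com_def ball_com_def pow_com_def)

context graph_run
begin

lemma pair_frame:
  "wrv pair_com = {0, 5, 6, 7, 8, 9, 10, 11, 12, 13, 14, 15, 16, 17, 18, 19, 20, 21, 22, 23, 24, 25, 26}"
  "wra pair_com = {1, 2, 3, 4}"
  by (auto simp: pair_com_def ball_frames run_com_frame)

definition lst :: "st \<Rightarrow> nat set" where
  "lst s = ar s 1 ` {..<vr s 7}"

text \<open>The third conclusion lets a round go on reading the old entries of the list while new
  ones are appended to it.\<close>

lemma nbrs_com_correct:
  assumes cx: "ctx s" and i: "vr s 9 < vr s 7" and x: "ar s 1 (vr s 9) = x" "x < n"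
  shows "lst (sem nbrs_com s) = lst s \<union> {u. u < n \<and> E x u}"
    "vr (sem nbrs_com s) 7 = vr s 7 + nb {..<n} x"
    "\<And>i. i < vr s 7 \<Longrightarrow> ar (sem nbrs_com s) 1 i = ar s 1 i"
proof -
  define b where "b = If (adj (Arr 1 (Var 9)) (Var 10))
     (Seq (Put 1 (Var 7) (Var 10)) (Asg 7 (Plus (Var 7) (Cst 1)))) Skip"
  define I where "I j s' \<longleftrightarrow> lst s' = lst s \<union> {u. u < j \<and> E x u} \<and>
     vr s' 7 = vr s 7 + card {u. u < j \<and> E x u} \<and> (\<forall>i<vr s 7. ar s' 1 i = ar s 1 i)" for j and s' :: st
  have n: "eval (Var 1) s = n" using cx by (simp add: ctx_def)
  have "I (eval (Var 1) s) (sem (For 10 (Var 1) b) s)"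
  proof (rule For_rule)
    show "I 0 s" by (simp add: I_def)
    fix j s' assume j: "j < eval (Var 1) s" and I: "I j s'" and a: "agree (insert 10 (wrv b)) (wra b) s s'"
    let ?s = "set_var 10 j s'"
    have "ctx s'" using ctx_agree[OF cx a] by (simp add: b_def)
    then have cx': "ctx ?s" by simp
    have v9: "vr s' 9 = vr s 9" using agreeD(1)[OF a, of 9] by (simp add: b_def)
    have "eval (Arr 1 (Var 9)) ?s = x" using I i x v9 by (simp add: I_def)
    then have e: "eval (adj (Arr 1 (Var 9)) (Var 10)) ?s = of_bool (E x j)"
      using eval_adj[OF cx', of "Arr 1 (Var 9)" "Var 10"] x j n by simp
    have l: "lst (sem b ?s) = (if E x j then insert j (lst s') else lst s')"
    proof (cases "E x j")
      case True
      then have "sem b ?s = set_var 7 (vr s' 7 + 1) (set_arr 1 (vr s' 7) j ?s)" by (simp add: b_def e del: One_nat_def)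
      then show ?thesis using True by (auto simp: lst_def lessThan_Suc)
    next
      case False
      then show ?thesis by (simp add: b_def e lst_def del: One_nat_def)
    qed
    show "I (Suc j) (sem b ?s)"
      unfolding I_def l
    proof (intro conjI)
      show "(if E x j then insert j (lst s') else lst s') = lst s \<union> {u. u < Suc j \<and> E x u}"
        using I by (auto simp: I_def less_Suc_eq)
      show "vr (sem b ?s) 7 = vr s 7 + card {u. u < Suc j \<and> E x u}"
        using I by (simp add: I_def b_def e card_less_Suc del: One_nat_def)
      show "\<forall>i<vr s 7. ar (sem b ?s) 1 i = ar s 1 i"
        using I by (auto simp: I_def b_def e simp del: One_nat_def)
    qed
  qed
  then have I: "I n (sem nbrs_com s)" unfolding n nbrs_com_def b_def .
  have "{u. u < n \<and> E x u} = {u \<in> {..<n}. E x u}" by auto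
  then show "lst (sem nbrs_com s) = lst s \<union> {u. u < n \<and> E x u}"
    "vr (sem nbrs_com s) 7 = vr s 7 + nb {..<n} x"
    "\<And>i. i < vr s 7 \<Longrightarrow> ar (sem nbrs_com s) 1 i = ar s 1 i"
    using I unfolding I_def nb_def by auto
qed

lemma round_com_correct:
  assumes cx: "ctx s" and V: "lst s \<subseteq> {..<n}" and deg: "\<And>v. v < n \<Longrightarrow> nb {..<n} v \<le> d"
  shows "lst (sem round_com s) = lst s \<union> {u. u < n \<and> (\<exists>x\<in>lst s. E x u)}"
    "vr (sem round_com s) 7 \<le> vr s 7 * (d + 1)"
proof -
  define s0 where "s0 = set_var 8 (vr s 7) s"
  define I where "I j s' \<longleftrightarrow> lst s' = lst s \<union> {u. u < n \<and> (\<exists>i<j. E (ar s 1 i) u)} \<and>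
     vr s 7 \<le> vr s' 7 \<and> vr s' 7 \<le> vr s 7 + j * d \<and> (\<forall>i<vr s 7. ar s' 1 i = ar s 1 i)" for j and s' :: st
  have cx0: "ctx s0" using cx by (simp add: s0_def)
  have n: "eval (Var 8) s0 = vr s 7" by (simp add: s0_def)
  have "I (eval (Var 8) s0) (sem (For 9 (Var 8) nbrs_com) s0)"
  proof (rule For_rule)
    show "I 0 s0" by (simp add: I_def s0_def lst_def)
    fix j s' assume j: "j < eval (Var 8) s0" and I: "I j s'"
      and a: "agree (insert 9 (wrv nbrs_com)) (wra nbrs_com) s0 s'"
    let ?s = "set_var 9 j s'" and ?x = "ar s 1 j"
    have "ctx s'" using ctx_agree[OF cx0 a] by (simp add: ball_frames)
    then have cx': "ctx ?s" by simp
    have x: "?x < n" using V j n by (auto simp: lst_def)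
    have pre: "vr ?s 9 < vr ?s 7" "ar ?s 1 (vr ?s 9) = ?x" using I j n by (auto simp: I_def)
    note nb = nbrs_com_correct[OF cx' pre x]
    have lst9: "lst ?s = lst s'" by (simp add: lst_def)
    show "I (Suc j) (sem nbrs_com ?s)"
      unfolding I_def
    proof (intro conjI)
      show "lst (sem nbrs_com ?s) = lst s \<union> {u. u < n \<and> (\<exists>i<Suc j. E (ar s 1 i) u)}"
        using I unfolding nb(1) lst9 I_def by (auto simp: less_Suc_eq)
      show "vr s 7 \<le> vr (sem nbrs_com ?s) 7" "vr (sem nbrs_com ?s) 7 \<le> vr s 7 + Suc j * d"
        using I deg[OF x] unfolding nb(2) I_def by auto
      show "\<forall>i<vr s 7. ar (sem nbrs_com ?s) 1 i = ar s 1 i"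
        using I nb(3) unfolding I_def by auto
    qed
  qed
  then have I: "I (vr s 7) (sem round_com s)" unfolding n by (simp add: round_com_def s0_def)
  then show "lst (sem round_com s) = lst s \<union> {u. u < n \<and> (\<exists>x\<in>lst s. E x u)}"
    unfolding I_def by (auto simp: lst_def[of s])
  show "vr (sem round_com s) 7 \<le> vr s 7 * (d + 1)" using I unfolding I_def by simp
qed

lemma lev_subset: "S \<subseteq> {..<n} \<Longrightarrow> lev {..<n} j S \<subseteq> {..<n}"
  by (induction j) auto

lemma ball_com_correct:
  assumes cx: "ctx s" and ab: "vr s 3 < n" "vr s 4 < n" and deg: "\<And>v. v < n \<Longrightarrow> nb {..<n} v \<le> d"
  defines "L \<equiv> 2 * (d + 1) ^ (vr s 2 + 4)"
  shows "lst (sem ball_com s) = lev {..<n} (vr s 2 + 4) {vr s 3, vr s 4}"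
    "vr (sem ball_com s) 7 \<le> L"
    "tm ball_com s \<le> 40 + (vr s 2 + 4) * (11 + kc (For 9 (Var 8) nbrs_com) * (n + L + 1) ^ 2)"
proof -
  define s0 where "s0 = set_var 7 2 (set_arr 1 1 (vr s 4) (set_arr 1 0 (vr s 3) s))"
  let ?S = "{vr s 3, vr s 4}"
  define I where "I j s' \<longleftrightarrow> lst s' = lev {..<n} j ?S \<and> vr s' 7 \<le> 2 * (d + 1) ^ j" for j and s' :: st
  have e: "eval (Plus (Var 2) (Cst 4)) s0 = vr s 2 + 4" by (simp add: s0_def)
  have cx0: "ctx s0" unfolding s0_def using cx by (auto intro: ctx_cong)
  have "{..<2::nat} = {0, 1}" by auto
  then have I0: "I 0 s0" by (auto simp: I_def s0_def lst_def)
  have step: "I (Suc j) (sem round_com (set_var 11 j s')) \<and>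
      tm round_com (set_var 11 j s') \<le> 4 + kc (For 9 (Var 8) nbrs_com) * (n + L + 1) ^ 2"
    if j: "j < eval (Plus (Var 2) (Cst 4)) s0" and I: "I j s'"
      and a: "agree (insert 11 (wrv round_com)) (wra round_com) s0 s'" for j s'
  proof
    let ?s = "set_var 11 j s'"
    have "ctx s'" using ctx_agree[OF cx0 a] by (simp add: ball_frames)
    then have cx': "ctx ?s" by simp
    have l: "lst ?s = lev {..<n} j ?S" using I by (simp add: I_def lst_def)
    have sub: "lst ?s \<subseteq> {..<n}" unfolding l using lev_subset ab by simp
    note r = round_com_correct[OF cx' sub deg]
    have "vr (sem round_com ?s) 7 \<le> vr ?s 7 * (d + 1)" using r(2) by blast
    also have "\<dots> \<le> 2 * (d + 1) ^ j * (d + 1)" using I by (intro mult_le_mono) (simp_all add: I_def)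
    finally have "vr (sem round_com ?s) 7 \<le> 2 * (d + 1) ^ Suc j" by (simp add: ac_simps)
    moreover have "lst (sem round_com ?s) = lev {..<n} (Suc j) ?S" using r(1) unfolding l by auto
    ultimately show "I (Suc j) (sem round_com ?s)" unfolding I_def by blast
    have "vr s' 7 \<le> 2 * (d + 1) ^ j" using I by (simp add: I_def)
    also have "\<dots> \<le> L" unfolding L_def using j e by (intro mult_le_mono2 power_increasing) auto
    finally have l7: "vr s' 7 \<le> L" .
    have "tm (For 9 (Var 8) nbrs_com) (set_var 8 (vr s' 7) ?s) \<le>
        kc (For 9 (Var 8) nbrs_com) * (n + L + 1) ^ dep (For 9 (Var 8) nbrs_com)"
      by (rule tm_le[of "{1, 8}"]) (use cx' l7 in \<open>auto simp: nbrs_com_def ctx_def\<close>)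
    moreover have "dep (For 9 (Var 8) nbrs_com) = 2" by (simp add: nbrs_com_def)
    ultimately have "tm (For 9 (Var 8) nbrs_com) (set_var 8 (vr s' 7) ?s) \<le>
        kc (For 9 (Var 8) nbrs_com) * (n + L + 1) ^ 2" by (simp only:)
    then show "tm round_com ?s \<le> 4 + kc (For 9 (Var 8) nbrs_com) * (n + L + 1) ^ 2"
      by (simp add: round_com_def del: tm.simps(6) kc.simps)
  qed
  have "I (eval (Plus (Var 2) (Cst 4)) s0) (sem (For 11 (Plus (Var 2) (Cst 4)) round_com) s0)"
    by (rule For_rule[of I, OF I0]) (use step in blast)
  then have "I (vr s 2 + 4) (sem ball_com s)" unfolding e by (simp add: ball_com_def s0_def)
  then show "lst (sem ball_com s) = lev {..<n} (vr s 2 + 4) {vr s 3, vr s 4}"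
    "vr (sem ball_com s) 7 \<le> L" unfolding I_def L_def by auto
  have "tm (For 11 (Plus (Var 2) (Cst 4)) round_com) s0 \<le> 9 + (vr s 2 + 4) *
      (7 + (4 + kc (For 9 (Var 8) nbrs_com) * (n + L + 1) ^ 2))"
  proof -
    have "tm (For 11 (Plus (Var 2) (Cst 4)) round_com) s0 \<le> ecost (Plus (Var 2) (Cst 4)) + 5 +
        eval (Plus (Var 2) (Cst 4)) s0 * (7 + (4 + kc (For 9 (Var 8) nbrs_com) * (n + L + 1) ^ 2))"
      by (rule For_time[of I, OF I0 step])
    then show ?thesis unfolding e by (simp del: tm.simps kc.simps)
  qed
  then show "tm ball_com s \<le> 40 + (vr s 2 + 4) * (11 + kc (For 9 (Var 8) nbrs_com) * (n + L + 1) ^ 2)"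
    by (simp add: ball_com_def s0_def del: tm.simps(6) kc.simps)
qed

lemma pow_com_correct: "vr (sem pow_com s) 5 = 2 ^ vr s 7"
proof -
  have "vr (sem (For 9 (Var 7) (Asg 5 (Plus (Var 5) (Var 5)))) s0) 5 = 2 ^ eval (Var 7) s0"
    if "vr s0 5 = 1" for s0
    by (rule For_rule[where I = "\<lambda>j s. vr s 5 = 2 ^ j"]) (use that in auto)
  from this[of "set_var 5 1 s"] show ?thesis by (simp add: pow_com_def)
qed

definition solvable :: "nat \<Rightarrow> bool" where
  "solvable k \<longleftrightarrow> (\<exists>D. loc_min D \<and> k \<le> card D)"

definition good_guess :: "nat \<Rightarrow> nat \<Rightarrow> nat set \<Rightarrow> bool" where
  "good_guess k a F \<longleftrightarrow> (\<forall>Z. peeled F Z \<longrightarrow> a \<in> Z \<and> (\<forall>Y. shrunk_component a Z Y \<longrightarrow> k \<le> card Y))"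

text \<open>Soundness as a relation between states, which composes along loops: the answer is left
  alone, or set to 1 when a witness exists.\<close>

definition answer :: "nat \<Rightarrow> st \<Rightarrow> st \<Rightarrow> bool" where
  "answer k s s' \<longleftrightarrow> (vr s' 0 = vr s 0 \<or> vr s' 0 = 1 \<and> solvable k)"

lemma run_com_answer:
  assumes "ctx s" "vr s 3 < n"
  shows "answer (vr s 2) s (sem run_com s)"
    "good_guess (vr s 2) (vr s 3) {ar s 1 i | i. i < vr s 7 \<and> odd (vr s 6 div 2 ^ i)} \<Longrightarrow> vr (sem run_com s) 0 = 1"
proof -
  obtain Z where Z: "peeled {ar s 1 i | i. i < vr s 7 \<and> odd (vr s 6 div 2 ^ i)} Z"
    "if vr s 3 \<in> Z
      then \<exists>Y. shrunk_component (vr s 3) Z Y \<and>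
             vr (sem run_com s) 0 = (if vr s 2 \<le> card Y then 1 else vr s 0)
      else vr (sem run_com s) 0 = vr s 0"
    using run_com_correct[OF assms] by blast
  show "answer (vr s 2) s (sem run_com s)"
    using Z shrunk_component_loc_min unfolding answer_def solvable_def
    by (metis (no_types, lifting))
  show "vr (sem run_com s) 0 = 1"
    if "good_guess (vr s 2) (vr s 3) {ar s 1 i | i. i < vr s 7 \<and> odd (vr s 6 div 2 ^ i)}"
    using Z that unfolding good_guess_def by auto
qed

lemma pair_com_correct:
  assumes cx: "ctx s" and ab: "vr s 3 < n" "vr s 4 < n" and deg: "\<And>v. v < n \<Longrightarrow> nb {..<n} v \<le> d"
    and k: "vr s 2 = k"
  defines "L \<equiv> 2 * (d + 1) ^ (k + 4)"
  shows "answer k s (sem pair_com s)"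
    "F \<subseteq> lev {..<n} (k + 4) {vr s 3, vr s 4} \<Longrightarrow> good_guess k (vr s 3) F \<Longrightarrow> vr (sem pair_com s) 0 = 1"
    "tm pair_com s \<le> 40 + (k + 4) * (11 + kc (For 9 (Var 8) nbrs_com) * (n + L + 1) ^ 2)
       + kc pow_com * (n + L + 1) + (7 + 2 ^ L * (7 + kc run_com * (n + L + 1) ^ 5))"
proof -
  define s1 where "s1 = sem ball_com s"
  define s2 where "s2 = sem pow_com s1"
  have cx1: "ctx s1" unfolding s1_def by (rule ctx_sem[OF cx]) (simp_all add: ball_frames)
  have cx2: "ctx s2" unfolding s2_def by (rule ctx_sem[OF cx1]) (simp_all add: ball_frames)
  note ball = ball_com_correct[OF cx ab deg, unfolded k, folded L_def s1_def]
  have s2: "vr s2 5 = 2 ^ vr s1 7" "vr s2 7 = vr s1 7" "ar s2 = ar s1" "vr s2 3 = vr s 3" "vr s2 2 = k"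
    "vr s2 0 = vr s 0"
    using pow_com_correct[of s1] k unfolding s2_def s1_def
    by (auto simp: vr_sem ar_sem ball_frames fun_eq_iff)
  have eq: "sem pair_com s = sem (For 6 (Var 5) run_com) s2" by (simp add: pair_com_def s1_def s2_def)
  define G where "G m = {ar s1 1 i | i. i < vr s1 7 \<and> odd (m div 2 ^ i)}" for m :: nat
  define I where "I j s' \<longleftrightarrow> answer k s2 s' \<and> (\<forall>m<j. good_guess k (vr s 3) (G m) \<longrightarrow> vr s' 0 = 1)"
    for j and s' :: st
  have I0: "I 0 s2" by (simp add: I_def answer_def)
  have step: "I (Suc j) (sem run_com (set_var 6 j s')) \<and>
      tm run_com (set_var 6 j s') \<le> kc run_com * (n + L + 1) ^ 5"
    if I: "I j s'" and a: "agree (insert 6 (wrv run_com)) (wra run_com) s2 s'" for j s'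
  proof
    let ?s = "set_var 6 j s'"
    have "ctx s'" using ctx_agree[OF cx2 a] by (simp add: run_com_frame)
    then have cx': "ctx ?s" by simp
    have v: "vr s' 3 = vr s 3" "vr s' 2 = k" "vr s' 7 = vr s1 7" "ar s' 1 = ar s1 1"
      using agreeD(1)[OF a, of 3] agreeD(1)[OF a, of 2] agreeD(1)[OF a, of 7] agreeD(2)[OF a, of 1] s2
      by (simp_all add: run_com_frame)
    have "answer k ?s (sem run_com ?s)" "good_guess k (vr s 3) (G j) \<Longrightarrow> vr (sem run_com ?s) 0 = 1"
      using run_com_answer[OF cx'] ab by (simp_all add: v G_def del: One_nat_def)
    then show "I (Suc j) (sem run_com ?s)"
      using I unfolding I_def answer_def by (auto simp: less_Suc_eq)
    have "tm run_com ?s \<le> kc run_com * (n + L + 1) ^ dep run_com"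
      by (rule tm_le[of "{1, 7}"])
        (use cx' v ball(2) in \<open>auto simp: run_com_frame ctx_def, auto simp: run_com_def decode_com_def
          sweep_def undef_com_def copy_com_def reach_com_def shrink_com_def check_com_def\<close>)
    \<comment> \<open>The five nested loops are the two of the shrinking sweep, the two of the
      search inside its test, and the scan for neighbours.\<close>
    moreover have "dep run_com = 5"
      by (simp add: run_com_def decode_com_def sweep_def undef_com_def copy_com_def reach_com_def
          shrink_com_def check_com_def)
    ultimately show "tm run_com ?s \<le> kc run_com * (n + L + 1) ^ 5" by simp
  qed
  have "I (eval (Var 5) s2) (sem (For 6 (Var 5) run_com) s2)"
    by (rule For_rule[of I, OF I0]) (use step in blast)
  then have I: "I (2 ^ vr s1 7) (sem pair_com s)" unfolding eq using s2 by simp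
  then show "answer k s (sem pair_com s)" using s2 by (simp add: I_def answer_def)
  show "vr (sem pair_com s) 0 = 1"
    if F: "F \<subseteq> lev {..<n} (k + 4) {vr s 3, vr s 4}" "good_guess k (vr s 3) F"
  proof -
    have Fl: "F \<subseteq> lst s1" using F(1) ball(1) by simp
    \<comment> \<open>All positions of the list that hold an element of \<open>F\<close> are marked,
      repetitions included. As \<open>F\<close> is contained in the list, this code decodes to
      \<open>F\<close>.\<close>
    obtain m :: nat where m: "m < 2 ^ vr s1 7" "\<And>i. odd (m div 2 ^ i) \<longleftrightarrow> i \<in> {i. i < vr s1 7 \<and> ar s1 1 i \<in> F}"
      using bits_exist[of "{i. i < vr s1 7 \<and> ar s1 1 i \<in> F}" "vr s1 7"] by auto
    have "G m = F" unfolding G_def m(2) using Fl by (auto simp: lst_def)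
    then show ?thesis using I m(1) F(2) unfolding I_def by blast
  qed
  have "tm pow_com s1 \<le> kc pow_com * (n + L + 1) ^ dep pow_com"
    by (rule tm_le[of "{7}"]) (use ball(2) in \<open>auto simp: pow_com_def\<close>)
  moreover have "dep pow_com = 1" by (simp add: pow_com_def)
  moreover have "tm (For 6 (Var 5) run_com) s2 \<le> 7 + 2 ^ L * (7 + kc run_com * (n + L + 1) ^ 5)"
  proof -
    have "tm (For 6 (Var 5) run_com) s2 \<le> 7 + 2 ^ vr s1 7 * (7 + kc run_com * (n + L + 1) ^ 5)"
      using For_time[of I s2 "Var 5", OF I0 step] s2 by simp
    also have "\<dots> \<le> 7 + 2 ^ L * (7 + kc run_com * (n + L + 1) ^ 5)"
      using ball(2) by (intro add_le_mono mult_le_mono power_increasing) auto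
    finally show ?thesis .
  qed
  ultimately show "tm pair_com s \<le> 40 + (k + 4) * (11 + kc (For 9 (Var 8) nbrs_com) * (n + L + 1) ^ 2)
       + kc pow_com * (n + L + 1) + (7 + 2 ^ L * (7 + kc run_com * (n + L + 1) ^ 5))"
    using ball(3) by (simp add: pair_com_def s1_def s2_def del: tm.simps(6) kc.simps)
qed


lemma init_com_correct:
  assumes inp: "ar s 0 1 = n" "ar s 0 2 = k" "\<And>u v. u < n \<Longrightarrow> v < n \<Longrightarrow> ar s 0 (3 + u * n + v) = of_bool (E u v)"
  shows "ctx (sem init_com s)" "vr (sem init_com s) 2 = k" "vr (sem init_com s) 0 = 0"
    "tm init_com s \<le> 26 + 40 * (n + 1)"
proof -
  define b where "b = Seq (Put 5 (Var 17) (Var 18)) (Asg 18 (Plus (Var 18) (Var 1)))"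
  define s0 where "s0 = set_var 18 3 (set_var 0 0 (set_var 2 k (set_var 1 n s)))"
  have s0: "sem (Asg 18 (Cst 3)) (sem (Asg 0 (Cst 0)) (sem (Asg 2 (Arr 0 (Cst 2))) (sem (Asg 1 (Arr 0 (Cst 1))) s))) = s0"
    using inp by (simp add: s0_def)
  have eq: "sem init_com s = sem (For 17 (Var 1) b) s0"
    unfolding init_com_def b_def sem.simps(4) s0 ..
  have n: "eval (Var 1) s0 = n" by (simp add: s0_def)
  define I where "I j s' \<longleftrightarrow> vr s' 18 = 3 + j * n \<and> (\<forall>u<j. ar s' 5 u = 3 + u * n)" for j and s' :: st
  have "I (eval (Var 1) s0) (sem (For 17 (Var 1) b) s0)"
  proof (rule For_rule)
    show "I 0 s0" by (simp add: I_def s0_def)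
    fix j s' assume I: "I j s'" and a: "agree (insert 17 (wrv b)) (wra b) s0 s'"
    have "vr s' 1 = n" using agreeD(1)[OF a, of 1] n by (simp add: b_def)
    then show "I (Suc j) (sem b (set_var 17 j s'))" using I by (auto simp: I_def b_def less_Suc_eq)
  qed
  then have I: "I n (sem init_com s)" unfolding n eq .
  have fr: "vr (sem init_com s) 1 = n" "vr (sem init_com s) 2 = k" "vr (sem init_com s) 0 = 0"
    "ar (sem init_com s) 0 = ar s 0"
    unfolding eq by (simp_all add: vr_sem ar_sem b_def s0_def del: sem.simps(6))
  then show "vr (sem init_com s) 2 = k" "vr (sem init_com s) 0 = 0" by blast+
  show "ctx (sem init_com s)" using fr I inp(3) by (auto simp: ctx_def I_def)
  have "tm (For 17 (Var 1) b) s0 \<le> kc (For 17 (Var 1) b) * (n + 1) ^ dep (For 17 (Var 1) b)"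
    by (rule tm_le[of "{1}"]) (use n in \<open>auto simp: b_def\<close>)
  moreover have "kc (For 17 (Var 1) b) \<le> 40" "dep (For 17 (Var 1) b) = 1" by (simp_all add: b_def)
  ultimately have "tm (For 17 (Var 1) b) s0 \<le> 40 * (n + 1)"
    by (metis mult_le_mono1 order_trans power_one_right)
  moreover have "tm init_com s = 26 + tm (For 17 (Var 1) b) s0"
    unfolding init_com_def b_def[symmetric] tm.simps(4) s0 by simp
  ultimately show "tm init_com s \<le> 26 + 40 * (n + 1)" by simp
qed

lemma main_com_correct:
  assumes inp: "ar s 0 1 = n" "ar s 0 2 = k" "\<And>u v. u < n \<Longrightarrow> v < n \<Longrightarrow> ar s 0 (3 + u * n + v) = of_bool (E u v)"
    and deg: "\<And>v. v < n \<Longrightarrow> nb {..<n} v \<le> d"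
  defines "L \<equiv> 2 * (d + 1) ^ (k + 4)"
  defines "T \<equiv> 40 + (k + 4) * (11 + kc (For 9 (Var 8) nbrs_com) * (n + L + 1) ^ 2)
       + kc pow_com * (n + L + 1) + (7 + 2 ^ L * (7 + kc run_com * (n + L + 1) ^ 5))"
  shows "vr (sem main_com s) 0 = (if solvable k then 1 else 0)"
    "tm main_com s \<le> 26 + 40 * (n + 1) + (7 + n * (7 + (7 + n * (7 + T))))"
proof -
  define s1 where "s1 = sem init_com s"
  note init = init_com_correct[OF inp, folded s1_def]
  \<comment> \<open>A pair that admits a good set \<open>F\<close>. One such pair suffices, since
    the answer is never reset.\<close>
  define found where "found a b \<longleftrightarrow> (\<exists>F\<subseteq>lev {..<n} (k + 4) {a, b}. good_guess k a F)" for a b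
  define I where "I a s' \<longleftrightarrow> answer k s1 s' \<and> (\<forall>a'<a. \<forall>b<n. found a' b \<longrightarrow> vr s' 0 = 1)" for a and s' :: st
  have n: "eval (Var 1) s1 = n" using init(1) by (simp add: ctx_def)
  have step: "I (Suc a) (sem (For 4 (Var 1) pair_com) (set_var 3 a s')) \<and>
       tm (For 4 (Var 1) pair_com) (set_var 3 a s') \<le> 7 + n * (7 + T)"
    if a: "a < eval (Var 1) s1" and I: "I a s'"
      and ag: "agree (insert 3 (wrv (For 4 (Var 1) pair_com))) (wra (For 4 (Var 1) pair_com)) s1 s'" for a s'
  proof -
    let ?s = "set_var 3 a s'"
    have "ctx s'" using ctx_agree[OF init(1) ag] by (simp add: pair_frame)
    then have cx: "ctx ?s" by simp
    have k: "vr s' 2 = k" using agreeD(1)[OF ag, of 2] init(2) by (simp add: pair_frame)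
    have n': "eval (Var 1) ?s = n" using cx by (simp add: ctx_def)
    define J where "J b s2 \<longleftrightarrow> answer k s1 s2 \<and> (\<forall>a'<a. \<forall>b<n. found a' b \<longrightarrow> vr s2 0 = 1) \<and>
      (\<forall>b'<b. found a b' \<longrightarrow> vr s2 0 = 1)" for b and s2 :: st
    have J0: "J 0 ?s" using I by (simp add: I_def J_def answer_def)
    have jstep: "J (Suc b) (sem pair_com (set_var 4 b s2)) \<and> tm pair_com (set_var 4 b s2) \<le> T"
      if b: "b < eval (Var 1) ?s" and J: "J b s2"
        and ag2: "agree (insert 4 (wrv pair_com)) (wra pair_com) ?s s2" for b s2
    proof -
      let ?t = "set_var 4 b s2"
      have "ctx s2" using ctx_agree[OF cx ag2] by (simp add: pair_frame)
      then have cx2: "ctx ?t" by simp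
      have v: "vr s2 3 = a" "vr s2 2 = k"
        using agreeD(1)[OF ag2, of 3] agreeD(1)[OF ag2, of 2] k by (simp_all add: pair_frame)
      have ab: "vr ?t 3 < n" "vr ?t 4 < n" "vr ?t 2 = k" using v a b n n' by simp_all
      note p = pair_com_correct[OF cx2 ab(1,2) deg ab(3), folded L_def, folded T_def]
      have "found a b \<Longrightarrow> vr (sem pair_com ?t) 0 = 1"
        using p(2) v unfolding found_def by auto
      moreover have "answer k ?t (sem pair_com ?t)" using p(1) by blast
      ultimately have "J (Suc b) (sem pair_com ?t)"
        using J unfolding J_def answer_def by (auto simp: less_Suc_eq)
      then show ?thesis using p(3) by blast
    qed
    have "J (eval (Var 1) ?s) (sem (For 4 (Var 1) pair_com) ?s)"
      by (rule For_rule[of J, OF J0]) (use jstep in blast)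
    then have "I (Suc a) (sem (For 4 (Var 1) pair_com) ?s)"
      unfolding n' I_def J_def by (auto simp: less_Suc_eq)
    moreover have "tm (For 4 (Var 1) pair_com) ?s \<le> ecost (Var 1) + 5 + eval (Var 1) ?s * (7 + T)"
      by (rule For_time[of J, OF J0 jstep])
    ultimately show ?thesis unfolding n' by simp
  qed
  have I0: "I 0 s1" by (simp add: I_def answer_def)
  have "I (eval (Var 1) s1) (sem (For 3 (Var 1) (For 4 (Var 1) pair_com)) s1)"
    by (rule For_rule[of I, OF I0]) (use step in blast)
  moreover have "sem main_com s = sem (For 3 (Var 1) (For 4 (Var 1) pair_com)) s1"
    by (simp add: main_com_def s1_def)
  ultimately have I: "I n (sem main_com s)" unfolding n by (simp only:)
  show "vr (sem main_com s) 0 = (if solvable k then 1 else 0)"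
  proof (cases "solvable k")
    case True
    then obtain a b where "a < n" "b < n" "found a b"
      using guess_complete unfolding solvable_def found_def good_guess_def by (metis lessThan_iff)
    then show ?thesis using I True unfolding I_def by simp
  next
    case False
    then show ?thesis using I init(3) unfolding I_def answer_def by simp
  qed
  have "tm (For 3 (Var 1) (For 4 (Var 1) pair_com)) s1 \<le>
      ecost (Var 1) + 5 + eval (Var 1) s1 * (7 + (7 + n * (7 + T)))"
    by (rule For_time[of I, OF I0 step])
  then show "tm main_com s \<le> 26 + 40 * (n + 1) + (7 + n * (7 + (7 + n * (7 + T))))"
    using init(4) unfolding n main_com_def by (simp add: s1_def del: tm.simps(6))
qed

end

section \<open>The parameter-dependent factor is computable\<close>

text \<open>Multiplication by \<open>p + 2\<close> is repeated addition, done \<open>p + 4\<close>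
  times from 16 on; then \<open>C\<close> is doubled as often as the result says.\<close>

definition budget_com :: "nat \<Rightarrow> com" where
  "budget_com C = Seq (Asg 1 (Arr 0 (Cst 1))) (Seq (Asg 2 (Cst 16))
     (Seq (For 3 (Plus (Var 1) (Cst 4))
       (Seq (Asg 4 (Cst 0)) (Seq (For 5 (Plus (Var 1) (Cst 2)) (Asg 4 (Plus (Var 4) (Var 2)))) (Asg 2 (Var 4)))))
     (Seq (Asg 0 (Cst C)) (For 3 (Var 2) (Asg 0 (Plus (Var 0) (Var 0)))))))"

lemma budget_com_correct:
  assumes "ar s 0 1 = p"
  shows "vr (sem (budget_com C) s) 0 = C * 2 ^ (16 * (p + 2) ^ (p + 4))"
proof -
  define m where "m = For 5 (Plus (Var 1) (Cst 2)) (Asg 4 (Plus (Var 4) (Var 2)))"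
  define b where "b = Seq (Asg 4 (Cst 0)) (Seq m (Asg 2 (Var 4)))"
  have fr: "wrv m = {4, 5}" "wra m = {}" by (auto simp: m_def)
  have m: "vr (sem m s) 4 = (vr s 1 + 2) * vr s 2" if "vr s 4 = 0" for s
  proof -
    define I where "I j s' \<longleftrightarrow> vr s' 4 = j * vr s 2" for j and s' :: st
    have "I (eval (Plus (Var 1) (Cst 2)) s) (sem m s)"
      unfolding m_def
    proof (rule For_rule)
      show "I 0 s" using that by (simp add: I_def)
      fix j s' assume I: "I j s'" and a: "agree (insert 5 (wrv (Asg 4 (Plus (Var 4) (Var 2)))))
         (wra (Asg 4 (Plus (Var 4) (Var 2)))) s s'"
      have "vr s' 2 = vr s 2" using agreeD(1)[OF a, of 2] by simp
      then show "I (Suc j) (sem (Asg 4 (Plus (Var 4) (Var 2))) (set_var 5 j s'))" using I by (simp add: I_def)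
    qed
    then show ?thesis by (simp add: I_def)
  qed
  define s1 where "s1 = set_var 2 16 (set_var 1 p s)"
  define s2 where "s2 = sem (For 3 (Plus (Var 1) (Cst 4)) b) s1"
  define I where "I j s' \<longleftrightarrow> vr s' 2 = 16 * (p + 2) ^ j" for j and s' :: st
  have "I (eval (Plus (Var 1) (Cst 4)) s1) s2"
    unfolding s2_def
  proof (rule For_rule)
    show "I 0 s1" by (simp add: I_def s1_def)
    fix j s' assume I: "I j s'" and a: "agree (insert 3 (wrv b)) (wra b) s1 s'"
    have "vr s' 1 = p" using agreeD(1)[OF a, of 1] by (simp add: b_def fr s1_def)
    then show "I (Suc j) (sem b (set_var 3 j s'))"
      using I m[of "set_var 4 0 (set_var 3 j s')"] by (simp add: I_def b_def)
  qed
  then have s2: "vr s2 2 = 16 * (p + 2) ^ (p + 4)" by (simp add: I_def s1_def)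
  define s3 where "s3 = set_var 0 C s2"
  define J where "J j s' \<longleftrightarrow> vr s' 0 = C * 2 ^ j" for j and s' :: st
  have "J (eval (Var 2) s3) (sem (For 3 (Var 2) (Asg 0 (Plus (Var 0) (Var 0)))) s3)"
    by (rule For_rule) (auto simp: J_def s3_def)
  moreover have "sem (Asg 2 (Cst 16)) (sem (Asg 1 (Arr 0 (Cst 1))) s) = s1"
    using assms by (simp add: s1_def)
  then have "sem (budget_com C) s = sem (For 3 (Var 2) (Asg 0 (Plus (Var 0) (Var 0)))) s3"
    unfolding budget_com_def m_def[symmetric] b_def[symmetric] s3_def s2_def by (simp del: sem.simps(6))
  ultimately show ?thesis using s2 by (simp add: J_def s3_def)
qed

lemma budget_computable: "computable (\<lambda>p. C * 2 ^ (16 * (p + 2) ^ (p + 4)))"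
  unfolding computable_def
proof (intro exI[of _ "compile (budget_com C)"] allI)
  fix p
  have "wfc 0 (budget_com C)" by (simp add: budget_com_def)
  then obtain s where s: "\<forall>i<length [p]. ar s 0 (Suc i) = [p] ! i"
    "\<forall>t\<ge>7 * length [p] + 420 + tm (budget_com C) s.
       outputs_within (compile (budget_com C)) [p] t (vr (sem (budget_com C) s) 0)"
    using compile_run[of "[p]" "budget_com C"] by auto
  have "ar s 0 1 = p" using s(1) by simp
  then show "\<exists>t. outputs_within (compile (budget_com C)) [p] t (C * 2 ^ (16 * (p + 2) ^ (p + 4)))"
    using s(2) budget_com_correct[of s p C] by auto
qed

section \<open>Encoded instances\<close>

lemma concat_nth:
  assumes "\<And>u. u < m \<Longrightarrow> length (f u) = n" "u < m" "v < n"
  shows "concat (map f [0..<m]) ! (u * n + v) = f u ! v"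
  using assms
proof (induction m)
  case (Suc m)
  have len: "length (concat (map f [0..<m])) = m * n"
    using Suc.prems(1) by (simp add: length_concat comp_def interv_sum_list_conv_sum_set_nat)
  show ?case
  proof (cases "u = m")
    case True
    then show ?thesis using len Suc.prems by (simp add: nth_append)
  next
    case False
    then have u: "u < m" using Suc.prems by simp
    then have "Suc u * n \<le> m * n" by (intro mult_le_mono1) simp
    then have "u * n + v < m * n" using Suc.prems(3) by simp
    then show ?thesis using Suc u len by (simp add: nth_append)
  qed
qed simp

lemma encode_instance_props:
  fixes k :: nat
  assumes "pverts G = {..<n}"
  defines "xs \<equiv> encode_instance (G, k)"
  shows "length xs = n * n + 2" "xs ! 0 = n" "xs ! 1 = k"
    "\<And>u v. u < n \<Longrightarrow> v < n \<Longrightarrow> xs ! (2 + u * n + v) = of_bool ((u, v) \<in> parcs G)"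
proof -
  define row where "row u = map (\<lambda>v. if (u, v) \<in> parcs G then 1 else 0::nat) [0..<n]" for u
  have xs: "xs = n # k # concat (map row [0..<n])"
    using assms(1) by (simp add: xs_def encode_instance_def Let_def row_def[abs_def])
  show "length xs = n * n + 2"
    by (simp add: xs length_concat comp_def row_def sum_list_triv)
  show "xs ! 0 = n" "xs ! 1 = k" by (simp_all add: xs)
  fix u v assume uv: "u < n" "v < n"
  have "xs ! (2 + u * n + v) = concat (map row [0..<n]) ! (u * n + v)" by (simp add: xs)
  also have "\<dots> = row u ! v" by (rule concat_nth) (use uv in \<open>simp_all add: row_def\<close>)
  finally show "xs ! (2 + u * n + v) = of_bool ((u, v) \<in> parcs G)" using uv by (simp add: row_def)
qed

lemma length_le_input_size: "length xs \<le> input_size xs"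
  unfolding input_size_def by (induction xs) auto

locale instance_graph =
  fixes G :: "nat pair_pre_digraph" and n :: nat
  assumes pg: "pair_graph G" and verts: "pverts G = {..<n}"
begin

abbreviation "E \<equiv> \<lambda>u v. (u, v) \<in> parcs G"

sublocale graph_run n E
proof -
  interpret pair_graph G by (rule pg)
  show "graph_run n E"
  proof
    show "finite {..<n}" by simp
    show "(v, u) \<in> parcs G" if "(u, v) \<in> parcs G" for u v
      using that sym_arcs by (metis graph_symmetric pair_sym_arcs)
    show "u \<in> {..<n}" if "(u, v) \<in> parcs G" for u v using that verts wellformed by fastforce
    show "(u, u) \<notin> parcs G" for u using no_loops by fastforce
  qed
qed

lemma nbrs_in_eq: "nbrs_in G D v = nb D v"
  by (simp add: nbrs_in_def nb_def)

lemma nb_Diff: "D \<subseteq> {..<n} \<Longrightarrow> nb {..<n} v = nb D v + nb ({..<n} - D) v"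
proof -
  assume D: "D \<subseteq> {..<n}"
  then have "{u \<in> {..<n}. E v u} = {u \<in> D. E v u} \<union> {u \<in> {..<n} - D. E v u}" by auto
  moreover have "card ({u \<in> D. E v u} \<union> {u \<in> {..<n} - D. E v u}) = card {u \<in> D. E v u} + card {u \<in> {..<n} - D. E v u}"
    by (rule card_Un_disjoint) (auto simp: finite_nbrs[simplified])
  ultimately show ?thesis unfolding nb_def by simp
qed

text \<open>Arcs are symmetric, so \<open>mk_symmetric\<close> changes nothing. Walks do not leave
  closed sets, and the set reachable from a vertex is closed, which links reachability to
  \<open>conn\<close>.\<close>

lemma connected_iff: "Digraph_Component.connected (with_proj G \<restriction> D) \<longleftrightarrow> conn D"
proof -
  let ?H = "with_proj (mk_symmetric (with_proj G \<restriction> D))"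
  have vH: "verts ?H = D" by (simp add: mk_symmetric_def)
  have aH: "arcs_ends ?H = {(u, v). u \<in> D \<and> v \<in> D \<and> E u v}"
    using E_sym by (auto simp: mk_symmetric_def)
  have "Digraph_Component.connected (with_proj G \<restriction> D) \<longleftrightarrow>
      D \<noteq> {} \<and> (\<forall>u\<in>D. \<forall>v\<in>D. (u, v) \<in> rtrancl_on D {(u, v). u \<in> D \<and> v \<in> D \<and> E u v})"
    unfolding connected_def strongly_connected_def reachable_def vH aH ..
  also have "\<dots> \<longleftrightarrow> conn D"
  proof
    assume H: "D \<noteq> {} \<and> (\<forall>u\<in>D. \<forall>v\<in>D. (u, v) \<in> rtrancl_on D {(u, v). u \<in> D \<and> v \<in> D \<and> E u v})"
    show "conn D"
      unfolding conn_def
    proof (intro conjI allI impI)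
      fix S assume S: "closed_in D S \<and> S \<noteq> {}"
      then obtain a where a: "a \<in> S" by blast
      have "v \<in> S" if v: "v \<in> D" for v
      proof -
        have "(a, v) \<in> rtrancl_on D {(u, v). u \<in> D \<and> v \<in> D \<and> E u v}"
          using H a v S unfolding closed_in_def by blast
        then show ?thesis
          by (induction rule: rtrancl_on_induct) (use a S in \<open>auto simp: closed_in_def\<close>)
      qed
      then show "S = D" using S unfolding closed_in_def by blast
    qed (use H in blast)
  next
    assume c: "conn D"
    have "(u, v) \<in> rtrancl_on D {(u, v). u \<in> D \<and> v \<in> D \<and> E u v}" if "u \<in> D" "v \<in> D" for u v
    proof -
      let ?S = "{v \<in> D. (u, v) \<in> rtrancl_on D {(u, v). u \<in> D \<and> v \<in> D \<and> E u v}}"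
      have "closed_in D ?S"
        unfolding closed_in_def by (auto intro: rtrancl_on_into_rtrancl_on)
      moreover have "u \<in> ?S" using that by auto
      ultimately have "?S = D" using conn_closedD[OF c] by blast
      then show ?thesis using that by blast
    qed
    then show "D \<noteq> {} \<and> (\<forall>u\<in>D. \<forall>v\<in>D. (u, v) \<in> rtrancl_on D {(u, v). u \<in> D \<and> v \<in> D \<and> E u v})"
      using c unfolding conn_def by blast
  qed
  finally show ?thesis .
qed

lemma connected_defensive_alliance_iff: "connected_defensive_alliance G D \<longleftrightarrow> cda D"
proof -
  have "(\<forall>v\<in>D. nbrs_in G (pverts G - D) v \<le> nbrs_in G D v + 1) \<longleftrightarrow> (\<forall>v\<in>D. \<not> undefended D v)"
    if "D \<subseteq> {..<n}"
    using nb_Diff[OF that] unfolding nbrs_in_eq verts undefended_def by (auto simp: not_less)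
  then show ?thesis
    unfolding connected_defensive_alliance_def defensive_alliance_def cda_def connected_iff da_def verts
    by (auto simp: conn_def)
qed

lemma CLMDA_iff: "CLMDA (G, k) \<longleftrightarrow> solvable k"
  by (simp add: CLMDA_def solvable_def connected_locally_minimal_defensive_alliance_def loc_min_def
      connected_defensive_alliance_iff)

lemma nb_le_max_degree: "v < n \<Longrightarrow> nb {..<n} v \<le> max_degree G"
  unfolding max_degree_def verts nbrs_in_eq by (intro Max_ge) auto

end

section \<open>Estimate of the total running time\<close>

text \<open>A bound in \<open>k\<close> and \<open>d\<close> has to become one in
  \<open>p = k + d\<close> alone: \<open>(p + 2) ^ (p + 4)\<close> dominates both
  \<open>(d + 1) ^ (k + 4)\<close> and \<open>k + 4\<close>. The exponent 7 has two factors from the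
  pairs of vertices and five from the nested loops of a run.\<close>

lemma time_bound:
  fixes n k d S B1 B2 B3 :: nat
  defines "L \<equiv> 2 * (d + 1) ^ (k + 4)"
  defines "T \<equiv> 40 + (k + 4) * (11 + B1 * (n + L + 1) ^ 2)
       + B2 * (n + L + 1) + (7 + 2 ^ L * (7 + B3 * (n + L + 1) ^ 5))"
  assumes S: "n * n + 2 \<le> S"
  shows "7 * (n * n + 2) + 420 + (26 + 40 * (n + 1) + (7 + n * (7 + (7 + n * (7 + T)))))
     \<le> (600 + B1 + B2 + B3) * 2 ^ (16 * (k + d + 2) ^ (k + d + 4)) * S ^ 7"
proof -
  define X where "X = (k + d + 2) ^ (k + d + 4)"
  define Q where "Q = 2 * X + 1"
  define W where "W = (n + 1) * Q"
  \<comment> \<open>The common yardstick for one pair: \<open>Q\<close> exceeds both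
    \<open>L\<close> and \<open>k + 3\<close>, the power of two bounds the number of codes, and
    \<open>W ^ 5\<close> bounds the polynomial part.\<close>
  define H where "H = Q * 2 ^ (2 * X) * W ^ 5"
  have "(d + 1) ^ (k + 4) \<le> (k + d + 2) ^ (k + 4)" by (rule power_mono) auto
  also have "\<dots> \<le> X" unfolding X_def by (rule power_increasing) auto
  finally have L: "L \<le> 2 * X" by (simp add: L_def)
  have "k + d + 4 < 2 ^ (k + d + 4)" by (rule less_exp)
  also have "\<dots> \<le> X" unfolding X_def by (rule power_mono) auto
  finally have k: "k + 4 \<le> Q" by (simp add: Q_def)
  have "n + L + 1 \<le> n + Q" using L by (simp add: Q_def)
  also have "\<dots> \<le> n * Q + Q" by (simp add: Q_def)
  finally have nL: "n + L + 1 \<le> W" by (simp add: W_def algebra_simps)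
  have W1: "1 \<le> W" "1 \<le> Q" by (simp_all add: W_def Q_def)
  have pow: "W ^ i \<le> W ^ 5" if "i \<le> 5" for i using W1 that by (intro power_increasing) auto
  have e1: "1 \<le> (2::nat) ^ (2 * X)" by simp
  have W5: "1 \<le> W ^ 5" using pow[of 0] by simp
  have H1: "1 \<le> H" unfolding H_def using W1 W5 e1 by (metis mult_le_mono nat_mult_1)
  have QW: "Q * W ^ 5 \<le> H"
    unfolding H_def using e1 by (metis mult_le_mono le_refl mult.commute nat_mult_1)
  have WH: "W ^ 5 \<le> H" using QW W1 by (metis mult_le_mono1 nat_mult_1 order_trans)
  have t1: "(k + 4) * (11 + B1 * (n + L + 1) ^ 2) \<le> (11 + B1) * H"
  proof -
    have "(n + L + 1) ^ 2 \<le> W ^ 5" using power_mono[OF nL, of 2] pow[of 2] by linarith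
    then have "11 + B1 * (n + L + 1) ^ 2 \<le> 11 * W ^ 5 + B1 * W ^ 5"
      using W5 by (intro add_le_mono mult_le_mono2) auto
    then have "(k + 4) * (11 + B1 * (n + L + 1) ^ 2) \<le> Q * (11 * W ^ 5 + B1 * W ^ 5)"
      using k by (intro mult_le_mono)
    also have "\<dots> = (11 + B1) * (Q * W ^ 5)" by (simp add: algebra_simps)
    also have "\<dots> \<le> (11 + B1) * H" using QW by (intro mult_le_mono2)
    finally show ?thesis .
  qed
  have t2: "B2 * (n + L + 1) \<le> B2 * H"
    using nL pow[of 1] WH by (intro mult_le_mono2) simp
  have t3: "2 ^ L * (7 + B3 * (n + L + 1) ^ 5) \<le> (7 + B3) * H"
  proof -
    have "(n + L + 1) ^ 5 \<le> W ^ 5" using nL by (rule power_mono) simp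
    then have "7 + B3 * (n + L + 1) ^ 5 \<le> 7 * W ^ 5 + B3 * W ^ 5"
      using W5 by (intro add_le_mono mult_le_mono2) auto
    moreover have "(2::nat) ^ L \<le> Q * 2 ^ (2 * X)"
      using power_increasing[OF L, of "2::nat"] W1(2) by (metis mult_le_mono nat_mult_1 one_le_numeral)
    ultimately have "2 ^ L * (7 + B3 * (n + L + 1) ^ 5) \<le> (Q * 2 ^ (2 * X)) * (7 * W ^ 5 + B3 * W ^ 5)"
      by (intro mult_le_mono)
    also have "\<dots> = (7 + B3) * H" by (simp add: H_def algebra_simps)
    finally show ?thesis .
  qed
  have "T \<le> 40 * H + (11 + B1) * H + B2 * H + (7 * H + (7 + B3) * H)"
    unfolding T_def using t1 t2 t3 H1 by linarith
  then have T: "T \<le> (65 + B1 + B2 + B3) * H" by (simp add: algebra_simps)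
  let ?A = "n + 1"
  have A1: "?A * H \<le> ?A * ?A * H" by (intro mult_le_mono) auto
  have A0: "H \<le> ?A * H" by simp
  have "n * (7 + T) \<le> ?A * (7 * H + (65 + B1 + B2 + B3) * H)"
    using T H1 by (intro mult_le_mono add_le_mono) auto
  then have "7 + (7 + n * (7 + T)) \<le> ?A * ((86 + B1 + B2 + B3) * H)"
    using H1 A0 by (simp add: algebra_simps)
  then have "n * (7 + (7 + n * (7 + T))) \<le> ?A * (?A * ((86 + B1 + B2 + B3) * H))"
    by (intro mult_le_mono) auto
  also have "\<dots> = (86 + B1 + B2 + B3) * (?A * ?A * H)" by (simp only: ac_simps)
  finally have t4: "n * (7 + (7 + n * (7 + T))) \<le> (86 + B1 + B2 + B3) * (?A * ?A * H)" .
  have "?A * 1 \<le> ?A * H" using H1 by (rule mult_le_mono2)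
  then have "?A \<le> ?A * H" by (simp only: mult_1_right)
  then have A2: "?A \<le> ?A * ?A * H" using A1 by (rule order_trans)
  then have A3: "1 \<le> ?A * ?A * H" by simp
  have "26 + 40 * ?A + (7 + n * (7 + (7 + n * (7 + T)))) \<le> (159 + B1 + B2 + B3) * (?A * ?A * H)"
  proof -
    have "t \<le> (86 + B1 + B2 + B3) * z \<Longrightarrow> a \<le> z \<Longrightarrow> 1 \<le> z \<Longrightarrow>
      26 + 40 * a + (7 + t) \<le> (159 + B1 + B2 + B3) * z" for t a z :: nat
      by (simp add: add_mult_distrib)
    from this[OF t4 A2 A3] show ?thesis .
  qed
  also have "?A * ?A * H \<le> 2 ^ (16 * X) * S ^ 7"
  proof -
    have nS: "?A \<le> S" using S by (cases n) auto
    \<comment> \<open>One factor \<open>Q\<close> from \<open>H\<close> and five from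
      \<open>W ^ 5\<close>, each at most \<open>2 ^ (2 * X)\<close>, together with the codes give
      \<open>2 ^ (14 * X)\<close>; the exponent is rounded up to a power of two times
      \<open>X\<close>.\<close>
    have "Q \<le> 2 ^ (2 * X)" unfolding Q_def using less_exp[of "2 * X"] by (simp only: Suc_eq_plus1[symmetric] Suc_le_eq)
    then have "Q ^ 6 * 2 ^ (2 * X) \<le> (2 ^ (2 * X)) ^ 6 * 2 ^ (2 * X)"
      by (intro mult_le_mono1 power_mono) auto
    also have "\<dots> = 2 ^ (14 * X)" by (simp flip: power_mult power_add)
    also have "\<dots> \<le> 2 ^ (16 * X)" by (intro power_increasing) auto
    finally have "Q ^ 6 * 2 ^ (2 * X) * ?A ^ 7 \<le> 2 ^ (16 * X) * S ^ 7"
      using nS by (intro mult_le_mono power_mono) auto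
    moreover have "?A * ?A * H = Q ^ 6 * 2 ^ (2 * X) * ?A ^ 7"
    proof -
      have "a * a * (q * e * (a * q) ^ 5) = q ^ 6 * e * a ^ 7" for a q e :: nat
        by (simp add: power_mult_distrib eval_nat_numeral ac_simps)
      then show ?thesis unfolding H_def W_def .
    qed
    ultimately show ?thesis by simp
  qed
  finally have main: "26 + 40 * ?A + (7 + n * (7 + (7 + n * (7 + T)))) \<le> (159 + B1 + B2 + B3) * (2 ^ (16 * X) * S ^ 7)"
    by simp
  have "S \<le> S ^ 7" using S by (intro self_le_power) auto
  also have "S ^ 7 \<le> 2 ^ (16 * X) * S ^ 7" by simp
  finally have Sz: "S \<le> 2 ^ (16 * X) * S ^ 7" .
  \<comment> \<open>Here \<open>S\<close> is at least 2, so 420 is at most \<open>210 * S\<close>,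
    and 376 is the sum of 7, 210 and 159.\<close>
  have "m + 2 \<le> S \<Longrightarrow> S \<le> z \<Longrightarrow> t \<le> (159 + B1 + B2 + B3) * z \<Longrightarrow>
      7 * (m + 2) + 420 + t \<le> (376 + B1 + B2 + B3) * z" for m t z :: nat
    by (simp add: add_mult_distrib)
  from this[OF S Sz main]
  have "7 * (n * n + 2) + 420 + (26 + 40 * ?A + (7 + n * (7 + (7 + n * (7 + T)))))
     \<le> (376 + B1 + B2 + B3) * (2 ^ (16 * X) * S ^ 7)" .
  also have "\<dots> \<le> (600 + B1 + B2 + B3) * (2 ^ (16 * X) * S ^ 7)" by (intro mult_le_mono1) simp
  finally show ?thesis by (simp add: X_def mult.assoc)
qed

theorem theorem3:
  "fixed_parameter_tractable clmda_instances encode_instance CLMDA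
     (\<lambda>(G, k). k + max_degree G)"
proof -
  \<comment> \<open>The constant depends only on the text of the program, through the syntactic
    costs \<open>kc\<close>; so one \<open>f\<close> serves all instances.\<close>
  define C where "C = 600 + kc (For 9 (Var 8) nbrs_com) + kc pow_com + kc run_com"
  define f where "f p = C * 2 ^ (16 * (p + 2) ^ (p + 4))" for p :: nat
  have wf: "wfc 0 main_com"
    by (simp add: main_com_def init_com_def pair_com_def ball_com_def round_com_def nbrs_com_def adj_def
        pow_com_def run_com_def decode_com_def sweep_def undef_com_def copy_com_def reach_com_def
        shrink_com_def check_com_def)
  have "outputs_within (compile main_com) (encode_instance x)
      (f (case x of (G, k) \<Rightarrow> k + max_degree G) * input_size (encode_instance x) ^ 7) (if CLMDA x then 1 else 0)"
    if x: "x \<in> clmda_instances" for x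
  proof -
    obtain G k n where Gk: "x = (G, k)" "pair_graph G" "pverts G = {..<n}"
      using x by (auto simp: clmda_instances_def)
    interpret instance_graph G n by (rule instance_graph.intro) (use Gk in auto)
    let ?xs = "encode_instance x"
    note enc = encode_instance_props[OF Gk(3), where k = k, folded Gk(1)]
    have "?xs \<noteq> []" using enc(1) by auto
    then obtain s where s: "\<And>i. i < length ?xs \<Longrightarrow> ar s 0 (Suc i) = ?xs ! i"
      "\<And>t. 7 * length ?xs + 420 + tm main_com s \<le> t \<Longrightarrow>
         outputs_within (compile main_com) ?xs t (vr (sem main_com s) 0)"
      using compile_run[OF _ wf] by blast
    have inp1: "ar s 0 1 = n" using s(1)[of 0] enc by simp
    have inp2: "ar s 0 2 = k" using s(1)[of 1] enc by (simp add: numeral_2_eq_2)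
    have inp3: "ar s 0 (3 + u * n + v) = of_bool ((u, v) \<in> parcs G)" if uv: "u < n" "v < n" for u v
    proof -
      have "Suc u * n \<le> n * n" using uv by (intro mult_le_mono1) simp
      then have "2 + u * n + v < length ?xs" using uv enc(1) by simp
      moreover have "3 + u * n + v = Suc (2 + u * n + v)" by simp
      ultimately show ?thesis using s(1)[of "2 + u * n + v"] enc(4)[OF uv] by (simp only:)
    qed
    have out: "vr (sem main_com s) 0 = (if solvable k then 1 else 0)"
      by (rule main_com_correct(1)[OF inp1 inp2 inp3 nb_le_max_degree])
    have "7 * length ?xs + 420 + tm main_com s \<le> f (k + max_degree G) * input_size ?xs ^ 7"
    proof -
      have "n * n + 2 \<le> input_size ?xs" using length_le_input_size[of ?xs] enc(1) by simp
      note tb = time_bound[OF this, where k = k and d = "max_degree G"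
          and ?B1.0 = "kc (For 9 (Var 8) nbrs_com)" and ?B2.0 = "kc pow_com" and ?B3.0 = "kc run_com"]
      show ?thesis
        unfolding f_def C_def enc(1)
        by (rule order_trans[OF add_le_mono[OF le_refl] tb])
          (rule main_com_correct(2)[OF inp1 inp2 inp3 nb_le_max_degree])
    qed
    then show ?thesis using s(2) out CLMDA_iff[of k] Gk(1) by simp
  qed
  moreover have "computable f" unfolding f_def by (rule budget_computable)
  ultimately show ?thesis unfolding fixed_parameter_tractable_def by blast
qed

end
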